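(* Let $E$ be the equivalence relation of topological conjugacy on the set of Toeplitz $\mathbb{Z}$-subshifts with separated holes (a Borel subset of the standard Borel space $S(\mathbb{Z})$ of all $\mathbb{Z}$-subshifts). Then $E$ is amenable, and consequently, for every Borel probability measure $\mu$ on this set, $E$ is hyperfinite $\mu$-almost everywhere (i.e., there is a $\mu$-conull Borel set on which the restriction of $E$ is hyperfinite).
   Context: The shift action of $\mathbb{Z}$ on $2^{\mathbb{Z}}$ is $(n\cdot x)(m)=x(m-n)$. A $\mathbb{Z}$-subshift is a nonempty closed shift-invariant subset of $2^{\mathbb{Z}}$; $S(\mathbb{Z})$ is the set of subshifts with the Vietoris topology (Effros Borel structure). Two subshifts $S,T$ are topologically conjugate if there is a homeomorphism $S\to T$ commuting with the shift. A word $x\in 2^{\mathbb{Z}}$ is Toeplitz if for every $n\in\mathbb{Z}$ there is $k\ge 1$ with $x(n+ki)=x(n)$ for all $i\in\mathbb{Z}$; a subshift is Toeplitz if it is the orbit closure of a Toeplitz word. For a Toeplitz word $x$ and $p\in\mathbb{N}$, let $\mathrm{Per}_p(x)=\{i+p\mathbb{Z} : x(i+kp)=x(i)\text{ for all }k\in\mathbb{Z}\}\subseteq \mathbb{Z}/p\mathbb{Z}$ and $H_p(x)=(\mathbb{Z}/p\mathbb{Z})\setminus \mathrm{Per}_p(x)$ (the $p$-holes). $x$ has separated holes if $\lim_{p\to\infty}\min\{|i-j| : i,j\in H_p(x), i\ne j\}=\infty$ (distance taken in $\mathbb{Z}/p\mathbb{Z}$); a Toeplitz subshift has separated holes if some (equivalently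 every) Toeplitz word in it has separated holes. A countable Borel equivalence relation $E$ on a standard Borel space $X$ is amenable if there are nonnegative Borel functions $\lambda^n\colon E\to\mathbb{R}$ such that, writing $\lambda^n_x(y)=\lambda^n(x,y)$, each $\lambda^n_x\in\ell^1([x]_E)$ with $\|\lambda^n_x\|_1=1$, and $\lim_n\|\lambda^n_x-\lambda^n_y\|_1=0$ for all $(x,y)\in E$. *)

theory Defs
  imports "HOL-Analysis.Analysis" "HOL-Probability.Probability"
begin

text \<open>
  The space \<open>2\<^sup>\<int>\<close> is the type \<open>int \<Rightarrow> bool\<close>, whose library topology is the product
  of the discrete topologies.
\<close>

definition shift :: "int \<Rightarrow> (int \<Rightarrow> bool) \<Rightarrow> (int \<Rightarrow> bool)" where
  "shift n x = (\<lambda>m. x (m - n))"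

definition subshifts :: "(int \<Rightarrow> bool) set set" where
  "subshifts = {S. S \<noteq> {} \<and> closed S \<and> (\<forall>n. \<forall>x\<in>S. shift n x \<in> S)}"

definition vietoris_subshifts :: "(int \<Rightarrow> bool) set topology" where
  "vietoris_subshifts = topology_generated_by
     ({{S \<in> subshifts. S \<inter> U \<noteq> {}} | U. open U} \<union> {{S \<in> subshifts. S \<subseteq> U} | U. open U})"

definition borel_of :: "'a topology \<Rightarrow> 'a measure" where
  "borel_of X = sigma (topspace X) {U. openin X U}"

definition standard_borel :: "'a measure \<Rightarrow> bool" where
  "standard_borel M \<longleftrightarrow>
     (\<exists>X. completely_metrizable_space X \<and> second_countable X \<and> sets M = sets (borel_of X))"

definition subshift_space :: "(int \<Rightarrow> bool) set measure" where
  "subshift_space = borel_of vietoris_subshifts"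

definition top_conjugate :: "(int \<Rightarrow> bool) set \<Rightarrow> (int \<Rightarrow> bool) set \<Rightarrow> bool" where
  "top_conjugate S T \<longleftrightarrow>
     (\<exists>f g. homeomorphism S T f g \<and> (\<forall>n. \<forall>x\<in>S. f (shift n x) = shift n (f x)))"

definition toeplitz_word :: "(int \<Rightarrow> bool) \<Rightarrow> bool" where
  "toeplitz_word x \<longleftrightarrow> (\<forall>n. \<exists>k\<ge>1. \<forall>i. x (n + k * i) = x n)"

definition toeplitz_subshift :: "(int \<Rightarrow> bool) set \<Rightarrow> bool" where
  "toeplitz_subshift S \<longleftrightarrow> (\<exists>x. toeplitz_word x \<and> S = closure (range (\<lambda>n. shift n x)))"

text \<open>For \<open>p \<ge> 1\<close>, the group \<open>\<int>/p\<int>\<close> is represented by the residues \<open>{0..<p}\<close>.\<close>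

definition Per :: "nat \<Rightarrow> (int \<Rightarrow> bool) \<Rightarrow> int set" where
  "Per p x = {i \<in> {0..<int p}. \<forall>k. x (i + k * int p) = x i}"

definition holes :: "nat \<Rightarrow> (int \<Rightarrow> bool) \<Rightarrow> int set" where
  "holes p x = {0..<int p} - Per p x"

definition cyclic_dist :: "nat \<Rightarrow> int \<Rightarrow> int \<Rightarrow> nat" where
  "cyclic_dist p i j = nat (min ((i - j) mod int p) ((j - i) mod int p))"

text \<open>The infimum in \<open>enat\<close> is \<open>\<infinity>\<close> if there are fewer than two holes.\<close>

definition hole_gap :: "(int \<Rightarrow> bool) \<Rightarrow> nat \<Rightarrow> enat" where
  "hole_gap x p = Inf {enat (cyclic_dist p i j) | i j. i \<in> holes p x \<and> j \<in> holes p x \<and> i \<noteq> j}"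

text \<open>
  The limit \<open>p \<rightarrow> \<infinity>\<close> is taken along the positive integers directed by divisibility. Along the
  usual order it would be degenerate: if \<open>x\<close> takes both values, at positions of periods \<open>k\<close> and
  \<open>l\<close>, then for every \<open>p\<close> coprime to \<open>k * l\<close> all residues modulo \<open>p\<close> are holes, so that
  only constant words would have separated holes.
\<close>

definition separated_holes :: "(int \<Rightarrow> bool) \<Rightarrow> bool" where
  "separated_holes x \<longleftrightarrow>
     (\<forall>N::nat. \<exists>q\<ge>1. \<forall>p\<ge>1. q dvd p \<longrightarrow> enat N \<le> hole_gap x p)"

definition toeplitz_sep :: "(int \<Rightarrow> bool) set set" where
  "toeplitz_sep =
     {S. toeplitz_subshift S \<and> (\<exists>x\<in>S. toeplitz_word x \<and> separated_holes x)}"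

definition conjugacy_sep :: "((int \<Rightarrow> bool) set \<times> (int \<Rightarrow> bool) set) set" where
  "conjugacy_sep = {(S, T). S \<in> toeplitz_sep \<and> T \<in> toeplitz_sep \<and> top_conjugate S T}"

text \<open>
  Standardness of the underlying measurable space is kept as a separate predicate. It passes from a
  standard Borel space to its Borel subsets with the induced Borel structure.
\<close>

definition borel_equiv :: "'a measure \<Rightarrow> ('a \<times> 'a) set \<Rightarrow> bool" where
  "borel_equiv M E \<longleftrightarrow> equiv (space M) E \<and> E \<in> sets (M \<Otimes>\<^sub>M M)"

definition countable_borel_equiv :: "'a measure \<Rightarrow> ('a \<times> 'a) set \<Rightarrow> bool" where
  "countable_borel_equiv M E \<longleftrightarrow> borel_equiv M E \<and> (\<forall>x\<in>space M. countable (E `` {x}))"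

definition finite_borel_equiv :: "'a measure \<Rightarrow> ('a \<times> 'a) set \<Rightarrow> bool" where
  "finite_borel_equiv M E \<longleftrightarrow> borel_equiv M E \<and> (\<forall>x\<in>space M. finite (E `` {x}))"

definition amenable :: "'a measure \<Rightarrow> ('a \<times> 'a) set \<Rightarrow> bool" where
  "amenable M E \<longleftrightarrow> countable_borel_equiv M E \<and>
     (\<exists>lam :: nat \<Rightarrow> 'a \<times> 'a \<Rightarrow> real.
        (\<forall>n. lam n \<in> borel_measurable (restrict_space (M \<Otimes>\<^sub>M M) E)) \<and>
        (\<forall>n. \<forall>e\<in>E. 0 \<le> lam n e) \<and>
        (\<forall>n. \<forall>x\<in>space M. ((\<lambda>y. \<bar>lam n (x, y)\<bar>) has_sum 1) (E `` {x})) \<and>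
        (\<forall>(x, y)\<in>E.
           (\<lambda>n. \<Sum>\<^sub>\<infinity>z\<in>E `` {x}. \<bar>lam n (x, z) - lam n (y, z)\<bar>) \<longlonglongrightarrow> 0))"

definition hyperfinite :: "'a measure \<Rightarrow> ('a \<times> 'a) set \<Rightarrow> bool" where
  "hyperfinite M E \<longleftrightarrow> countable_borel_equiv M E \<and>
     (\<exists>F :: nat \<Rightarrow> ('a \<times> 'a) set.
        (\<forall>n. finite_borel_equiv M (F n)) \<and> incseq F \<and> E = (\<Union>n. F n))"

definition hyperfinite_ae :: "'a measure \<Rightarrow> ('a \<times> 'a) set \<Rightarrow> bool" where
  "hyperfinite_ae \<mu> E \<longleftrightarrow>
     (\<exists>A\<in>sets \<mu>. space \<mu> - A \<in> null_sets \<mu> \<and> hyperfinite (restrict_space \<mu> A) (E \<inter> A \<times> A))"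

end

theory Submission
  imports Defs
begin

text \<open>
  Fix \<open>p = n!\<close>. Call two points equivalent if invertible maps on \<open>p\<close>-blocks carry them to each other
  and their orbit closures are conjugate; the classes are finite up to \<open>p\<close>-orbit closures, so each class
  determines a least conjugate subshift for a Borel linear order. A conjugacy of radius \<open>r\<close> acts as a map on
  \<open>p\<close>-blocks at every point without \<open>p\<close>-holes near the block boundaries. Separation of the holes makes their
  density tend to 0, so for most \<open>i < p\<close> the \<open>i\<close>-th shift of a point and of its image are equivalent.
  Hence the distribution of the least subshift at a uniformly random one of the \<open>p\<close> shifts of a point of \<open>S\<close>
  is a finitely supported measure on the class of \<open>S\<close> which is asymptotically invariant.

  Given a probability measure, correlated sampling from these measures (the first element in a random order
  of finitely many colours) maps \<open>S\<close> and a conjugate of \<open>S\<close> to the same subshift with probability close to 1.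
  The map is finite-to-one, since block maps are inverted by block maps, so its fibres are the classes of a
  finite Borel equivalence relation, and Borel-Cantelli yields an increasing exhaustion almost everywhere. This
  replaces the Connes-Feldman-Weiss theorem.
\<close>

text \<open>Factorials are used because n! is eventually a multiple of every modulus, which is how
  limits along divisibility are reached by a sequence. A subshift has no preferred phase modulo p,
  and its Borel selected point is not respected by conjugacies. Replacing one point of a Toeplitz
  subshift by another only rotates the values at the p shifts, so the counts of values over i < p
  are well defined; weights and random choices are therefore built from these counts alone. The
  values are reals whereas a random order needs a finite ground set. They are rounded to mesh 1/L,
  and for fixed n the subshifts on which rounding confuses two relevant values have measure tending
  to 0 as L grows. Averaging over the finitely many orders yields one order that is good for
  finitely many partial conjugacies at once, and a countable list of partial conjugacies covers the
  whole relation.\<close>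

type_synonym config = "int \<Rightarrow> bool"

section \<open>Configurations and windows\<close>

definition agree :: "nat \<Rightarrow> config \<Rightarrow> config \<Rightarrow> bool" where
  "agree n x y \<longleftrightarrow> (\<forall>j. \<bar>j\<bar> \<le> int n \<longrightarrow> x j = y j)"

lemma agree_refl [simp]: "agree n x x"
  by (simp add: agree_def)

lemma agree_sym: "agree n x y \<Longrightarrow> agree n y x"
  by (simp add: agree_def)

lemma agree_trans: "agree n x y \<Longrightarrow> agree n y z \<Longrightarrow> agree n x z"
  by (simp add: agree_def)

lemma agree_mono: "agree n x y \<Longrightarrow> m \<le> n \<Longrightarrow> agree m x y"
  by (auto simp: agree_def)

lemma open_agree: "open {y. agree n x y}"
proof -
  have eq: "{y. agree n x y} = (\<Inter>j\<in>{-int n..int n}. (\<lambda>y. y j) -` {x j})"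
    by (force simp: agree_def abs_le_iff)
  have "open ((\<lambda>y::config. y j) -` {x j})" for j
    by (rule open_vimage) (auto intro: continuous_on_product_coordinates Topological_Spaces.open_discrete)
  then show ?thesis unfolding eq by (intro open_INT) auto
qed

lemma open_config_iff:
  "open U \<longleftrightarrow> (\<forall>x\<in>U. \<exists>n. \<forall>y. agree n x y \<longrightarrow> y \<in> U)" for U :: "config set"
proof
  assume U: "open U"
  show "\<forall>x\<in>U. \<exists>n. \<forall>y. agree n x y \<longrightarrow> y \<in> U"
  proof
    fix x assume "x \<in> U"
    then obtain X where X: "x \<in> Pi\<^sub>E UNIV X" "\<And>i::int. open (X i)" "finite {i. X i \<noteq> UNIV}" "Pi\<^sub>E UNIV X \<subseteq> U"
      using product_topology_open_contains_basis[of "\<lambda>_. euclidean" UNIV U x] U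
      by (auto simp: open_fun_def)
    obtain n where n: "\<And>i. i \<in> {i. X i \<noteq> UNIV} \<Longrightarrow> nat \<bar>i\<bar> \<le> n"
      using X(3) finite_nat_set_iff_bounded_le[of "(\<lambda>i. nat \<bar>i\<bar>) ` {i. X i \<noteq> UNIV}"] by auto
    have "y \<in> U" if "agree n x y" for y
    proof -
      have "y i \<in> X i" for i
      proof (cases "X i = UNIV")
        case False
        then have "x i = y i" using n[of i] that by (auto simp: agree_def)
        then show ?thesis using X(1) using PiE_mem[OF X(1), of i] by simp
      qed auto
      then show ?thesis using X(4) by (auto simp: PiE_def Pi_def subset_iff)
    qed
    then show "\<exists>n. \<forall>y. agree n x y \<longrightarrow> y \<in> U" by blast
  qed
next
  assume *: "\<forall>x\<in>U. \<exists>n. \<forall>y. agree n x y \<longrightarrow> y \<in> U"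
  show "open U"
  proof (rule Topological_Spaces.openI)
    fix x assume "x \<in> U"
    then obtain n where "\<forall>y. agree n x y \<longrightarrow> y \<in> U" using * by blast
    then show "\<exists>T. open T \<and> x \<in> T \<and> T \<subseteq> U"
      by (intro exI[of _ "{y. agree n x y}"]) (auto simp: open_agree)
  qed
qed

lemma closed_config_iff:
  "closed C \<longleftrightarrow> (\<forall>x. (\<forall>n. \<exists>y\<in>C. agree n x y) \<longrightarrow> x \<in> C)" for C :: "config set"
  unfolding closed_def open_config_iff Ball_def Compl_iff by blast

lemma closure_config_iff:
  "x \<in> closure A \<longleftrightarrow> (\<forall>n. \<exists>y\<in>A. agree n x y)" for A :: "config set"
proof
  assume "x \<in> closure A"
  then show "\<forall>n. \<exists>y\<in>A. agree n x y"
    using open_agree unfolding closure_iff_nhds_not_empty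
    by (metis (no_types, lifting) agree_refl disjoint_iff mem_Collect_eq subset_refl)
next
  assume *: "\<forall>n. \<exists>y\<in>A. agree n x y"
  show "x \<in> closure A" unfolding closure_iff_nhds_not_empty
  proof (intro allI impI)
    fix T S :: "config set" assume ST: "S \<subseteq> T" "open S" "x \<in> S"
    then obtain n where "\<forall>y. agree n x y \<longrightarrow> y \<in> S" by (auto simp: open_config_iff)
    then show "A \<inter> T \<noteq> {}" using * ST by blast
  qed
qed

lemma compact_config: "compact (UNIV :: config set)"
proof -
  have "compact_space (product_topology (\<lambda>_::int. euclidean :: bool topology) UNIV)"
    unfolding compact_space_product_topology
    by (auto intro!: disjI2 finite_imp_compact simp: compact_space_def)
  then show ?thesis
    by (simp add: compact_space_def euclidean_product_topology)
qed

lemma nested_config: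
  fixes C :: "nat \<Rightarrow> config set"
  assumes "\<And>n. closed (C n)" "\<And>n. C n \<noteq> {}" "decseq C"
  shows "\<exists>x. \<forall>n. x \<in> C n"
proof -
  have "UNIV \<inter> (\<Inter>n\<in>UNIV. C n) \<noteq> {}"
  proof (rule compact_imp_fip_image[OF compact_config])
    fix I :: "nat set" assume I: "finite I"
    have "C (Max (insert 0 I)) \<subseteq> (\<Inter>n\<in>I. C n)"
    proof (rule INT_greatest)
      fix n assume "n \<in> I"
      then show "C (Max (insert 0 I)) \<subseteq> C n"
        using assms(3) I by (simp add: decseq_def)
    qed
    then show "UNIV \<inter> (\<Inter>n\<in>I. C n) \<noteq> {}" using assms(2) by blast
  qed (use assms in auto)
  then show ?thesis by auto
qed

section \<open>Words, languages and subshifts\<close>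

definition occ :: "bool list \<Rightarrow> config \<Rightarrow> int \<Rightarrow> bool" where
  "occ w x i \<longleftrightarrow> (\<forall>j<length w. x (i + int j) = w ! j)"

definition lang :: "config set \<Rightarrow> bool list set" where
  "lang S = {w. \<exists>x\<in>S. occ w x 0}"

definition window :: "nat \<Rightarrow> config \<Rightarrow> bool list" where
  "window n x = map x [- int n..int n]"

lemma length_window [simp]: "length (window n x) = 2 * n + 1"
  by (simp add: window_def)

lemma nth_window: "j < 2 * n + 1 \<Longrightarrow> window n x ! j = x (int j - int n)"
  by (simp add: window_def)

lemma occ_window_iff: "occ (window n x) y (- int n) \<longleftrightarrow> agree n x y"
proof
  assume o: "occ (window n x) y (- int n)"
  show "agree n x y" unfolding agree_def
  proof (intro allI impI)
    fix j assume j: "\<bar>j\<bar> \<le> int n"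
    have "nat (j + int n) < 2 * n + 1" using j by linarith
    then have "y (- int n + int (nat (j + int n))) = x (int (nat (j + int n)) - int n)"
      using o unfolding occ_def by (metis length_window nth_window)
    moreover have "int (nat (j + int n)) = j + int n" using j by linarith
    ultimately show "x j = y j" by (simp add: algebra_simps)
  qed
qed (auto simp: occ_def agree_def nth_window)

lemma window_eq_iff: "window n x = window n y \<longleftrightarrow> agree n x y"
proof
  assume "agree n x y"
  then show "window n x = window n y"
    unfolding window_def agree_def by (auto simp: abs_le_iff)
qed (metis occ_window_iff agree_refl)

lemma shift_shift [simp]: "shift a (shift b x) = shift (a + b) x"
  by (auto simp: shift_def algebra_simps)

lemma shift_0 [simp]: "shift 0 x = x"
  by (simp add: shift_def)

lemma shift_apply: "shift n x m = x (m - n)"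
  by (simp add: shift_def)

lemma occ_shift: "occ w (shift n x) i \<longleftrightarrow> occ w x (i - n)"
  by (simp add: occ_def shift_def algebra_simps)

lemma open_occ: "open {x. occ w x i}"
  unfolding open_config_iff
proof
  fix x assume x: "x \<in> {x. occ w x i}"
  have "y \<in> {x. occ w x i}" if "agree (nat \<bar>i\<bar> + length w) x y" for y
    using x that by (auto simp: occ_def agree_def)
  then show "\<exists>n. \<forall>y. agree n x y \<longrightarrow> y \<in> {x. occ w x i}" by blast
qed

lemma closed_occ: "closed {x. occ w x i}"
proof -
  have "open {x. \<not> occ w x i}"
    unfolding open_config_iff
  proof
    fix x assume x: "x \<in> {x. \<not> occ w x i}"
    have "y \<in> {x. \<not> occ w x i}" if "agree (nat \<bar>i\<bar> + length w) x y" for y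
      using x that by (auto simp: occ_def agree_def)
    then show "\<exists>n. \<forall>y. agree n x y \<longrightarrow> y \<in> {x. \<not> occ w x i}" by blast
  qed
  then show ?thesis by (simp add: closed_def Collect_neg_eq)
qed

lemma subshiftsD:
  assumes "S \<in> subshifts"
  shows "S \<noteq> {}" "closed S" "x \<in> S \<Longrightarrow> shift n x \<in> S"
  using assms by (auto simp: subshifts_def)

lemma lang_subshift_iff:
  assumes "S \<in> subshifts"
  shows "w \<in> lang S \<longleftrightarrow> (\<exists>x\<in>S. occ w x i)"
proof
  assume "w \<in> lang S"
  then obtain x where x: "x \<in> S" "occ w x 0" by (auto simp: lang_def)
  then show "\<exists>x\<in>S. occ w x i"
    using subshiftsD(3)[OF assms, of x i] by (intro bexI[of _ "shift i x"]) (auto simp: occ_shift)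
next
  assume "\<exists>x\<in>S. occ w x i"
  then obtain x where x: "x \<in> S" "occ w x i" by auto
  then show "w \<in> lang S" unfolding lang_def
    using subshiftsD(3)[OF assms, of x "-i"] by (auto intro!: bexI[of _ "shift (-i) x"] simp: occ_shift)
qed

lemma window_in_lang: "S \<in> subshifts \<Longrightarrow> x \<in> S \<Longrightarrow> window n x \<in> lang S"
  using lang_subshift_iff[of S "window n x" "- int n"] agree_refl occ_window_iff by blast

lemma subshift_memI:
  assumes "S \<in> subshifts" "\<And>n. window n x \<in> lang S"
  shows "x \<in> S"
  using assms subshiftsD(2)[OF assms(1)] lang_subshift_iff[OF assms(1), of "window n x" "- int n" for n]
  unfolding closed_config_iff by (auto simp: occ_window_iff)

lemma lang_inj: "S \<in> subshifts \<Longrightarrow> T \<in> subshifts \<Longrightarrow> lang S = lang T \<Longrightarrow> S = T"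
  by (metis subsetI subset_antisym subshift_memI window_in_lang)

lemma subshift_subset_iff:
  "S \<in> subshifts \<Longrightarrow> T \<in> subshifts \<Longrightarrow> S \<subseteq> T \<longleftrightarrow> lang S \<subseteq> lang T"
proof -
  assume "S \<in> subshifts" "T \<in> subshifts"
  note ST = this
  show ?thesis
  proof
    assume "lang S \<subseteq> lang T"
    then show "S \<subseteq> T" using subshift_memI[OF ST(2)] window_in_lang[OF ST(1)] by blast
  qed (auto simp: lang_def)
qed

text \<open>An open set is the union of the centred cylinders of these words, so hitting it is a
  countable disjunction of conditions on the language.\<close>

definition inner_words :: "config set \<Rightarrow> bool list set" where
  "inner_words U = {w. \<exists>n. length w = 2 * n + 1 \<and> (\<forall>y. occ w y (- int n) \<longrightarrow> y \<in> U)}"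

lemma hit_open_iff:
  assumes S: "S \<in> subshifts" and U: "open U"
  shows "S \<inter> U \<noteq> {} \<longleftrightarrow> (\<exists>w\<in>inner_words U. w \<in> lang S)"
proof
  assume "S \<inter> U \<noteq> {}"
  then obtain x where x: "x \<in> S" "x \<in> U" by auto
  then obtain n where "\<forall>y. agree n x y \<longrightarrow> y \<in> U" using U by (auto simp: open_config_iff)
  then have "window n x \<in> inner_words U"
    by (auto simp: inner_words_def occ_window_iff)
  then show "\<exists>w\<in>inner_words U. w \<in> lang S" using window_in_lang[OF S x(1)] by blast
next
  assume "\<exists>w\<in>inner_words U. w \<in> lang S"
  then show "S \<inter> U \<noteq> {}"
    using lang_subshift_iff[OF S] by (fastforce simp: inner_words_def)
qed

definition near :: "nat \<Rightarrow> config set \<Rightarrow> config set" where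
  "near n K = {x. \<exists>y\<in>K. agree n x y}"

lemma open_near: "open (near n K)"
  unfolding open_config_iff near_def
  by (auto intro!: exI[of _ n] intro: agree_trans agree_sym)

lemma closed_near: "closed (near n K)"
proof -
  have "x \<in> - near n K" if "y \<in> - near n K" "agree n x y" for x y
    using that agree_trans[of n y x] agree_sym[of n x y] by (auto simp: near_def)
  then have "- near n K = near n (- near n K)"
    using agree_refl unfolding near_def[of n "- near n K"] by blast
  then show ?thesis using open_near[of n "- near n K"] by (simp add: closed_def)
qed

text \<open>Compactness: the sets \<open>near n K\<close> decrease to K, so their nonempty closed
  traces on S have a common point. Meeting a closed set thereby becomes a countable intersection of
  conditions on open sets.\<close>

lemma hit_closed_iff:
  assumes "closed S" "closed K"
  shows "S \<inter> K \<noteq> {} \<longleftrightarrow> (\<forall>n. S \<inter> near n K \<noteq> {})"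
proof
  assume "S \<inter> K \<noteq> {}"
  then obtain x where "x \<in> S" "x \<in> K" by blast
  then have "x \<in> S \<inter> near n K" for n unfolding near_def using agree_refl[of n x] by blast
  then show "\<forall>n. S \<inter> near n K \<noteq> {}" by blast
next
  assume *: "\<forall>n. S \<inter> near n K \<noteq> {}"
  have "\<exists>x. \<forall>n. x \<in> S \<inter> near n K"
  proof (rule nested_config)
    show "decseq (\<lambda>n. S \<inter> near n K)"
      by (auto simp: decseq_def near_def intro: agree_mono)
  qed (use * assms(1) closed_near in auto)
  then obtain x where x: "x \<in> S" "\<And>n. x \<in> near n K" by auto
  then have "x \<in> K" using assms(2) by (auto simp: closed_config_iff near_def)
  then show "S \<inter> K \<noteq> {}" using x by auto
qed

section \<open>The Vietoris topology through languages\<close>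

text \<open>Real values embed the subshifts in the Polish product type
  \<open>bool list \<Rightarrow> real\<close>.\<close>

definition lang_ind :: "config set \<Rightarrow> bool list \<Rightarrow> real" where
  "lang_ind S w = of_bool (w \<in> lang S)"

lemma open_coord_gt: "open {v :: bool list \<Rightarrow> real. v w > c}"
  using open_vimage[of "{c<..}" "\<lambda>v :: bool list \<Rightarrow> real. v w"]
  by (simp add: vimage_def continuous_on_product_coordinates)

lemma open_coord_lt: "open {v :: bool list \<Rightarrow> real. v w < c}"
  using open_vimage[of "{..<c}" "\<lambda>v :: bool list \<Rightarrow> real. v w"]
  by (simp add: vimage_def continuous_on_product_coordinates)

text \<open>Compactness again: a subshift inside U avoids \<open>near n (- U)\<close> for a single
  n. Only finitely many words of length 2n+1 are then forbidden, which makes the condition open in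
  terms of languages.\<close>

lemma subset_open_iff:
  assumes S: "S \<in> subshifts" and U: "open U"
  shows "S \<subseteq> U \<longleftrightarrow> (\<exists>n. \<forall>w. length w = 2 * n + 1 \<and> (\<exists>y. occ w y (- int n) \<and> y \<notin> U) \<longrightarrow> w \<notin> lang S)"
    (is "_ \<longleftrightarrow> (\<exists>n. ?P n)")
proof -
  have "?P n \<longleftrightarrow> S \<inter> near n (- U) = {}" for n
  proof
    assume P: "?P n"
    show "S \<inter> near n (- U) = {}"
    proof (rule ccontr)
      assume "S \<inter> near n (- U) \<noteq> {}"
      then obtain x y where xy: "x \<in> S" "y \<notin> U" "agree n x y" by (auto simp: near_def)
      have "window n x \<notin> lang S" using P xy by (metis length_window occ_window_iff)
      then show False using window_in_lang[OF S xy(1)] by blast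
    qed
  next
    assume e: "S \<inter> near n (- U) = {}"
    show "?P n"
    proof (intro allI impI notI)
      fix w assume w: "length w = 2 * n + 1 \<and> (\<exists>y. occ w y (- int n) \<and> y \<notin> U)" "w \<in> lang S"
      then obtain y where y: "occ w y (- int n)" "y \<notin> U" by blast
      obtain x where x: "x \<in> S" "occ w x (- int n)" using w lang_subshift_iff[OF S] by blast
      have "window n x = w" using w x(2) by (auto simp: list_eq_iff_nth_eq nth_window occ_def)
      then have "agree n x y" using y occ_window_iff by blast
      then show False using e x y by (auto simp: near_def)
    qed
  qed
  moreover have "S \<subseteq> U \<longleftrightarrow> (\<exists>n. S \<inter> near n (- U) = {})"
    using hit_closed_iff[OF subshiftsD(2)[OF S], of "- U"] U by (auto simp: closed_def)
  ultimately show ?thesis by simp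
qed

lemma topspace_vietoris: "topspace vietoris_subshifts = subshifts"
  unfolding vietoris_subshifts_def topology_generated_by_topspace
  by (auto intro!: exI[of _ "{S \<in> subshifts. S \<subseteq> UNIV}"])

text \<open>Both kinds of Vietoris generators are unions of conditions on finitely many words.
  Conversely a cylinder is clopen, so both the presence and the absence of a word are Vietoris
  open.\<close>

lemma vietoris_eq_pullback:
  "vietoris_subshifts = pullback_topology subshifts lang_ind euclidean"
  unfolding topology_eq
proof (intro allI iffI)
  fix \<U> assume op: "openin vietoris_subshifts \<U>"
  have hit: "openin (pullback_topology subshifts lang_ind euclidean) {S \<in> subshifts. S \<inter> U \<noteq> {}}" if "open U" for U
  proof -
    \<comment> \<open>The threshold 1/2 separates the two values 0 and 1 of the indicator.\<close>
    let ?V = "\<Union>w\<in>inner_words U. {v :: bool list \<Rightarrow> real. v w > 1/2}"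
    have "open ?V" by (intro open_UN ballI open_coord_gt)
    moreover have "{S \<in> subshifts. S \<inter> U \<noteq> {}} = lang_ind -` ?V \<inter> subshifts"
    proof (rule set_eqI)
      fix S
      have "lang_ind S w > 1 / 2 \<longleftrightarrow> w \<in> lang S" for w by (auto simp: lang_ind_def)
      then have "S \<in> lang_ind -` ?V \<longleftrightarrow> (\<exists>w\<in>inner_words U. w \<in> lang S)" by simp
      then show "S \<in> {S \<in> subshifts. S \<inter> U \<noteq> {}} \<longleftrightarrow> S \<in> lang_ind -` ?V \<inter> subshifts"
        using hit_open_iff[OF _ that, of S] by auto
    qed
    ultimately show ?thesis by (auto simp: openin_pullback_topology)
  qed
  have sub: "openin (pullback_topology subshifts lang_ind euclidean) {S \<in> subshifts. S \<subseteq> U}" if "open U" for U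
  proof -
    let ?W = "\<lambda>n. {w. length w = 2 * n + 1 \<and> (\<exists>y. occ w y (- int n) \<and> y \<notin> U)}"
    let ?V = "\<Union>n. \<Inter>w\<in>?W n. {v :: bool list \<Rightarrow> real. v w < 1/2}"
    have "finite (?W n)" for n
      by (rule finite_subset[OF _ finite_lists_length_eq[of "UNIV :: bool set" "2 * n + 1"]]) auto
    then have "open ?V" by (intro open_UN ballI open_INT open_coord_lt) auto
    moreover have "{S \<in> subshifts. S \<subseteq> U} = lang_ind -` ?V \<inter> subshifts"
    proof (rule set_eqI)
      fix S
      have "lang_ind S w < 1 / 2 \<longleftrightarrow> w \<notin> lang S" for w by (auto simp: lang_ind_def)
      then have "S \<in> lang_ind -` ?V \<longleftrightarrow> (\<exists>n. \<forall>w. length w = 2 * n + 1 \<and> (\<exists>y. occ w y (- int n) \<and> y \<notin> U) \<longrightarrow> w \<notin> lang S)"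
        by simp
      then show "S \<in> {S \<in> subshifts. S \<subseteq> U} \<longleftrightarrow> S \<in> lang_ind -` ?V \<inter> subshifts"
        using subset_open_iff[OF _ that, of S] by auto
    qed
    ultimately show ?thesis by (auto simp: openin_pullback_topology)
  qed
  show "openin (pullback_topology subshifts lang_ind euclidean) \<U>"
    by (rule generate_topology_on_coarsest[OF istopology_openin _
          op[unfolded vietoris_subshifts_def openin_topology_generated_by_iff]])
      (use hit sub in auto)
next
  fix \<U> assume "openin (pullback_topology subshifts lang_ind euclidean) \<U>"
  then obtain V where V: "open V" "\<U> = lang_ind -` V \<inter> subshifts"
    by (auto simp: openin_pullback_topology)
  have "continuous_map vietoris_subshifts euclidean lang_ind"
    unfolding euclidean_product_topology[symmetric] continuous_map_componentwise_UNIV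
  proof
    fix w
    have 1: "openin vietoris_subshifts {S \<in> subshifts. w \<in> lang S}"
    proof -
      have "{S \<in> subshifts. w \<in> lang S} = {S \<in> subshifts. S \<inter> {x. occ w x 0} \<noteq> {}}"
        by (auto simp: lang_def)
      then show ?thesis unfolding vietoris_subshifts_def
        using open_occ[of w 0]
        by (intro topology_generated_by_Basis UnI1 CollectI exI[of _ "{x. occ w x 0}"]) simp
    qed
    have 2: "openin vietoris_subshifts {S \<in> subshifts. w \<notin> lang S}"
    proof -
      have "{S \<in> subshifts. w \<notin> lang S} = {S \<in> subshifts. S \<subseteq> - {x. occ w x 0}}"
        by (auto simp: lang_def)
      moreover have "open (- {x. occ w x 0})" using closed_occ by (simp add: closed_def)
      ultimately show ?thesis unfolding vietoris_subshifts_def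
        by (intro topology_generated_by_Basis UnI2 CollectI exI[of _ "- {x. occ w x 0}"]) simp
    qed
    show "continuous_map vietoris_subshifts euclidean (\<lambda>S. lang_ind S w)"
      unfolding continuous_map_def topspace_vietoris
    proof (intro conjI allI impI)
      fix X :: "real set"
      have "{S \<in> subshifts. lang_ind S w \<in> X} =
        (if 1 \<in> X then {S \<in> subshifts. w \<in> lang S} else {}) \<union> (if 0 \<in> X then {S \<in> subshifts. w \<notin> lang S} else {})"
        by (auto simp: lang_ind_def)
      then show "openin vietoris_subshifts {S \<in> subshifts. lang_ind S w \<in> X}"
        using 1 2 by auto
    qed auto
  qed
  then have "openin vietoris_subshifts {S \<in> topspace vietoris_subshifts. lang_ind S \<in> V}"
    using V(1) openin_continuous_map_preimage by fastforce
  then show "openin vietoris_subshifts \<U>"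
    unfolding V(2) topspace_vietoris by (simp add: vimage_def Int_def conj_commute)
qed

lemma inj_on_lang_ind: "inj_on lang_ind subshifts"
proof (rule inj_onI)
  fix S T assume ST: "S \<in> subshifts" "T \<in> subshifts" "lang_ind S = lang_ind T"
  have "lang S = lang T"
  proof (rule set_eqI)
    fix w show "w \<in> lang S \<longleftrightarrow> w \<in> lang T"
      using fun_cong[OF ST(3), of w] by (auto simp: lang_ind_def)
  qed
  then show "S = T" using ST lang_inj by blast
qed

lemma occ_shorter:
  assumes "agree n x y" "n \<ge> length w + nat \<bar>i\<bar>" "occ w x i"
  shows "occ w y i"
  using assms by (auto simp: occ_def agree_def)

lemma shift_agree:
  assumes "agree (n + nat \<bar>k\<bar>) x y"
  shows "agree n (shift k x) (shift k y)"
  using assms by (auto simp: agree_def shift_def)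

text \<open>Compactness produces a bi-infinite word through every word of the limit.\<close>

lemma limit_language:
  assumes L: "\<And>n. \<exists>S\<in>subshifts. \<forall>w. length w \<le> n \<longrightarrow> (w \<in> lang S \<longleftrightarrow> w \<in> L)"
  shows "\<exists>T\<in>subshifts. lang T = L"
proof -
  define T where "T = {x. \<forall>n. window n x \<in> L}"
  \<comment> \<open>Closure under factors is inherited from the approximating subshifts; the bound
    on n places the occurrence of w inside the window.\<close>
  have factor: "w \<in> L" if "window n x \<in> L" "occ w x i" "n \<ge> length w + nat \<bar>i\<bar>" for n x w i
  proof -
    obtain S where S: "S \<in> subshifts" "\<And>w. length w \<le> 2 * n + 1 \<Longrightarrow> w \<in> lang S \<longleftrightarrow> w \<in> L"
      using L[of "2 * n + 1"] by blast
    have "window n x \<in> lang S" using that(1) S(2) by simp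
    then obtain y where y: "y \<in> S" "agree n x y"
      using lang_subshift_iff[OF S(1), of _ "- int n"] occ_window_iff by blast
    have "occ w y i" using occ_shorter[OF y(2) that(3,2)] .
    then have "w \<in> lang S" using lang_subshift_iff[OF S(1)] y by blast
    then show ?thesis using S(2)[of w] that(3) by simp
  qed
  have ex: "\<exists>x\<in>T. occ w x 0" if w: "w \<in> L" for w
  proof -
    have "\<exists>x. \<forall>n. x \<in> {x. occ w x 0} \<inter> {x. window n x \<in> L}"
    proof (rule nested_config)
      fix n
      have "{x. window n x \<in> L} = near n {x. window n x \<in> L}"
      proof (intro subset_antisym subsetI)
        fix x assume "x \<in> {x. window n x \<in> L}"
        then show "x \<in> near n {x. window n x \<in> L}"
          unfolding near_def using agree_refl[of n x] by blast
      next
        fix x assume "x \<in> near n {x. window n x \<in> L}"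
        then obtain y where "window n y \<in> L" "agree n x y" by (auto simp: near_def)
        then show "x \<in> {x. window n x \<in> L}" using window_eq_iff[of n x y] by simp
      qed
      then show "closed ({x. occ w x 0} \<inter> {x. window n x \<in> L})"
        using closed_occ closed_near by (metis closed_Int)
      obtain S where S: "S \<in> subshifts" "\<And>u. length u \<le> 2 * n + 1 + length w \<Longrightarrow> u \<in> lang S \<longleftrightarrow> u \<in> L"
        using L[of "2 * n + 1 + length w"] by blast
      have "w \<in> lang S" using S(2)[of w] w by simp
      then obtain x where x: "x \<in> S" "occ w x 0" by (auto simp: lang_def)
      then have "window n x \<in> L" using S window_in_lang[OF S(1) x(1), of n] by simp
      then show "{x. occ w x 0} \<inter> {x. window n x \<in> L} \<noteq> {}" using x by auto
    next
      show "decseq (\<lambda>n. {x. occ w x 0} \<inter> {x. window n x \<in> L})"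
        unfolding decseq_Suc_iff
      proof (intro allI Int_mono subset_refl subsetI CollectI)
        fix n x assume "x \<in> {x. window (Suc n) x \<in> L}"
        then have w: "window (Suc n) x \<in> L" by simp
        obtain S where S: "S \<in> subshifts" "\<And>u. length u \<le> 2 * (Suc n) + 1 \<Longrightarrow> u \<in> lang S \<longleftrightarrow> u \<in> L"
          using L[of "2 * (Suc n) + 1"] by blast
        have "window (Suc n) x \<in> lang S" using w S(2) by simp
        then obtain y where y: "y \<in> S" "agree (Suc n) x y"
          using lang_subshift_iff[OF S(1), of _ "- int (Suc n)"] occ_window_iff by blast
        then have "window n x = window n y" using agree_mono[OF y(2)] by (simp add: window_eq_iff)
        then show "window n x \<in> L" using window_in_lang[OF S(1) y(1), of n] S(2) by simp
      qed
    qed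
    then show ?thesis by (auto simp: T_def)
  qed
  have "[] \<in> L"
  proof -
    obtain S where S: "S \<in> subshifts" "\<And>u. length u \<le> 0 \<Longrightarrow> u \<in> lang S \<longleftrightarrow> u \<in> L"
      using L[of 0] by blast
    moreover have "[] \<in> lang S" using subshiftsD(1)[OF S(1)] by (auto simp: lang_def occ_def)
    ultimately show ?thesis by simp
  qed
  then have "T \<noteq> {}" using ex by blast
  moreover have "closed T"
    unfolding closed_config_iff
  proof (intro allI impI)
    fix x assume *: "\<forall>n. \<exists>y\<in>T. agree n x y"
    have "window n x \<in> L" for n
    proof -
      obtain y where "y \<in> T" "agree n x y" using * by blast
      then show ?thesis using window_eq_iff[of n x y] by (simp add: T_def)
    qed
    then show "x \<in> T" by (simp add: T_def)
  qed
  moreover have "shift k x \<in> T" if "x \<in> T" for k x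
    unfolding T_def
  proof (intro CollectI allI)
    fix n
    have "occ (window n (shift k x)) (shift k x) (- int n)" by (simp add: occ_window_iff)
    then have o: "occ (window n (shift k x)) x (- int n - k)" by (simp add: occ_shift)
    let ?m = "length (window n (shift k x)) + nat \<bar>- int n - k\<bar>"
    have "window ?m x \<in> L" using that by (simp only: T_def mem_Collect_eq)
    from factor[OF this o] show "window n (shift k x) \<in> L" by blast
  qed
  ultimately have "T \<in> subshifts" by (auto simp: subshifts_def)
  moreover have "lang T = L"
  proof (intro subset_antisym subsetI)
    fix w assume "w \<in> lang T"
    then obtain x where x: "x \<in> T" "occ w x 0" by (auto simp: lang_def)
    then show "w \<in> L" using factor[of "length w" x w 0] by (auto simp: T_def)
  next
    fix w assume "w \<in> L"
    then show "w \<in> lang T" using ex by (auto simp: lang_def)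
  qed
  ultimately show ?thesis by blast
qed

text \<open>A limit of indicators is again 0/1-valued and agrees, on the finitely many words up to
  each length, with the language of some subshift; \<open>limit_language\<close> then realizes
  it.\<close>

lemma closed_lang_ind_image: "closed (lang_ind ` subshifts)"
proof -
  have "v \<in> lang_ind ` subshifts" if v: "v \<in> closure (lang_ind ` subshifts)" for v
  proof -
    have approx: "\<exists>S\<in>subshifts. \<forall>w\<in>W. \<bar>lang_ind S w - v w\<bar> < e" if "finite W" "e > 0" for W e
    proof -
      let ?U = "\<Inter>w\<in>W. {u. u w > v w - e} \<inter> {u. u w < v w + e}"
      have "open ?U" using that(1) by (intro open_INT ballI open_Int open_coord_gt open_coord_lt) auto
      moreover have "v \<in> ?U" using that by auto
      ultimately have "lang_ind ` subshifts \<inter> ?U \<noteq> {}"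
        using v unfolding closure_iff_nhds_not_empty by blast
      then obtain S where "S \<in> subshifts" "lang_ind S \<in> ?U" by auto
      then show ?thesis by (intro bexI[of _ S]) (auto simp: abs_less_iff field_simps)
    qed
    have v01: "v w = 0 \<or> v w = 1" for w
    proof (rule ccontr)
      assume "\<not> ?thesis"
      then have "min \<bar>v w\<bar> \<bar>v w - 1\<bar> > 0" by auto
      from approx[of "{w}", OF _ this] obtain S where "\<bar>lang_ind S w - v w\<bar> < min \<bar>v w\<bar> \<bar>v w - 1\<bar>" by auto
      then show False by (cases "w \<in> lang S") (auto simp: lang_ind_def)
    qed
    have "\<exists>T\<in>subshifts. lang T = {w. v w = 1}"
    proof (rule limit_language)
      fix n
      have "finite {w :: bool list. length w \<le> n}"
        using finite_lists_length_le[of "UNIV :: bool set" n] by simp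
      from approx[OF this, of 1] obtain S where S: "S \<in> subshifts" "\<And>w. length w \<le> n \<Longrightarrow> \<bar>lang_ind S w - v w\<bar> < 1"
        by auto
      have "w \<in> lang S \<longleftrightarrow> w \<in> {w. v w = 1}" if "length w \<le> n" for w
        using S(2)[OF that] v01[of w] by (auto simp: lang_ind_def of_bool_def split: if_splits)
      then show "\<exists>S\<in>subshifts. \<forall>w. length w \<le> n \<longrightarrow> (w \<in> lang S \<longleftrightarrow> w \<in> {w. v w = 1})"
        using S(1) by blast
    qed
    then obtain T where T: "T \<in> subshifts" "lang T = {w. v w = 1}" by blast
    have "lang_ind T = v"
      using v01 by (auto simp: lang_ind_def T(2) fun_eq_iff of_bool_def)
    then show ?thesis using T by blast
  qed
  then show ?thesis by (metis closure_subset_eq subsetI)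
qed

lemma standard_borel_subshift_space: "standard_borel subshift_space"
proof -
  let ?Y = "top_of_set (lang_ind ` subshifts)"
  have top: "topspace vietoris_subshifts = subshifts" by (rule topspace_vietoris)
  have "homeomorphic_map vietoris_subshifts ?Y lang_ind"
    unfolding homeomorphic_eq_everything_map
  proof (intro conjI)
    show c: "continuous_map vietoris_subshifts ?Y lang_ind"
    proof -
      have "continuous_map vietoris_subshifts euclidean (id \<circ> lang_ind)"
        unfolding vietoris_eq_pullback by (rule continuous_map_pullback) simp
      then show ?thesis using top by (auto simp: continuous_map_in_subtopology)
    qed
    show o: "open_map vietoris_subshifts ?Y lang_ind"
      unfolding open_map_def
    proof (intro allI impI)
      fix U assume "openin vietoris_subshifts U"
      then obtain V where V: "open V" "U = lang_ind -` V \<inter> subshifts"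
        by (auto simp: vietoris_eq_pullback openin_pullback_topology)
      have "lang_ind ` U = lang_ind ` subshifts \<inter> V" using V(2) by auto
      then show "openin ?Y (lang_ind ` U)" using V(1) by (auto simp: openin_open)
    qed
    show "lang_ind ` topspace vietoris_subshifts = topspace ?Y" using top by simp
    show inj: "inj_on lang_ind (topspace vietoris_subshifts)" using top inj_on_lang_ind by simp
    show "closed_map vietoris_subshifts ?Y lang_ind"
      using bijective_open_imp_closed_map[OF o] top inj by simp
  qed
  then have hom: "vietoris_subshifts homeomorphic_space ?Y"
    by (rule homeomorphic_map_imp_homeomorphic_space)
  have "completely_metrizable_space ?Y"
    by (rule completely_metrizable_space_closedin[OF completely_metrizable_space_euclidean])
      (use closed_lang_ind_image in auto)
  moreover have "second_countable (euclidean :: (bool list \<Rightarrow> real) topology)"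
  proof -
    obtain \<B> :: "(bool list \<Rightarrow> real) set set" where B: "countable \<B>" "\<And>C. C \<in> \<B> \<Longrightarrow> open C"
      "\<And>S. open S \<Longrightarrow> \<exists>U\<subseteq>\<B>. S = \<Union> U"
      using univ_second_countable by blast
    show ?thesis unfolding second_countable_def
    proof (intro exI[of _ \<B>] conjI allI impI ballI)
      fix U :: "(bool list \<Rightarrow> real) set" and x assume "openin euclidean U \<and> x \<in> U"
      then show "\<exists>V\<in>\<B>. x \<in> V \<and> V \<subseteq> U" using B(3)[of U] by auto
    qed (use B in auto)
  qed
  then have "second_countable ?Y" by (rule second_countable_subtopology)
  ultimately show ?thesis
    unfolding standard_borel_def subshift_space_def
    using hom homeomorphic_completely_metrizable_space homeomorphic_space_second_countability by blast
qed

section \<open>Measurability on the space of subshifts\<close>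

lemma space_subshift_space [simp]: "space subshift_space = subshifts"
  unfolding subshift_space_def borel_of_def topspace_vietoris
  by (rule space_measure_of) (use openin_subset topspace_vietoris in force)

text \<open>Generating a sigma-algebra commutes with pulling back, so the Borel structure comes from
  the word indicators. A map into subshifts is then measurable as soon as each single word condition
  is.\<close>

lemma sets_subshift_space:
  "sets subshift_space = sets (vimage_algebra subshifts lang_ind borel)"
proof -
  have "vimage_algebra subshifts lang_ind (sigma UNIV {V. open V})
      = sigma subshifts {lang_ind -` A \<inter> subshifts | A. A \<in> {V. open V}}"
    by (rule vimage_algebra_sigma) auto
  moreover have "{U. openin vietoris_subshifts U} = {lang_ind -` A \<inter> subshifts | A. A \<in> {V. open V}}"
    by (auto simp: vietoris_eq_pullback openin_pullback_topology)
  ultimately show ?thesis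
    unfolding subshift_space_def borel_of_def topspace_vietoris borel_def
    by (metis (no_types, lifting) mem_Collect_eq)
qed

lemma lang_measurable [measurable]: "Measurable.pred subshift_space (\<lambda>S. w \<in> lang S)"
proof -
  have "lang_ind \<in> measurable (vimage_algebra subshifts lang_ind borel) borel"
    by (rule measurable_vimage_algebra1) auto
  then have *: "lang_ind \<in> borel_measurable subshift_space"
    using sets_subshift_space measurable_cong_sets by blast
  have "(\<lambda>S. lang_ind S w) \<in> borel_measurable subshift_space"
    using * by (rule measurable_product_then_coordinatewise)
  then have "Measurable.pred subshift_space (\<lambda>S. lang_ind S w > 0)"
    by measurable
  then show ?thesis by (simp add: lang_ind_def)
qed

lemma measurable_to_subshift_space:
  assumes "\<And>x. x \<in> space N \<Longrightarrow> f x \<in> subshifts"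
    and "\<And>w. Measurable.pred N (\<lambda>x. w \<in> lang (f x))"
  shows "f \<in> measurable N subshift_space"
proof -
  have "(\<lambda>x. lang_ind (f x) w) \<in> borel_measurable N" for w
    unfolding lang_ind_def of_bool_def using assms(2)[of w] by measurable
  then have "(\<lambda>x. lang_ind (f x)) \<in> borel_measurable N"
    by (rule measurable_coordinatewise_then_product)
  then have "f \<in> measurable N (vimage_algebra subshifts lang_ind borel)"
    by (intro measurable_vimage_algebra2) (use assms(1) in auto)
  then show ?thesis using sets_subshift_space measurable_cong_sets by blast
qed

lemma hit_open_measurable:
  assumes "open U"
  shows "Measurable.pred subshift_space (\<lambda>S. S \<inter> U \<noteq> {})"
proof -
  have "Measurable.pred subshift_space (\<lambda>S. \<exists>w\<in>inner_words U. w \<in> lang S)"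
    by measurable
  then show ?thesis
    by (rule measurable_cong[THEN iffD1, rotated]) (use hit_open_iff[OF _ assms] in auto)
qed

lemma hit_closed_measurable:
  assumes "closed K"
  shows "Measurable.pred subshift_space (\<lambda>S. S \<inter> K \<noteq> {})"
proof -
  note hit_open_measurable[OF open_near, measurable]
  have "Measurable.pred subshift_space (\<lambda>S. \<forall>n. S \<inter> near n K \<noteq> {})"
    by measurable
  then show ?thesis
    by (rule measurable_cong[THEN iffD1, rotated]) (use hit_closed_iff[OF _ assms] subshiftsD(2) in auto)
qed

lemma subset_closed_measurable:
  assumes "closed K"
  shows "Measurable.pred subshift_space (\<lambda>S. S \<subseteq> K)"
proof -
  have "Measurable.pred subshift_space (\<lambda>S. S \<inter> - K \<noteq> {})"
    using assms by (intro hit_open_measurable) (simp add: closed_def)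
  then have "Measurable.pred subshift_space (\<lambda>S. \<not> S \<inter> - K \<noteq> {})" by measurable
  then show ?thesis by (simp add: disjoint_eq_subset_Compl)
qed

section \<open>Orbit closures, recurrence and periodic positions\<close>

definition ocl :: "config \<Rightarrow> config set" where
  "ocl x = closure (range (\<lambda>n. shift n x))"

lemma mem_ocl_iff: "y \<in> ocl x \<longleftrightarrow> (\<forall>n. \<exists>k. agree n y (shift k x))"
  by (simp add: ocl_def closure_config_iff)

lemma ocl_self [simp]: "x \<in> ocl x"
  unfolding mem_ocl_iff by (metis agree_refl shift_0)

lemma ocl_subshift [simp]: "ocl x \<in> subshifts"
  unfolding subshifts_def
proof (intro CollectI conjI allI ballI)
  show "ocl x \<noteq> {}" using ocl_self by blast
  show "closed (ocl x)" by (simp add: ocl_def)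
  fix m y assume y: "y \<in> ocl x"
  show "shift m y \<in> ocl x" unfolding mem_ocl_iff
  proof
    fix n
    obtain k where "agree (n + nat \<bar>m\<bar>) y (shift k x)" using y unfolding mem_ocl_iff by blast
    from shift_agree[OF this] show "\<exists>k. agree n (shift m y) (shift k x)"
      unfolding shift_shift by blast
  qed
qed

lemma lang_ocl_iff: "w \<in> lang (ocl x) \<longleftrightarrow> (\<exists>i. occ w x i)"
proof
  assume "w \<in> lang (ocl x)"
  then obtain y where y: "y \<in> ocl x" "occ w y 0" by (auto simp: lang_def)
  then obtain k where "agree (length w) y (shift k x)" unfolding mem_ocl_iff by blast
  then have "occ w (shift k x) 0" using occ_shorter[of "length w" y "shift k x" w 0] y by simp
  then show "\<exists>i. occ w x i" using occ_shift by blast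
next
  assume "\<exists>i. occ w x i"
  then show "w \<in> lang (ocl x)" using lang_subshift_iff[OF ocl_subshift] ocl_self by blast
qed

lemma ocl_subset: "S \<in> subshifts \<Longrightarrow> x \<in> S \<Longrightarrow> ocl x \<subseteq> S"
  unfolding ocl_def by (rule closure_minimal) (auto simp: subshifts_def)

lemma ocl_shift [simp]: "ocl (shift n x) = ocl x"
proof
  show "ocl (shift n x) \<subseteq> ocl x"
    by (rule ocl_subset) (auto intro: subshiftsD)
  have "shift (-n) (shift n x) \<in> ocl (shift n x)"
    by (rule subshiftsD(3)) auto
  then show "ocl x \<subseteq> ocl (shift n x)"
    by (intro ocl_subset) auto
qed

text \<open>Uniform recurrence, which for subshifts is minimality. One bound N for all points turns
  it into inclusions in closed sets, hence into a Borel condition on S.\<close>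

definition recurrent :: "config set \<Rightarrow> bool" where
  "recurrent S \<longleftrightarrow> (\<forall>w\<in>lang S. \<exists>N. S \<subseteq> {x. \<exists>i\<in>{- int N..int N}. occ w x i})"

lemma ocl_eq_if_recurrent:
  assumes "S \<in> subshifts" "recurrent S" "x \<in> S"
  shows "ocl x = S"
proof
  show "ocl x \<subseteq> S" using ocl_subset assms by blast
  have "lang S \<subseteq> lang (ocl x)"
    using assms(2,3) unfolding recurrent_def lang_ocl_iff[abs_def] subset_iff by blast
  then show "S \<subseteq> ocl x" using subshift_subset_iff[OF assms(1)] by simp
qed

text \<open>Periodic positions are taken among all integers rather than residues, so that shifts act
  on them by translation; \<open>holes_iff\<close> is the bridge to residues.\<close>

definition cst :: "int \<Rightarrow> config \<Rightarrow> int \<Rightarrow> bool" where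
  "cst p x i \<longleftrightarrow> (\<forall>k. x (i + k * p) = x i)"

lemma cst_dvd: "cst p x i \<Longrightarrow> p dvd q \<Longrightarrow> cst q x i"
  unfolding cst_def by (metis dvd_def mult.assoc mult.commute)

lemma cst_cong_val:
  assumes "cst p x i" "p dvd j - i"
  shows "x j = x i"
proof -
  obtain k where "j - i = p * k" using assms(2) by blast
  then have "j = i + k * p" by (simp add: algebra_simps)
  then show ?thesis using assms(1) by (simp add: cst_def)
qed

lemma cst_cong:
  assumes "cst p x i" "p dvd j - i"
  shows "cst p x j"
  unfolding cst_def
proof
  fix k
  have "j + k * p - i = (j - i) + k * p" by simp
  then have "p dvd j + k * p - i" using assms(2) by (metis dvd_add dvd_triv_right)
  then show "x (j + k * p) = x j" using cst_cong_val[OF assms(1)] assms(2) by blast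
qed

lemma cst_shift: "cst p (shift n x) i \<longleftrightarrow> cst p x (i - n)"
  by (simp add: cst_def shift_def algebra_simps)

lemma toeplitz_word_iff: "toeplitz_word x \<longleftrightarrow> (\<forall>i. \<exists>p\<ge>1. cst p x i)"
  unfolding toeplitz_word_def cst_def by (metis mult.commute)

lemma toeplitz_window:
  assumes "toeplitz_word x" "p \<ge> 1"
  shows "\<exists>q\<ge>1. p dvd q \<and> (\<forall>i. \<bar>i\<bar> \<le> int n \<longrightarrow> cst q x i)"
proof -
  obtain f where f: "\<And>i. f i \<ge> 1" "\<And>i. cst (f i) x i"
    using assms(1) unfolding toeplitz_word_iff by metis
  let ?q = "p * (\<Prod>i\<in>{- int n..int n}. f i)"
  have "(\<Prod>i\<in>{- int n..int n}. f i) \<ge> 1" using f(1) by (intro prod_ge_1) auto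
  then have "?q \<ge> 1" using assms(2) mult_mono[of 1 p 1 "\<Prod>i\<in>{- int n..int n}. f i"] by simp
  moreover have "f i dvd ?q" if "\<bar>i\<bar> \<le> int n" for i
    using that by (intro dvd_mult dvd_prodI) auto
  then have "cst ?q x i" if "\<bar>i\<bar> \<le> int n" for i
    using cst_dvd[OF f(2)] that by blast
  ultimately show ?thesis by (intro exI[of _ ?q]) auto
qed

text \<open>A word of a Toeplitz point sits in a window with a common period q, hence recurs along
  an arithmetic progression of step q. Gaps bounded by q persist in the orbit closure.\<close>

lemma toeplitz_recurrent:
  assumes "toeplitz_word x"
  shows "recurrent (ocl x)"
  unfolding recurrent_def
proof
  fix w assume "w \<in> lang (ocl x)"
  then obtain i where i: "occ w x i" using lang_ocl_iff by blast
  obtain q where q: "q \<ge> 1" "\<And>j. \<bar>j\<bar> \<le> int (nat \<bar>i\<bar> + length w) \<Longrightarrow> cst q x j"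
    using toeplitz_window[OF assms, of 1 "nat \<bar>i\<bar> + length w"] by auto
  have per: "occ w x (i + k * q)" for k
    unfolding occ_def
  proof (intro allI impI)
    fix j assume j: "j < length w"
    have "cst q x (i + int j)" using j by (intro q(2)) auto
    then have "x (i + int j + k * q) = x (i + int j)" by (auto simp: cst_def)
    then show "x (i + k * q + int j) = w ! j" using i j by (simp add: occ_def algebra_simps)
  qed
  have "\<exists>j\<in>{- int (nat q)..int (nat q)}. occ w y j" if "y \<in> ocl x" for y
  proof -
    have "\<exists>k. agree (length w + nat q) y (shift k x)" using that by (simp add: mem_ocl_iff)
    then obtain k where k: "agree (length w + nat q) y (shift k x)" ..
    define j where "j = (i + k) mod q"
    have j: "0 \<le> j" "j < q" using q(1) by (auto simp: j_def)
    have "occ w (shift k x) j"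
      unfolding occ_shift j_def using per[of "- ((i + k) div q)"]
      by (simp add: minus_div_mult_eq_mod[symmetric] algebra_simps)
    then have "occ w y j" using occ_shorter[OF agree_sym[OF k], of w j] j by simp
    then show ?thesis using j by (intro bexI[of _ j]) auto
  qed
  then show "\<exists>N. ocl x \<subseteq> {y. \<exists>i\<in>{- int N..int N}. occ w y i}" by blast
qed

section \<open>Separated holes as a closed shift-invariant condition\<close>

definition gapset :: "int \<Rightarrow> nat \<Rightarrow> config set" where
  "gapset p N = {x. \<forall>i j. \<not> p dvd i - j \<and> \<bar>i - j\<bar> < int N \<longrightarrow> cst p x i \<or> cst p x j}"

lemma holes_iff: "p \<ge> 1 \<Longrightarrow> i \<in> holes p x \<longleftrightarrow> 0 \<le> i \<and> i < int p \<and> \<not> cst (int p) x i"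
  by (auto simp: holes_def Per_def cst_def)

text \<open>Cyclic distance below N means that suitable representatives of the two residues lie at
  ordinary distance below N. Residues are thus replaced by pairs of integers, for which the
  condition is closed and preserved by shifts.\<close>

lemma hole_gap_iff:
  assumes p: "p \<ge> 1"
  shows "enat N \<le> hole_gap x p \<longleftrightarrow> x \<in> gapset (int p) N"
proof -
  have "enat N \<le> hole_gap x p \<longleftrightarrow>
    (\<forall>i j. i \<in> holes p x \<longrightarrow> j \<in> holes p x \<longrightarrow> i \<noteq> j \<longrightarrow> N \<le> cyclic_dist p i j)" (is "_ \<longleftrightarrow> ?R")
    unfolding hole_gap_def le_Inf_iff Ball_def mem_Collect_eq by (metis enat_ord_simps(1))
  also have "?R \<longleftrightarrow> x \<in> gapset (int p) N"
  proof
    assume R: ?R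
    show "x \<in> gapset (int p) N"
      unfolding gapset_def
    proof (intro CollectI allI impI)
      fix i j assume ij: "\<not> int p dvd i - j \<and> \<bar>i - j\<bar> < int N"
      show "cst (int p) x i \<or> cst (int p) x j"
      proof (rule ccontr)
        assume n: "\<not> (cst (int p) x i \<or> cst (int p) x j)"
        have d: "int p dvd k - k mod int p" for k by (rule dvd_minus_mod)
        have h: "i mod int p \<in> holes p x" "j mod int p \<in> holes p x"
          using n p cst_cong[OF _ d] by (auto simp: holes_iff)
        have "i mod int p \<noteq> j mod int p" using ij by (simp add: mod_eq_dvd_iff)
        then have "N \<le> cyclic_dist p (i mod int p) (j mod int p)" using R h by blast
        then have le: "int N \<le> min ((i - j) mod int p) ((j - i) mod int p)"
          using p by (simp add: cyclic_dist_def mod_simps le_nat_iff)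
        have "(i - j) mod int p \<le> i - j" if "i \<ge> j" using that p by (intro zmod_le_nonneg_dividend) auto
        moreover have "(j - i) mod int p \<le> j - i" if "j \<ge> i" using that p by (intro zmod_le_nonneg_dividend) auto
        ultimately show False using le ij by (cases "i \<ge> j") auto
      qed
    qed
  next
    assume g: "x \<in> gapset (int p) N"
    show ?R
    proof (intro allI impI, rule ccontr)
      fix i j assume h: "i \<in> holes p x" "j \<in> holes p x" "i \<noteq> j" "\<not> N \<le> cyclic_dist p i j"
      have nd: "\<not> int p dvd i - j" using h p
        by (metis holes_iff mod_eq_dvd_iff mod_pos_pos_trivial)
      have key: False if a: "a \<in> holes p x" "b \<in> holes p x" "\<not> int p dvd a - b" "(a - b) mod int p < int N" for a b
      proof -
        \<comment> \<open>The representative of the class of b nearest to a from below. The other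
          direction of the cyclic distance is covered by exchanging a and b.\<close>
        let ?b = "a - (a - b) mod int p"
        have e: "int p dvd b - ?b"
        proof -
          have "b - ?b = - ((a - b) - (a - b) mod int p)" by simp
          then show ?thesis by (metis dvd_minus_iff dvd_minus_mod)
        qed
        have "\<not> int p dvd a - ?b"
        proof
          assume "int p dvd a - ?b"
          moreover have "a - b = (a - ?b) - (b - ?b)" by simp
          ultimately show False using a(3) e by (metis dvd_diff)
        qed
        moreover have "\<bar>a - ?b\<bar> < int N" using a(4) p by simp
        ultimately have "cst (int p) x a \<or> cst (int p) x ?b" using g unfolding gapset_def by blast
        then have "cst (int p) x a \<or> cst (int p) x b" using cst_cong e by blast
        then show False using a p by (auto simp: holes_iff)
      qed
      have nd': "\<not> int p dvd j - i" using nd by (metis dvd_minus_iff minus_diff_eq)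
      have "min ((i - j) mod int p) ((j - i) mod int p) < int N"
        using h(4) p by (auto simp: cyclic_dist_def)
      then show False using key[OF h(1,2) nd] key[OF h(2,1) nd'] by (auto simp: min_def split: if_splits)
    qed
  qed
  finally show ?thesis .
qed

lemma separated_holes_iff:
  "separated_holes x \<longleftrightarrow> (\<forall>N. \<exists>q\<ge>1. \<forall>p\<ge>1. q dvd p \<longrightarrow> x \<in> gapset (int p) N)"
  unfolding separated_holes_def using hole_gap_iff by (metis (no_types, lifting))

lemma not_cst_agree:
  assumes "\<not> cst p x i"
  shows "\<exists>n. \<forall>y. agree n x y \<longrightarrow> \<not> cst p y i"
proof -
  obtain k where k: "x (i + k * p) \<noteq> x i" using assms by (auto simp: cst_def)
  have "\<not> cst p y i" if "agree (nat \<bar>i + k * p\<bar> + nat \<bar>i\<bar>) x y" for y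
  proof -
    have "y (i + k * p) = x (i + k * p)" "y i = x i" using that by (auto simp: agree_def)
    then show ?thesis using k by (auto simp: cst_def)
  qed
  then show ?thesis by blast
qed

lemma closed_cst: "closed {x. cst p x i}"
proof -
  have "open {x. \<not> cst p x i}"
    unfolding open_config_iff using not_cst_agree by auto
  then show ?thesis by (simp add: closed_def Collect_neg_eq)
qed

lemma closed_gapset: "closed (gapset p N)"
proof -
  have "gapset p N = (\<Inter>i. \<Inter>j. if \<not> p dvd i - j \<and> \<bar>i - j\<bar> < int N then {x. cst p x i} \<union> {x. cst p x j} else UNIV)"
    by (auto simp: gapset_def)
  moreover have "closed \<dots>"
    by (intro closed_INT ballI) (use closed_cst in auto)
  ultimately show ?thesis by simp
qed

lemma gapset_shift: "x \<in> gapset p N \<Longrightarrow> shift n x \<in> gapset p N"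
  unfolding gapset_def
proof (intro CollectI allI impI)
  fix i j assume x: "x \<in> {x. \<forall>i j. \<not> p dvd i - j \<and> \<bar>i - j\<bar> < int N \<longrightarrow> cst p x i \<or> cst p x j}"
    and ij: "\<not> p dvd i - j \<and> \<bar>i - j\<bar> < int N"
  have "\<not> p dvd (i - n) - (j - n) \<and> \<bar>(i - n) - (j - n)\<bar> < int N" using ij by simp
  then show "cst p (shift n x) i \<or> cst p (shift n x) j" using x cst_shift by blast
qed

lemma ocl_subset_gapset: "x \<in> gapset p N \<Longrightarrow> ocl x \<subseteq> gapset p N"
  unfolding ocl_def by (rule closure_minimal) (auto simp: closed_gapset gapset_shift)

section \<open>Orbit closures under the p-th power of the shift, which keep track of the phase
  modulo p\<close>

definition pcl :: "int \<Rightarrow> config \<Rightarrow> config set" where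
  "pcl p x = {y. \<forall>n. \<exists>k. agree n y (shift (k * p) x)}"

lemma pcl_subset_ocl: "pcl p x \<subseteq> ocl x"
  unfolding pcl_def using mem_ocl_iff by blast

text \<open>If every residue s failed from some window on, the largest of these p windows would
  exclude all shifts at once.\<close>

lemma ocl_split:
  assumes "y \<in> ocl x" "p \<ge> 1"
  shows "\<exists>s\<in>{0..<p}. y \<in> pcl p (shift s x)"
proof (rule ccontr)
  assume "\<not> ?thesis"
  then have "\<forall>s\<in>{0..<p}. \<exists>n. \<forall>k. \<not> agree n y (shift (k * p + s) x)"
    by (auto simp: pcl_def)
  then obtain N where N: "\<And>s k. s \<in> {0..<p} \<Longrightarrow> \<not> agree (N s) y (shift (k * p + s) x)"
    by metis
  let ?M = "Max (N ` {0..<p})"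
  obtain k where k: "agree ?M y (shift k x)" using assms(1) mem_ocl_iff by blast
  have s: "k mod p \<in> {0..<p}" using assms(2) by simp
  have "agree (N (k mod p)) y (shift k x)"
    by (rule agree_mono[OF k]) (use s in \<open>auto intro!: Max_ge\<close>)
  then show False using N[OF s, of "k div p"] by simp
qed

lemma pcl_cst_val:
  assumes y: "y \<in> pcl p x" and c: "\<And>l. x (i + l * q) = b" and d: "q dvd p"
  shows "y (i + l * q) = b"
proof -
  obtain k where "agree (nat \<bar>i + l * q\<bar>) y (shift (k * p) x)" using y by (auto simp: pcl_def)
  then have "y (i + l * q) = x (i + l * q - k * p)" by (auto simp: agree_def shift_def)
  moreover obtain e where "p = q * e" using d by blast
  then have "i + l * q - k * p = i + (l - k * e) * q" by (simp add: algebra_simps)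
  ultimately show ?thesis using c by simp
qed

text \<open>Recurrence lets one move a point with a large periodic window into the \<open>p\<close>-orbit closure of the
  previous one.\<close>

lemma toeplitz_point_exists:
  assumes S: "S \<in> subshifts" "recurrent S"
    and per: "\<And>n. \<exists>p\<ge>1. \<exists>x\<in>S. \<forall>i. \<bar>i\<bar> \<le> int n \<longrightarrow> cst p x i"
  shows "\<exists>x\<in>S. toeplitz_word x"
proof -
  let ?P = "\<lambda>n (x, p). x \<in> S \<and> p \<ge> 1 \<and> (\<forall>i. \<bar>i\<bar> \<le> int n \<longrightarrow> cst p x i)"
  let ?Q = "\<lambda>n (x, p) (x', p'). x' \<in> pcl p x \<and> p dvd p'"
  have "\<exists>f. \<forall>n. ?P n (f n) \<and> ?Q n (f n) (f (Suc n))"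
  proof (rule dependent_nat_choice)
    show "\<exists>z. ?P 0 z" using per[of 0] by auto
  next
    fix z n assume z: "?P n z"
    obtain x p where xp: "z = (x, p)" by (cases z)
    \<comment> \<open>The extra \<open>nat p\<close> leaves room for moving the new point by some s
      < p back into the p-orbit closure of the old one.\<close>
    obtain q y where q: "q \<ge> 1" "y \<in> S" "\<And>i. \<bar>i\<bar> \<le> int (Suc n + nat p) \<Longrightarrow> cst q y i"
      using per[of "Suc n + nat p"] by blast
    have "y \<in> ocl x" using ocl_eq_if_recurrent[OF S] z xp q(2) by auto
    then obtain s where s: "s \<in> {0..<p}" "y \<in> pcl p (shift s x)"
      using ocl_split[of y x p] z xp by auto
    let ?x = "shift (- s) y"
    have "?x \<in> pcl p x" unfolding pcl_def
    proof (intro CollectI allI)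
      fix m
      obtain k where "agree (m + nat \<bar>- s\<bar>) y (shift (k * p) (shift s x))" using s(2) by (auto simp: pcl_def)
      from shift_agree[OF this] show "\<exists>k. agree m ?x (shift (k * p) x)" by auto
    qed
    moreover have "?x \<in> S" using subshiftsD(3)[OF S(1) q(2)] .
    moreover have "cst (p * q) ?x i" if "\<bar>i\<bar> \<le> int (Suc n)" for i
      unfolding cst_shift using that s(1) z xp by (intro cst_dvd[OF q(3)]) auto
    moreover have "1 \<le> p * q" using z xp q(1) mult_mono[of 1 p 1 q] by auto
    ultimately show "\<exists>z'. ?P (Suc n) z' \<and> ?Q n z z'"
      using xp by (intro exI[of _ "(?x, p * q)"]) auto
  qed
  then obtain f where f': "\<forall>n. ?P n (f n) \<and> ?Q n (f n) (f (Suc n))" ..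
  have f: "?P n (f n)" "?Q n (f n) (f (Suc n))" for n
    using spec[OF f', of n] by (rule conjunct1, rule conjunct2)
  define X where "X n = fst (f n)" for n
  define P where "P n = snd (f n)" for n
  have f_eq: "f n = (X n, P n)" for n by (simp add: X_def P_def)
  have X: "X n \<in> S" "P n \<ge> 1" "\<And>i. \<bar>i\<bar> \<le> int n \<Longrightarrow> cst (P n) (X n) i"
    "X (Suc n) \<in> pcl (P n) (X n)" "P n dvd P (Suc n)" for n
    using f[of n] by (auto simp: f_eq)
  have dv: "P n dvd P m" if "n \<le> m" for n m
    using that by (induction m rule: dec_induct) (use X(5) dvd_trans in auto)
  have val: "X m (i + l * P n) = X n i" if "n \<le> m" "\<bar>i\<bar> \<le> int n" for n m i l
    using that(1)
  proof (induction m arbitrary: l rule: dec_induct)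
    case base
    then show ?case using X(3)[OF that(2)] by (simp add: cst_def)
  next
    case (step m)
    show ?case by (rule pcl_cst_val[OF X(4)[of m] step.IH dv[OF step(1)]])
  qed
  have val0: "X m i = X n i" if "n \<le> m" "\<bar>i\<bar> \<le> int n" for n m i
    using val[OF that, of 0] by simp
  \<comment> \<open>Diagonal limit: by \<open>val\<close>, the values in the window of radius n are
    fixed, together with their period \<open>P n\<close>, from stage n on.\<close>
  define x where "x i = X (nat \<bar>i\<bar>) i" for i
  have "x \<in> S"
    using subshiftsD(2)[OF S(1)] unfolding closed_config_iff
  proof (elim allE impE)
    show "\<forall>n. \<exists>y\<in>S. agree n x y"
    proof
      fix n
      have "X (nat \<bar>j\<bar>) j = X n j" if "\<bar>j\<bar> \<le> int n" for j
        by (rule val0[symmetric]) (use that in auto)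
      then have "agree n x (X n)" unfolding agree_def x_def by blast
      then show "\<exists>y\<in>S. agree n x y" using X(1) by blast
    qed
  qed
  moreover have "toeplitz_word x" unfolding toeplitz_word_iff
  proof (intro allI exI conjI)
    fix i
    let ?n = "nat \<bar>i\<bar>"
    show "P ?n \<ge> 1" by (rule X(2))
    show "cst (P ?n) x i" unfolding cst_def
    proof
      fix k
      let ?j = "i + k * P ?n"
      let ?m = "max ?n (nat \<bar>?j\<bar>)"
      have "x ?j = X ?m ?j" unfolding x_def by (rule val0[symmetric]) auto
      also have "\<dots> = X ?n i" by (rule val) auto
      finally show "x ?j = x i" by (simp add: x_def)
    qed
  qed
  ultimately show ?thesis by blast
qed

text \<open>The quantifier over Toeplitz words is eliminated: long periodic windows at varying
  points suffice by \<open>toeplitz_point_exists\<close>. What remains is a countable combination of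
  hitting and inclusion conditions for closed sets, hence Borel. Separation spreads from one word to
  all points because \<open>gapset\<close> is closed and shift-invariant.\<close>

lemma toeplitz_sep_iff:
  "S \<in> toeplitz_sep \<longleftrightarrow> S \<in> subshifts \<and> recurrent S
    \<and> (\<forall>n. \<exists>p\<ge>1. S \<inter> {x. \<forall>i\<in>{- int n..int n}. cst p x i} \<noteq> {})
    \<and> (\<forall>N. \<exists>q\<ge>1. \<forall>p\<ge>1. q dvd p \<longrightarrow> S \<subseteq> gapset (int p) N)" (is "_ \<longleftrightarrow> ?R")
proof
  assume "S \<in> toeplitz_sep"
  then obtain x y where x: "toeplitz_word x" "S = ocl x" and y: "y \<in> S" "toeplitz_word y" "separated_holes y"
    by (auto simp: toeplitz_sep_def toeplitz_subshift_def ocl_def)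
  have S: "S \<in> subshifts" "recurrent S" using x toeplitz_recurrent by auto
  have "\<exists>p\<ge>1. S \<inter> {x. \<forall>i\<in>{- int n..int n}. cst p x i} \<noteq> {}" for n
  proof -
    obtain q where "q \<ge> 1" "\<forall>i. \<bar>i\<bar> \<le> int n \<longrightarrow> cst q x i" using toeplitz_window[OF x(1), of 1 n] by auto
    then have "x \<in> S \<inter> {x. \<forall>i\<in>{- int n..int n}. cst q x i}" using x(2) by auto
    then show ?thesis using \<open>q \<ge> 1\<close> by blast
  qed
  moreover have "S = ocl y" using ocl_eq_if_recurrent[OF S y(1)] by simp
  then have "\<forall>N. \<exists>q\<ge>1. \<forall>p\<ge>1. q dvd p \<longrightarrow> S \<subseteq> gapset (int p) N"
    using y(3) ocl_subset_gapset unfolding separated_holes_iff by metis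
  ultimately show ?R using S by blast
next
  assume R: ?R
  have "\<exists>x\<in>S. toeplitz_word x"
  proof (rule toeplitz_point_exists)
    fix n
    obtain p x where "p \<ge> 1" "x \<in> S" "\<forall>i\<in>{- int n..int n}. cst p x i" using R by blast
    then show "\<exists>p\<ge>1. \<exists>x\<in>S. \<forall>i. \<bar>i\<bar> \<le> int n \<longrightarrow> cst p x i"
      by (intro exI[of _ p] conjI bexI[of _ x]) (auto simp: abs_le_iff)
  qed (use R in auto)
  then obtain x where x: "x \<in> S" "toeplitz_word x" by blast
  have "S = ocl x" using ocl_eq_if_recurrent R x(1) by blast
  moreover have "separated_holes x"
    unfolding separated_holes_iff using R x(1) by (meson subsetD)
  ultimately show "S \<in> toeplitz_sep"
    using x unfolding toeplitz_sep_def toeplitz_subshift_def ocl_def by blast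
qed

lemma toeplitz_sep_measurable: "toeplitz_sep \<in> sets subshift_space"
proof -
  have rec: "Measurable.pred subshift_space recurrent"
  proof -
    have "closed {x. \<exists>i\<in>{- int N..int N}. occ w x i}" for N w
    proof -
      have "{x. \<exists>i\<in>{- int N..int N}. occ w x i} = (\<Union>i\<in>{- int N..int N}. {x. occ w x i})" by auto
      then show ?thesis using closed_occ by (metis closed_UN finite_atLeastAtMost_int)
    qed
    note subset_closed_measurable[OF this, measurable]
    show ?thesis unfolding recurrent_def Ball_def by measurable
  qed
  have hit: "Measurable.pred subshift_space (\<lambda>S. S \<inter> {x. \<forall>i\<in>{- int n..int n}. cst p x i} \<noteq> {})" for n p
  proof (rule hit_closed_measurable)
    have "{x. \<forall>i\<in>{- int n..int n}. cst p x i} = (\<Inter>i\<in>{- int n..int n}. {x. cst p x i})" by auto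
    then show "closed {x. \<forall>i\<in>{- int n..int n}. cst p x i}" using closed_cst by (metis closed_INT)
  qed
  note [measurable] = rec hit subset_closed_measurable[OF closed_gapset]
  have "{S \<in> space subshift_space. recurrent S
    \<and> (\<forall>n. \<exists>p. p \<ge> 1 \<and> S \<inter> {x. \<forall>i\<in>{- int n..int n}. cst p x i} \<noteq> {})
    \<and> (\<forall>N. \<exists>q::nat. q \<ge> 1 \<and> (\<forall>p\<ge>1. q dvd p \<longrightarrow> S \<subseteq> gapset (int p) N))} \<in> sets subshift_space"
    by measurable
  also have "{S \<in> space subshift_space. recurrent S
    \<and> (\<forall>n. \<exists>p. p \<ge> 1 \<and> S \<inter> {x. \<forall>i\<in>{- int n..int n}. cst p x i} \<noteq> {})
    \<and> (\<forall>N. \<exists>q::nat. q \<ge> 1 \<and> (\<forall>p\<ge>1. q dvd p \<longrightarrow> S \<subseteq> gapset (int p) N))} = toeplitz_sep"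
    using toeplitz_sep_iff by auto
  finally show ?thesis .
qed

lemma toeplitz_sepD:
  assumes "S \<in> toeplitz_sep"
  shows "S \<in> subshifts" "recurrent S" "x \<in> S \<Longrightarrow> ocl x = S" "\<exists>x\<in>S. toeplitz_word x"
    "\<exists>q\<ge>1. \<forall>p\<ge>1. q dvd p \<longrightarrow> S \<subseteq> gapset (int p) N"
proof -
  show S: "S \<in> subshifts" "recurrent S" and "\<exists>q\<ge>1. \<forall>p\<ge>1. q dvd p \<longrightarrow> S \<subseteq> gapset (int p) N"
    using assms toeplitz_sep_iff by auto
  show "x \<in> S \<Longrightarrow> ocl x = S" using ocl_eq_if_recurrent S by blast
  show "\<exists>x\<in>S. toeplitz_word x" using assms by (auto simp: toeplitz_sep_def)
qed

section \<open>Block codes\<close>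

text \<open>A pair consists of a radius and the list of windows that are mapped to True; keeping the
  windows in a list makes the type of codes countable.\<close>

definition code :: "nat \<times> bool list list \<Rightarrow> config \<Rightarrow> config" where
  "code c x = (\<lambda>j. window (fst c) (shift (- j) x) \<in> set (snd c))"

lemma code_shift: "code c (shift n x) = shift n (code c x)"
  by (auto simp: code_def shift_apply)

lemma code_eq_at:
  assumes "\<And>k. \<bar>k\<bar> \<le> int (fst c) \<Longrightarrow> x (i + k) = y (j + k)"
  shows "code c x i = code c y j"
proof -
  have "agree (fst c) (shift (- i) x) (shift (- j) y)"
    using assms by (auto simp: agree_def shift_apply add.commute)
  then show ?thesis by (simp add: code_def window_eq_iff[symmetric])
qed

lemma code_agree:
  assumes "agree (n + fst c) x y"
  shows "agree n (code c x) (code c y)"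
  unfolding agree_def
proof (intro allI impI code_eq_at)
  fix j k assume "\<bar>j\<bar> \<le> int n" "\<bar>k\<bar> \<le> int (fst c)"
  then show "x (j + k) = y (j + k)" using assms by (auto simp: agree_def)
qed

lemma open_vimage_code:
  assumes "open U"
  shows "open {x. code c x \<in> U}"
  unfolding open_config_iff
proof
  fix x assume "x \<in> {x. code c x \<in> U}"
  then obtain n where "\<forall>y. agree n (code c x) y \<longrightarrow> y \<in> U" using assms by (auto simp: open_config_iff)
  then have "\<forall>y. agree (n + fst c) x y \<longrightarrow> y \<in> {x. code c x \<in> U}" using code_agree by blast
  then show "\<exists>n. \<forall>y. agree n x y \<longrightarrow> y \<in> {x. code c x \<in> U}" by blast
qed

lemma continuous_on_code: "continuous_on A (code c)"
proof -
  have "continuous_on UNIV (code c)"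
    unfolding continuous_on_open_vimage[OF open_UNIV]
    using open_vimage_code by (auto simp: vimage_def)
  then show ?thesis using continuous_on_subset by blast
qed

lemma closed_code_fixed: "closed {x. code d (code c x) = x}"
  unfolding closed_config_iff
proof (intro allI impI)
  fix x assume *: "\<forall>n. \<exists>y\<in>{x. code d (code c x) = x}. agree n x y"
  have "code d (code c x) j = x j" for j
  proof -
    let ?n = "nat \<bar>j\<bar>"
    obtain y where y: "code d (code c y) = y" "agree (?n + fst d + fst c) x y" using * by blast
    have "agree ?n (code d (code c x)) (code d (code c y))"
      using code_agree[OF code_agree[OF y(2)]] .
    moreover have "agree ?n x y" using agree_mono[OF y(2)] by simp
    ultimately show ?thesis using y(1) by (auto simp: agree_def)
  qed
  then show "x \<in> {x. code d (code c x) = x}" by auto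
qed

text \<open>The points with f x 0 true and those with f x 0 false form disjoint compact sets, so
  windows of some radius r distinguish them; equivariance transports the rule from 0 to every
  position.\<close>

lemma curtis_hedlund_lyndon:
  assumes S: "closed S" "\<And>n x. x \<in> S \<Longrightarrow> shift n x \<in> S"
    and f: "continuous_on S f" "\<And>n x. x \<in> S \<Longrightarrow> f (shift n x) = shift n (f x)"
  shows "\<exists>c. \<forall>x\<in>S. f x = code c x"
proof -
  have cl: "closed (S \<inter> f -` {y. occ [b] y 0})" for b
    by (rule continuous_closed_preimage[OF f(1) S(1) closed_occ])
  have f0: "S \<inter> f -` {y. occ [b] y 0} = {x \<in> S. f x 0 = b}" for b
    by (auto simp: occ_def)
  have "{x \<in> S. f x 0 = True} \<inter> {x \<in> S. f x 0 = False} = {}" by auto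
  then obtain r where r: "{x \<in> S. f x 0 = True} \<inter> near r {x \<in> S. f x 0 = False} = {}"
    using hit_closed_iff[OF cl[of True] cl[of False]] unfolding f0 by blast
  let ?D = "window r ` {x \<in> S. f x 0}"
  have "finite ?D"
    by (rule finite_subset[OF _ finite_lists_length_eq[of "UNIV :: bool set" "2 * r + 1"]]) auto
  then obtain ds where ds: "set ds = ?D" using finite_list by blast
  have "f x j = code (r, ds) x j" if x: "x \<in> S" for x j
  proof -
    let ?y = "shift (- j) x"
    have y: "?y \<in> S" using S(2) x by blast
    have "f x j = f ?y 0" using f(2)[OF x, of "- j"] by (simp add: shift_apply)
    also have "\<dots> \<longleftrightarrow> window r ?y \<in> ?D"
    proof
      assume "window r ?y \<in> ?D"
      then obtain z where z: "z \<in> S" "f z 0" "agree r z ?y" by (auto simp: window_eq_iff agree_sym)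
      then show "f ?y 0" using r y unfolding near_def by blast
    qed (use y in blast)
    finally show ?thesis using ds by (simp add: code_def)
  qed
  then show ?thesis by blast
qed

text \<open>Expressed through inclusions so that it is a Borel condition on the pair (S, T);
  countably many witnesses (c, d) then make conjugacy Borel with countable classes.\<close>

definition code_conj :: "nat \<times> bool list list \<Rightarrow> nat \<times> bool list list \<Rightarrow> config set \<Rightarrow> config set \<Rightarrow> bool" where
  "code_conj c d S T \<longleftrightarrow> code c ` S \<subseteq> T \<and> code d ` T \<subseteq> S
     \<and> S \<subseteq> {x. code d (code c x) = x} \<and> T \<subseteq> {y. code c (code d y) = y}"

lemma code_conj_image:
  assumes "code_conj c d S T"
  shows "T = code c ` S"
proof (intro subset_antisym subsetI)
  fix y assume "y \<in> T"
  then have "code d y \<in> S" "code c (code d y) = y" using assms by (auto simp: code_conj_def)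
  then show "y \<in> code c ` S" by (metis imageI)
qed (use assms in \<open>auto simp: code_conj_def\<close>)

lemma top_conjugate_iff:
  assumes S: "S \<in> subshifts" and T: "T \<in> subshifts"
  shows "top_conjugate S T \<longleftrightarrow> (\<exists>c d. code_conj c d S T)"
proof
  assume "top_conjugate S T"
  then obtain f g where fg: "homeomorphism S T f g" "\<And>n x. x \<in> S \<Longrightarrow> f (shift n x) = shift n (f x)"
    by (auto simp: top_conjugate_def)
  have h: "continuous_on S f" "continuous_on T g" "f ` S = T" "g ` T = S"
    "\<And>x. x \<in> S \<Longrightarrow> g (f x) = x" "\<And>y. y \<in> T \<Longrightarrow> f (g y) = y"
    using fg(1) by (auto simp: homeomorphism_def)
  have geq: "g (shift n y) = shift n (g y)" if "y \<in> T" for n y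
  proof -
    have "g y \<in> S" using h(4) that by blast
    then have "g (f (shift n (g y))) = shift n (g y)" using h(5) subshiftsD(3)[OF S] by blast
    then show ?thesis using fg(2)[OF \<open>g y \<in> S\<close>] h(6)[OF that] by simp
  qed
  obtain c where c: "\<forall>x\<in>S. f x = code c x"
    using curtis_hedlund_lyndon[OF subshiftsD(2,3)[OF S] h(1) fg(2)] by blast
  obtain d where d: "\<forall>x\<in>T. g x = code d x"
    using curtis_hedlund_lyndon[OF subshiftsD(2,3)[OF T] h(2) geq] by blast
  have "code_conj c d S T" unfolding code_conj_def using c d h by force
  then show "\<exists>c d. code_conj c d S T" by blast
next
  assume "\<exists>c d. code_conj c d S T"
  then obtain c d where cd: "code_conj c d S T" by blast
  have 1: "code c ` S = T" using code_conj_image[OF cd] by simp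
  have 2: "code d ` T = S"
    by (rule code_conj_image[symmetric, of d c]) (use cd in \<open>auto simp: code_conj_def\<close>)
  have "homeomorphism S T (code c) (code d)"
    unfolding homeomorphism_def using cd 1 2 continuous_on_code by (auto simp: code_conj_def)
  then show "top_conjugate S T" unfolding top_conjugate_def using code_shift by blast
qed

lemma top_conjugate_refl: "top_conjugate S S"
  unfolding top_conjugate_def
  by (intro exI[of _ "\<lambda>x. x"]) (auto simp: homeomorphism_def)

lemma top_conjugate_sym:
  assumes "S \<in> subshifts" "T \<in> subshifts" "top_conjugate S T"
  shows "top_conjugate T S"
  using assms unfolding top_conjugate_iff[OF assms(1,2)] top_conjugate_iff[OF assms(2,1)]
  by (auto simp: code_conj_def)

lemma top_conjugate_trans:
  assumes "top_conjugate S T" "top_conjugate T U"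
  shows "top_conjugate S U"
proof -
  obtain f g where f: "homeomorphism S T f g" "\<And>n x. x \<in> S \<Longrightarrow> f (shift n x) = shift n (f x)"
    using assms(1) by (auto simp: top_conjugate_def)
  obtain f' g' where f': "homeomorphism T U f' g'" "\<And>n x. x \<in> T \<Longrightarrow> f' (shift n x) = shift n (f' x)"
    using assms(2) by (auto simp: top_conjugate_def)
  have "homeomorphism S U (f' \<circ> f) (g \<circ> g')" by (rule homeomorphism_compose[OF f(1) f'(1)])
  moreover have "(f' \<circ> f) (shift n x) = shift n ((f' \<circ> f) x)" if "x \<in> S" for n x
    using f(2)[OF that, of n] f'(2)[of "f x" n] f(1) that by (auto simp: homeomorphism_def)
  ultimately show ?thesis unfolding top_conjugate_def by blast
qed

lemma equiv_conjugacy_sep: "equiv toeplitz_sep conjugacy_sep"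
proof (rule equivI)
  show "sym conjugacy_sep"
    by (rule symI) (auto simp: conjugacy_sep_def intro: top_conjugate_sym toeplitz_sepD(1))
  show "trans conjugacy_sep"
    by (rule transI) (auto simp: conjugacy_sep_def intro: top_conjugate_trans)
qed (auto simp: conjugacy_sep_def refl_on_def intro: top_conjugate_refl)

lemma conjugacy_sep_iff:
  "(S, T) \<in> conjugacy_sep \<longleftrightarrow> S \<in> toeplitz_sep \<and> T \<in> toeplitz_sep \<and> (\<exists>c d. code_conj c d S T)"
  using top_conjugate_iff[OF toeplitz_sepD(1) toeplitz_sepD(1), of S T] by (auto simp: conjugacy_sep_def)

lemma countable_conjugacy_class: "countable (conjugacy_sep `` {S})"
proof (rule countable_subset)
  show "conjugacy_sep `` {S} \<subseteq> range (\<lambda>c. code c ` S)"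
  proof
    fix T assume "T \<in> conjugacy_sep `` {S}"
    then obtain c d where "code_conj c d S T" by (auto simp: conjugacy_sep_iff)
    then show "T \<in> range (\<lambda>c. code c ` S)" using code_conj_image[of c d S T] by blast
  qed
qed auto

text \<open>A word of the image pulls back to an open set, so each tested condition is Borel.
  Shift-invariance moves every window to position 0.\<close>

lemma code_image_subset_iff:
  assumes "S \<in> subshifts" "T \<in> subshifts"
  shows "code c ` S \<subseteq> T \<longleftrightarrow> (\<forall>w. S \<inter> {x. code c x \<in> {y. occ w y 0}} \<noteq> {} \<longrightarrow> w \<in> lang T)"
proof
  assume "code c ` S \<subseteq> T"
  then show "\<forall>w. S \<inter> {x. code c x \<in> {y. occ w y 0}} \<noteq> {} \<longrightarrow> w \<in> lang T"
    by (auto simp: lang_def)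
next
  assume *: "\<forall>w. S \<inter> {x. code c x \<in> {y. occ w y 0}} \<noteq> {} \<longrightarrow> w \<in> lang T"
  show "code c ` S \<subseteq> T"
  proof (intro image_subsetI subshift_memI[OF assms(2)])
    fix x n assume x: "x \<in> S"
    have "occ (window n (code c x)) (code c x) (- int n)" by (simp add: occ_window_iff)
    then have "occ (window n (code c x)) (code c (shift (int n) x)) 0"
      by (simp add: code_shift occ_shift)
    moreover have "shift (int n) x \<in> S" using x subshiftsD(3)[OF assms(1)] by blast
    ultimately show "window n (code c x) \<in> lang T" using * by blast
  qed
qed

lemma code_conj_measurable:
  "Measurable.pred (subshift_space \<Otimes>\<^sub>M subshift_space) (\<lambda>(S, T). code_conj c d S T)"
proof -
  have sub: "Measurable.pred (subshift_space \<Otimes>\<^sub>M subshift_space) (\<lambda>(S, T). code c ` S \<subseteq> T)" for c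
  proof -
    note hit_open_measurable[OF open_vimage_code[OF open_occ], measurable]
    have "Measurable.pred (subshift_space \<Otimes>\<^sub>M subshift_space)
      (\<lambda>(S, T). \<forall>w. S \<inter> {x. code c x \<in> {y. occ w y 0}} \<noteq> {} \<longrightarrow> w \<in> lang T)"
      by measurable
    then show ?thesis
    proof (rule measurable_cong[THEN iffD1, rotated])
      fix z assume "z \<in> space (subshift_space \<Otimes>\<^sub>M subshift_space)"
      then obtain S T where z: "z = (S, T)" "S \<in> subshifts" "T \<in> subshifts"
        by (auto simp: space_pair_measure)
      show "(case z of (S, T) \<Rightarrow> \<forall>w. S \<inter> {x. code c x \<in> {y. occ w y 0}} \<noteq> {} \<longrightarrow> w \<in> lang T) \<longleftrightarrow>
        (case z of (S, T) \<Rightarrow> code c ` S \<subseteq> T)"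
        unfolding z(1) prod.case using code_image_subset_iff[OF z(2,3)] by (rule sym)
    qed
  qed
  note [measurable] = sub subset_closed_measurable[OF closed_code_fixed]
  have 1: "Measurable.pred (subshift_space \<Otimes>\<^sub>M subshift_space) (\<lambda>z. code c ` fst z \<subseteq> snd z)"
    using sub[of c] by (simp add: case_prod_beta')
  have 2: "Measurable.pred (subshift_space \<Otimes>\<^sub>M subshift_space) (\<lambda>z. code d ` snd z \<subseteq> fst z)"
  proof -
    have "Measurable.pred (subshift_space \<Otimes>\<^sub>M subshift_space) (\<lambda>z. case (snd z, fst z) of (S, T) \<Rightarrow> code d ` S \<subseteq> T)"
      by measurable
    then show ?thesis by simp
  qed
  note [measurable] = 1 2
  show ?thesis unfolding code_conj_def case_prod_beta' by measurable
qed

lemma conjugacy_sep_measurable: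
  "conjugacy_sep \<in> sets (subshift_space \<Otimes>\<^sub>M subshift_space)"
proof -
  note [measurable] = code_conj_measurable toeplitz_sep_measurable
  have "{z \<in> space (subshift_space \<Otimes>\<^sub>M subshift_space).
      fst z \<in> toeplitz_sep \<and> snd z \<in> toeplitz_sep \<and> (\<exists>c d. case z of (S, T) \<Rightarrow> code_conj c d S T)}
    \<in> sets (subshift_space \<Otimes>\<^sub>M subshift_space)"
    by measurable
  also have "{z \<in> space (subshift_space \<Otimes>\<^sub>M subshift_space).
      fst z \<in> toeplitz_sep \<and> snd z \<in> toeplitz_sep \<and> (\<exists>c d. case z of (S, T) \<Rightarrow> code_conj c d S T)} = conjugacy_sep"
  proof (rule set_eqI)
    fix z :: "config set \<times> config set"
    obtain S T where z: "z = (S, T)" by (cases z)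
    show "z \<in> {z \<in> space (subshift_space \<Otimes>\<^sub>M subshift_space).
      fst z \<in> toeplitz_sep \<and> snd z \<in> toeplitz_sep \<and> (\<exists>c d. case z of (S, T) \<Rightarrow> code_conj c d S T)}
      \<longleftrightarrow> z \<in> conjugacy_sep"
      unfolding z mem_Collect_eq conjugacy_sep_iff space_pair_measure prod.case fst_conv snd_conv
        mem_Sigma_iff space_subshift_space using toeplitz_sepD(1) by blast
  qed
  finally show ?thesis .
qed

section \<open>Measurable choices\<close>

abbreviation config_space :: "config measure" where
  "config_space \<equiv> Pi\<^sub>M UNIV (\<lambda>_. count_space UNIV)"

lemma coord_measurable [measurable]: "Measurable.pred config_space (\<lambda>x. x i)"
  by (rule measurable_component_singleton) simp

lemma measurable_to_config_space:
  assumes "\<And>i. Measurable.pred N (\<lambda>x. f x i)"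
  shows "f \<in> measurable N config_space"
  using measurable_PiM_single'[of UNIV "\<lambda>i x. f x i" N "\<lambda>_. count_space UNIV"] assms by simp

lemma occ_measurable [measurable]: "Measurable.pred config_space (\<lambda>x. occ w x i)"
  unfolding occ_def by measurable

lemma shift_measurable [measurable]: "shift n \<in> measurable config_space config_space"
  by (rule measurable_to_config_space) (simp add: shift_apply)

lemma code_measurable [measurable]: "code c \<in> measurable config_space config_space"
proof (rule measurable_to_config_space)
  fix j
  have *: "window n x = w \<longleftrightarrow> length w = 2 * n + 1 \<and> occ w x (- int n)" for n x w
    by (auto simp: list_eq_iff_nth_eq nth_window occ_def)
  have "code c x j \<longleftrightarrow> (\<exists>w\<in>set (snd c). window (fst c) (shift (- j) x) = w)" for x
    by (auto simp: code_def)
  then show "Measurable.pred config_space (\<lambda>x. code c x j)"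
    unfolding * occ_shift by simp
qed

lemma ocl_measurable [measurable]: "ocl \<in> measurable config_space subshift_space"
  by (rule measurable_to_subshift_space) (auto simp: lang_ocl_iff)

section \<open>A Borel choice of a point\<close>

definition lex_occ :: "bool list \<Rightarrow> config \<Rightarrow> bool" where
  "lex_occ l x \<longleftrightarrow> (\<forall>j<length l. x (int_decode j) = l ! j)"

primrec lex_prefix :: "config set \<Rightarrow> nat \<Rightarrow> bool list" where
  "lex_prefix S 0 = []"
| "lex_prefix S (Suc n) = lex_prefix S n @ [\<exists>x\<in>S. lex_occ (lex_prefix S n @ [True]) x]"

text \<open>The lexicographically largest point of S, with True above False and the integers
  enumerated by \<open>int_decode\<close>. Each greedy step asks whether S meets an open set, so the
  choice is Borel; closedness of S puts the limit into S.\<close>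

definition point :: "config set \<Rightarrow> config" where
  "point S i = lex_prefix S (Suc (int_encode i)) ! int_encode i"

lemma length_lex_prefix [simp]: "length (lex_prefix S n) = n"
  by (induction n) auto

lemma lex_occ_snoc: "lex_occ (l @ [b]) x \<longleftrightarrow> lex_occ l x \<and> x (int_decode (length l)) = b"
  by (auto simp: lex_occ_def nth_append less_Suc_eq)

lemma lex_prefix_occ: "S \<noteq> {} \<Longrightarrow> \<exists>x\<in>S. lex_occ (lex_prefix S n) x"
proof (induction n)
  case (Suc n)
  then show ?case
    by (cases "\<exists>x\<in>S. lex_occ (lex_prefix S n @ [True]) x") (auto simp: lex_occ_snoc)
qed (auto simp: lex_occ_def)

lemma lex_prefix_nth: "j < n \<Longrightarrow> n \<le> m \<Longrightarrow> lex_prefix S m ! j = lex_prefix S n ! j"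
proof (induction m)
  case (Suc m)
  then show ?case by (cases "n = Suc m") (auto simp: nth_append)
qed auto

lemma point_in:
  assumes "S \<in> subshifts"
  shows "point S \<in> S"
  using subshiftsD(2)[OF assms] unfolding closed_config_iff
proof (elim allE impE)
  show "\<forall>n. \<exists>y\<in>S. agree n (point S) y"
  proof
    fix n
    define N where "N = Suc (Max (int_encode ` {- int n..int n}))"
    have N: "int_encode j < N" if "\<bar>j\<bar> \<le> int n" for j
      unfolding N_def less_Suc_eq_le by (rule Max_ge) (use that in \<open>auto simp: abs_le_iff\<close>)
    obtain y where y: "y \<in> S" "lex_occ (lex_prefix S N) y"
      using lex_prefix_occ subshiftsD(1)[OF assms] by blast
    have "point S j = y j" if "\<bar>j\<bar> \<le> int n" for j
    proof -
      have "point S j = lex_prefix S N ! int_encode j"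
        unfolding point_def using N[OF that] by (intro lex_prefix_nth[symmetric]) auto
      also have "\<dots> = y (int_decode (int_encode j))"
        using y(2) N[OF that] unfolding lex_occ_def by (simp del: int_encode_inverse)
      finally show ?thesis by simp
    qed
    then show "\<exists>y\<in>S. agree n (point S) y" using y(1) by (auto simp: agree_def)
  qed
qed

lemma open_lex_occ: "open {x. lex_occ l x}"
proof -
  have eq: "{x. lex_occ l x} = (\<Inter>j\<in>{..<length l}. {x. occ [l ! j] x (int_decode j)})"
    by (auto simp: lex_occ_def occ_def)
  show ?thesis unfolding eq by (intro open_INT ballI open_occ) simp
qed

lemma lex_prefix_measurable [measurable]:
  "(\<lambda>S. lex_prefix S n) \<in> measurable subshift_space (count_space UNIV)"
proof (induction n)
  case (Suc n)
  have *: "Measurable.pred subshift_space (\<lambda>S. \<exists>x\<in>S. lex_occ l x)" for l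
    using hit_open_measurable[OF open_lex_occ[of l]] by (simp add: disjoint_iff Bex_def)
  note [measurable] = Suc *
  have "(\<lambda>S. (\<lambda>l S. l @ [\<exists>x\<in>S. lex_occ (l @ [True]) x]) (lex_prefix S n) S)
    \<in> measurable subshift_space (count_space UNIV)"
  proof (rule measurable_compose_countable[where g = "\<lambda>S. lex_prefix S n" and
          f = "\<lambda>l S. l @ [\<exists>x\<in>S. lex_occ (l @ [True]) x]"])
    fix l :: "bool list"
    show "(\<lambda>S. l @ [\<exists>x\<in>S. lex_occ (l @ [True]) x]) \<in> measurable subshift_space (count_space UNIV)"
      by (rule measurable_compose[OF *]) simp
  qed (rule Suc)
  then show ?case by simp
qed simp

lemma point_measurable [measurable]: "point \<in> measurable subshift_space config_space"
proof (rule measurable_to_config_space)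
  fix i
  show "Measurable.pred subshift_space (\<lambda>S. point S i)"
    unfolding point_def
    by (rule measurable_compose[OF lex_prefix_measurable]) simp
qed

text \<open>A Borel rank that orders the subshifts linearly. Base 3 with digits 0 and 1 avoids
  double expansions, so distinct languages get distinct reals.\<close>

definition tau :: "config set \<Rightarrow> real" where
  "tau S = (\<Sum>n. lang_ind S (from_nat n) * (1/3) ^ n)"

lemma summable_tau: "summable (\<lambda>n. lang_ind S (from_nat n) * (1/3) ^ n)"
  by (rule summable_comparison_test'[of "\<lambda>n. (1/3) ^ n" 0]) (auto simp: lang_ind_def)

lemma tau_nonneg: "0 \<le> tau S"
  unfolding tau_def by (rule suminf_nonneg[OF summable_tau]) (auto simp: lang_ind_def)

lemma tau_less_2: "tau S < 2"
proof -
  have "tau S \<le> (\<Sum>n. (1/3) ^ n)"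
    unfolding tau_def by (rule suminf_le[OF _ summable_tau]) (auto simp: lang_ind_def)
  also have "\<dots> = 3 / 2" by (simp add: suminf_geometric)
  finally show ?thesis by simp
qed

lemma tau_measurable [measurable]: "tau \<in> borel_measurable subshift_space"
  unfolding tau_def[abs_def] lang_ind_def by measurable

text \<open>After the first difference at n, the digits of a contribute at most (1/3)^(n+1) * 3/2,
  half of the (1/3)^n that b gains at n.\<close>

lemma base_three_less:
  fixes a b :: "nat \<Rightarrow> real"
  assumes ab: "\<And>n. a n = 0 \<or> a n = 1" "\<And>n. b n = 0 \<or> b n = 1"
    and eq: "\<And>i. i < n \<Longrightarrow> a i = b i" and n: "a n = 0" "b n = 1"
  shows "(\<Sum>i. a i * (1/3) ^ i) < (\<Sum>i. b i * (1/3) ^ i)"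
proof -
  have sm: "summable (\<lambda>n. c n * (1/3) ^ n)" if "\<And>n. c n = 0 \<or> c n = 1" for c :: "nat \<Rightarrow> real"
  proof (rule summable_comparison_test'[of "\<lambda>n. (1/3) ^ n" 0])
    show "norm (c n * (1/3) ^ n) \<le> (1/3) ^ n" for n using that[of n] by auto
  qed simp
  have le: "c n \<le> 1" "0 \<le> c n" if "\<And>n. c n = 0 \<or> c n = 1" for c :: "nat \<Rightarrow> real" and n
    using that[of n] by auto
  have split: "(\<Sum>i. c i * (1/3) ^ i) = (\<Sum>i. c (i + Suc n) * (1/3) ^ (i + Suc n)) + (c n * (1/3) ^ n + (\<Sum>i<n. c i * (1/3) ^ i))"
    if "\<And>n. c n = 0 \<or> c n = 1" for c :: "nat \<Rightarrow> real"
    using suminf_split_initial_segment[OF sm[of c, OF that], of "Suc n"] by simp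
  have "(\<Sum>i. a (i + Suc n) * (1/3) ^ (i + Suc n)) \<le> (\<Sum>i. (1/3) ^ Suc n * (1/3) ^ i)"
  proof (rule suminf_le)
    show "a (i + Suc n) * (1 / 3) ^ (i + Suc n) \<le> (1 / 3) ^ Suc n * (1 / 3) ^ i" for i
      using le(1)[of a "i + Suc n", OF ab(1)] by (simp add: power_add mult.commute mult.left_commute)
    show "summable (\<lambda>i. a (i + Suc n) * (1 / 3) ^ (i + Suc n))"
      using summable_ignore_initial_segment[OF sm[of a, OF ab(1)], of "Suc n"] .
    show "summable (\<lambda>i. (1/3::real) ^ Suc n * (1/3) ^ i)" by (intro summable_mult summable_geometric) simp
  qed
  also have "\<dots> = (1/3) ^ Suc n * (3/2)"
    by (subst suminf_mult) (auto simp: suminf_geometric intro!: summable_geometric)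
  also have "\<dots> < (1/3) ^ n" by simp
  finally have "(\<Sum>i. a i * (1/3) ^ i) < (1/3) ^ n + (\<Sum>i<n. a i * (1/3) ^ i)"
    using split[of a, OF ab(1)] n by simp
  also have "\<dots> = b n * (1/3) ^ n + (\<Sum>i<n. b i * (1/3) ^ i)" using n eq by simp
  also have "\<dots> \<le> (\<Sum>i. b i * (1/3) ^ i)"
    unfolding split[of b, OF ab(2)]
    using suminf_nonneg[OF summable_ignore_initial_segment[OF sm[of b, OF ab(2)], of "Suc n"]] le(2)[of b, OF ab(2)] by simp
  finally show ?thesis .
qed

lemma tau_inj:
  assumes "S \<in> subshifts" "T \<in> subshifts" "tau S = tau T"
  shows "S = T"
proof (rule ccontr)
  assume "S \<noteq> T"
  then have "lang S \<noteq> lang T" using lang_inj assms by blast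
  then obtain w where "(w \<in> lang S) \<noteq> (w \<in> lang T)" by blast
  then have w: "lang_ind S w \<noteq> lang_ind T w" by (auto simp: lang_ind_def)
  let ?P = "\<lambda>n. lang_ind S (from_nat n) \<noteq> lang_ind T (from_nat n)"
  define n where "n = (LEAST n. ?P n)"
  have "?P (to_nat w)" using w by simp
  then have n: "?P n" unfolding n_def by (rule LeastI)
  have lt: "lang_ind S (from_nat i) = lang_ind T (from_nat i)" if "i < n" for i
    using not_less_Least[of i ?P] that unfolding n_def by blast
  have 01: "lang_ind U v = 0 \<or> lang_ind U v = 1" for U v by (auto simp: lang_ind_def)
  consider "lang_ind S (from_nat n) = 0" "lang_ind T (from_nat n) = 1"
    | "lang_ind T (from_nat n) = 0" "lang_ind S (from_nat n) = 1" using n 01 by metis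
  then show False
  proof cases
    case 1
    then have "tau S < tau T" unfolding tau_def using 01 lt by (intro base_three_less[of _ _ n]) auto
    then show False using assms(3) by simp
  next
    case 2
    then have "tau T < tau S" unfolding tau_def using 01 lt by (intro base_three_less[of _ _ n]) auto
    then show False using assms(3) by simp
  qed
qed

section \<open>Block maps and the canonical value of a point\<close>

definition blk :: "int \<Rightarrow> config \<Rightarrow> int \<Rightarrow> int set" where
  "blk p x k = {i \<in> {0..<p}. x (k * p + i)}"

definition bmap :: "int \<Rightarrow> (int set \<Rightarrow> int set) \<Rightarrow> config \<Rightarrow> config" where
  "bmap p \<phi> x = (\<lambda>j. j mod p \<in> \<phi> (blk p x (j div p)))"

text \<open>Extensional maps, so that there are only finitely many; composites are restricted in
  order to stay in this set.\<close>

definition blockmaps :: "int \<Rightarrow> (int set \<Rightarrow> int set) set" where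
  "blockmaps p = Pow {0..<p} \<rightarrow>\<^sub>E Pow {0..<p}"

lemma finite_blockmaps: "finite (blockmaps p)"
  unfolding blockmaps_def by (intro finite_PiE) auto

lemma blk_in_Pow [simp]: "blk p x k \<in> Pow {0..<p}"
  by (auto simp: blk_def)

lemma blockmaps_Pow: "\<phi> \<in> blockmaps p \<Longrightarrow> \<phi> (blk p x k) \<subseteq> {0..<p}"
proof -
  assume "\<phi> \<in> blockmaps p"
  then have "\<phi> (blk p x k) \<in> Pow {0..<p}"
    unfolding blockmaps_def by (rule PiE_mem) (rule blk_in_Pow)
  then show ?thesis by (rule PowD)
qed

lemma blk_bmap:
  assumes "\<phi> \<in> blockmaps p"
  shows "blk p (bmap p \<phi> x) k = \<phi> (blk p x k)"
proof (rule set_eqI)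
  fix i
  have "(k * p + i) mod p = i" "(k * p + i) div p = k" if "0 \<le> i" "i < p"
    using that by auto
  then show "i \<in> blk p (bmap p \<phi> x) k \<longleftrightarrow> i \<in> \<phi> (blk p x k)"
    using blockmaps_Pow[OF assms, of x k]
    unfolding blk_def[of p "bmap p \<phi> x"] unfolding bmap_def by auto
qed

lemma bmap_comp:
  assumes "\<phi> \<in> blockmaps p" "\<psi> \<in> blockmaps p"
  shows "bmap p \<phi> (bmap p \<psi> x) = bmap p (restrict (\<phi> \<circ> \<psi>) (Pow {0..<p})) x"
  unfolding bmap_def[of p \<phi>] bmap_def[of p "restrict (\<phi> \<circ> \<psi>) (Pow {0..<p})"] blk_bmap[OF assms(2)]
  by (simp only: restrict_apply blk_in_Pow if_True comp_apply)

lemma restrict_comp_blockmaps: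
  "\<phi> \<in> blockmaps p \<Longrightarrow> \<psi> \<in> blockmaps p \<Longrightarrow> restrict (\<phi> \<circ> \<psi>) (Pow {0..<p}) \<in> blockmaps p"
  unfolding blockmaps_def by (auto intro!: restrict_PiE simp: PiE_def Pi_def)

lemma bmap_id: "p \<ge> 1 \<Longrightarrow> bmap p (restrict (\<lambda>B. B) (Pow {0..<p})) x = x"
  unfolding bmap_def by (simp only: restrict_apply blk_in_Pow if_True) (auto simp: blk_def)

lemma restrict_id_blockmaps: "restrict (\<lambda>B. B) (Pow {0..<p}) \<in> blockmaps p"
  by (auto simp: blockmaps_def)

lemma bmap_shift:
  assumes "p \<ge> 1"
  shows "bmap p \<phi> (shift (k * p) x) = shift (k * p) (bmap p \<phi> x)"
proof
  fix j
  have "blk p (shift (k * p) x) m = blk p x (m - k)" for m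
    by (auto simp: blk_def shift_apply algebra_simps)
  moreover have "(j - k * p) mod p = j mod p"
    using mod_mult_self1[of j "- k" p] by simp
  moreover have "(j - k * p) div p = j div p - k"
    using div_mult_self1[of p j "- k"] assms by simp
  ultimately show "bmap p \<phi> (shift (k * p) x) j = shift (k * p) (bmap p \<phi> x) j"
    by (simp add: bmap_def shift_apply)
qed

lemma bmap_agree:
  assumes p: "p \<ge> 1" and a: "agree (n + nat p) x y"
  shows "agree n (bmap p \<phi> x) (bmap p \<phi> y)"
  unfolding agree_def
proof (intro allI impI)
  fix j assume j: "\<bar>j\<bar> \<le> int n"
  have "x (j div p * p + i) = y (j div p * p + i)" if "0 \<le> i" "i < p" for i
  proof -
    have "j div p * p = j - j mod p" by (simp add: minus_mod_eq_div_mult)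
    moreover have "0 \<le> j mod p" "j mod p < p" using p by auto
    ultimately have "\<bar>j div p * p + i\<bar> \<le> int (n + nat p)" using that j p by linarith
    then show ?thesis using a by (simp only: agree_def)
  qed
  then have "blk p x (j div p) = blk p y (j div p)" by (auto simp: blk_def)
  then show "bmap p \<phi> x j = bmap p \<phi> y j" by (simp add: bmap_def)
qed

lemma bmap_measurable [measurable]: "bmap p \<phi> \<in> measurable config_space config_space"
proof (rule measurable_to_config_space)
  fix j
  let ?k = "j div p"
  have "bmap p \<phi> x j \<longleftrightarrow> (\<exists>B\<in>{B \<in> Pow {0..<p}. j mod p \<in> \<phi> B}. \<forall>i\<in>{0..<p}. x (?k * p + i) \<longleftrightarrow> i \<in> B)" for x
  proof
    assume "bmap p \<phi> x j"
    then show "\<exists>B\<in>{B \<in> Pow {0..<p}. j mod p \<in> \<phi> B}. \<forall>i\<in>{0..<p}. x (?k * p + i) \<longleftrightarrow> i \<in> B"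
      by (intro bexI[of _ "blk p x ?k"]) (auto simp: bmap_def blk_def)
  next
    assume "\<exists>B\<in>{B \<in> Pow {0..<p}. j mod p \<in> \<phi> B}. \<forall>i\<in>{0..<p}. x (?k * p + i) \<longleftrightarrow> i \<in> B"
    then obtain B where B: "B \<subseteq> {0..<p}" "j mod p \<in> \<phi> B" "\<forall>i\<in>{0..<p}. x (?k * p + i) \<longleftrightarrow> i \<in> B" by auto
    then have "blk p x ?k = B" by (auto simp: blk_def)
    then show "bmap p \<phi> x j" using B by (simp add: bmap_def)
  qed
  moreover have "Measurable.pred config_space (\<lambda>x. \<exists>B\<in>{B \<in> Pow {0..<p}. j mod p \<in> \<phi> B}. \<forall>i\<in>{0..<p}. x (?k * p + i) \<longleftrightarrow> i \<in> B)"
    by (intro pred_intros_finite) (auto intro!: pred_intros_finite)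
  ultimately show "Measurable.pred config_space (\<lambda>x. bmap p \<phi> x j)" by simp
qed

lemma bmap_pcl:
  assumes "p \<ge> 1" "y \<in> pcl p x"
  shows "bmap p \<phi> y \<in> pcl p (bmap p \<phi> x)"
  unfolding pcl_def
proof (intro CollectI allI)
  fix n
  obtain k where "agree (n + nat p) y (shift (k * p) x)" using assms(2) by (auto simp: pcl_def)
  from bmap_agree[OF assms(1) this] show "\<exists>k. agree n (bmap p \<phi> y) (shift (k * p) (bmap p \<phi> x))"
    unfolding bmap_shift[OF assms(1)] by blast
qed

lemma pcl_shift_both:
  assumes "y \<in> pcl p x"
  shows "shift i y \<in> pcl p (shift i x)"
  unfolding pcl_def
proof (intro CollectI allI)
  fix n
  obtain k where "agree (n + nat \<bar>i\<bar>) y (shift (k * p) x)" using assms by (auto simp: pcl_def)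
  from shift_agree[OF this] have "agree n (shift i y) (shift (k * p) (shift i x))"
    by (simp add: add.commute)
  then show "\<exists>k. agree n (shift i y) (shift (k * p) (shift i x))" ..
qed

lemma shift_in_pcl: "shift (k * p) x \<in> pcl p x"
  unfolding pcl_def using agree_refl by blast

lemma in_pcl_shift: "x \<in> pcl p (shift (k * p) x)"
  using shift_in_pcl[of "- k" p "shift (k * p) x"] by simp

lemma ocl_eq_if_pcl:
  assumes "y \<in> pcl p x" "x \<in> pcl p y"
  shows "ocl x = ocl y"
  using assms ocl_subset[OF ocl_subshift] pcl_subset_ocl by blast

text \<open>A window of x0 has a period q divisible by p. Modulo q, a shift by k * p is undone by
  the residue s = k * p mod q, which is a multiple of p and below q; a margin of q in the
  approximation of x therefore suffices to approximate x0 by shifts of x.\<close>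

lemma pcl_sym_toeplitz:
  assumes x0: "toeplitz_word x0" and p: "p \<ge> 1" and x: "x \<in> pcl p x0"
  shows "x0 \<in> pcl p x"
  unfolding pcl_def
proof (intro CollectI allI)
  fix n
  obtain q where q: "q \<ge> 1" "p dvd q" "\<And>i. \<bar>i\<bar> \<le> int n \<Longrightarrow> cst q x0 i"
    using toeplitz_window[OF x0 p, of n] by blast
  obtain k where k: "agree (n + nat q) x (shift (k * p) x0)" using x by (auto simp: pcl_def)
  define s where "s = k * p mod q"
  have s: "0 \<le> s" "s < q" using q(1) by (auto simp: s_def)
  have "p dvd s" using q(2) by (simp add: s_def dvd_mod)
  then obtain l where l: "s = p * l" by blast
  have "agree n x0 (shift (- l * p) x)" unfolding agree_def
  proof (intro allI impI)
    fix i assume i: "\<bar>i\<bar> \<le> int n"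
    have e: "- l * p = - s" using l by simp
    have "shift (- l * p) x i = x (i + s)" unfolding e by (simp add: shift_apply)
    also have "\<dots> = shift (k * p) x0 (i + s)"
      using k i s unfolding agree_def by auto
    also have "\<dots> = x0 (i + s - k * p)" by (simp add: shift_apply)
    also have "\<dots> = x0 i"
    proof (rule cst_cong_val[OF q(3)[OF i]])
      have "i + s - k * p - i = - (k * p - k * p mod q)" by (simp add: s_def)
      then show "q dvd i + s - k * p - i" by (metis dvd_minus_iff dvd_minus_mod)
    qed
    finally show "x0 i = shift (- l * p) x i" by simp
  qed
  then show "\<exists>k. agree n x0 (shift (k * p) x)" by blast
qed

lemma toeplitz_word_shift: "toeplitz_word x \<Longrightarrow> toeplitz_word (shift s x)"
  unfolding toeplitz_word_iff cst_shift by blast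

lemma pcl_toeplitz_point:
  assumes "toeplitz_word x0" "x \<in> ocl x0" "p \<ge> 1"
  shows "\<exists>s\<in>{0..<p}. x \<in> pcl p (shift s x0) \<and> shift s x0 \<in> pcl p x"
  using ocl_split[OF assms(2,3)] pcl_sym_toeplitz[OF toeplitz_word_shift[OF assms(1)] assms(3)] by blast

text \<open>Invertibility is asked only at u. Conjugacy of the orbit closures is a separate demand,
  since block maps in general commute only with shifts by multiples of p.\<close>

definition valid :: "int \<Rightarrow> config \<Rightarrow> (int set \<Rightarrow> int set) \<Rightarrow> bool" where
  "valid p u \<phi> \<longleftrightarrow> (\<exists>\<psi>\<in>blockmaps p. bmap p \<psi> (bmap p \<phi> u) = u) \<and> (ocl u, ocl (bmap p \<phi> u)) \<in> conjugacy_sep"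

text \<open>A finite part of the conjugacy class of \<open>ocl u\<close>, shared by all points that
  valid block maps produce from u.\<close>

definition rset :: "int \<Rightarrow> config \<Rightarrow> config set set" where
  "rset p u = (\<lambda>\<phi>. ocl (bmap p \<phi> u)) ` {\<phi> \<in> blockmaps p. valid p u \<phi>}"

text \<open>The value 2 exceeds all values of \<open>tau\<close> and is taken only outside the separated Toeplitz
  subshifts.\<close>

definition rval :: "int \<Rightarrow> config \<Rightarrow> real" where
  "rval p u = Min (insert 2 (tau ` rset p u))"

lemma finite_rset: "finite (rset p u)"
  unfolding rset_def using finite_blockmaps by simp

lemma rset_subset: "rset p u \<subseteq> conjugacy_sep `` {ocl u}"
  by (auto simp: rset_def valid_def)

lemma rval_measurable [measurable]: "rval p \<in> borel_measurable config_space"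
proof -
  note [measurable] = conjugacy_sep_measurable
  have "Measurable.pred config_space (\<lambda>u. bmap p \<psi> (bmap p \<phi> u) = u)" for \<phi> \<psi>
  proof -
    have *: "Measurable.pred config_space (\<lambda>u. bmap p \<psi> (bmap p \<phi> u) i)" for i
      by measurable
    have "Measurable.pred config_space (\<lambda>u. \<forall>i. bmap p \<psi> (bmap p \<phi> u) i = u i)"
      using * by measurable
    then show ?thesis by (simp add: fun_eq_iff)
  qed
  then have "Measurable.pred config_space (\<lambda>u. \<exists>\<psi>\<in>blockmaps p. bmap p \<psi> (bmap p \<phi> u) = u)" for \<phi>
    using finite_blockmaps by (intro pred_intros_finite)
  note [measurable] = this
  have "Measurable.pred config_space (\<lambda>u. valid p u \<phi>)" for \<phi>
    unfolding valid_def by measurable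
  note [measurable] = this
  show ?thesis
  proof (rule borel_measurable_iff_le[THEN iffD2], rule allI)
    fix a
    have "Measurable.pred config_space (\<lambda>u. \<exists>\<phi>\<in>blockmaps p. valid p u \<phi> \<and> tau (ocl (bmap p \<phi> u)) \<le> a)"
      using finite_blockmaps by (intro pred_intros_finite) measurable
    moreover have "rval p u \<le> a \<longleftrightarrow> 2 \<le> a \<or> (\<exists>\<phi>\<in>blockmaps p. valid p u \<phi> \<and> tau (ocl (bmap p \<phi> u)) \<le> a)" for u
      unfolding rval_def by (subst Min_le_iff) (auto simp: finite_rset, auto simp: rset_def)
    ultimately show "{u \<in> space config_space. rval p u \<le> a} \<in> sets config_space" by simp
  qed
qed

lemma rset_self:
  assumes "p \<ge> 1" "ocl u \<in> toeplitz_sep"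
  shows "ocl u \<in> rset p u"
proof -
  let ?i = "restrict (\<lambda>B. B) (Pow {0..<p})"
  have "valid p u ?i"
    unfolding valid_def bmap_id[OF assms(1)] using restrict_id_blockmaps[of p] assms(2)
    by (auto simp: conjugacy_sep_def top_conjugate_refl intro!: bexI[of _ ?i] bmap_id[OF assms(1)])
  then show ?thesis unfolding rset_def
    using restrict_id_blockmaps[of p] bmap_id[OF assms(1)] by (metis (mono_tags, lifting) imageI mem_Collect_eq)
qed

lemma rval_in:
  assumes "p \<ge> 1" "ocl u \<in> toeplitz_sep"
  shows "\<exists>T\<in>rset p u. rval p u = tau T"
proof -
  have "rval p u \<le> tau (ocl u)"
    unfolding rval_def using rset_self[OF assms] by (intro Min_le) (auto simp: finite_rset)
  then have "rval p u \<noteq> 2" using tau_less_2[of "ocl u"] by auto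
  moreover have "rval p u \<in> insert 2 (tau ` rset p u)"
    unfolding rval_def by (intro Min_in) (auto simp: finite_rset)
  ultimately show ?thesis by auto
qed

text \<open>Valid block maps compose. Used for a valid map and for its inverse, the inclusion
  becomes the equality behind \<open>rval_bmap\<close>.\<close>

lemma rset_valid_subset:
  assumes \<phi>: "\<phi> \<in> blockmaps p" "valid p u \<phi>"
  shows "rset p (bmap p \<phi> u) \<subseteq> rset p u"
proof
  let ?v = "bmap p \<phi> u"
  fix T assume "T \<in> rset p ?v"
  then obtain \<theta> where \<theta>: "\<theta> \<in> blockmaps p" "valid p ?v \<theta>" "T = ocl (bmap p \<theta> ?v)" by (auto simp: rset_def)
  obtain \<psi> where \<psi>: "\<psi> \<in> blockmaps p" "bmap p \<psi> ?v = u" using \<phi>(2) by (auto simp: valid_def)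
  obtain \<theta>' where \<theta>': "\<theta>' \<in> blockmaps p" "bmap p \<theta>' (bmap p \<theta> ?v) = ?v" using \<theta>(2) by (auto simp: valid_def)
  let ?c = "restrict (\<theta> \<circ> \<phi>) (Pow {0..<p})" and ?d = "restrict (\<psi> \<circ> \<theta>') (Pow {0..<p})"
  have c: "?c \<in> blockmaps p" "bmap p ?c u = bmap p \<theta> ?v"
    using restrict_comp_blockmaps[OF \<theta>(1) \<phi>(1)] bmap_comp[OF \<theta>(1) \<phi>(1)] by auto
  have "bmap p ?d (bmap p ?c u) = u" "?d \<in> blockmaps p"
    using restrict_comp_blockmaps[OF \<psi>(1) \<theta>'(1)] bmap_comp[OF \<psi>(1) \<theta>'(1), of "bmap p ?c u", symmetric] \<theta>'(2) \<psi>(2) c(2) by auto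
  moreover have "(ocl u, ocl (bmap p ?c u)) \<in> conjugacy_sep"
    using \<phi>(2) \<theta>(2) equiv_conjugacy_sep unfolding valid_def c(2) equiv_def by (meson transD)
  ultimately have "valid p u ?c" unfolding valid_def by blast
  then show "T \<in> rset p u" unfolding rset_def using c \<theta>(3)
    by (intro image_eqI[of _ _ ?c]) auto
qed

lemma rval_bmap:
  assumes \<phi>: "\<phi> \<in> blockmaps p" and \<psi>: "\<psi> \<in> blockmaps p" "bmap p \<psi> (bmap p \<phi> u) = u"
    and E: "(ocl u, ocl (bmap p \<phi> u)) \<in> conjugacy_sep"
  shows "rval p (bmap p \<phi> u) = rval p u"
proof -
  have 1: "valid p u \<phi>" unfolding valid_def using assms by blast
  have "(ocl (bmap p \<phi> u), ocl u) \<in> conjugacy_sep"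
    using E equiv_conjugacy_sep by (auto simp: equiv_def dest: symD)
  then have 2: "valid p (bmap p \<phi> u) \<psi>" unfolding valid_def \<psi>(2) using \<phi> by blast
  have "rset p (bmap p \<phi> u) = rset p u"
    using rset_valid_subset[OF \<phi> 1] rset_valid_subset[OF \<psi>(1) 2] \<psi>(2) by auto
  then show ?thesis by (simp add: rval_def)
qed

text \<open>Block maps have finite range and commute with shifts by multiples of p, so an inversion
  identity at u passes to its p-orbit closure, and images of mutually approximable points have the
  same orbit closure.\<close>

lemma rset_pcl_subset:
  assumes p: "p \<ge> 1" and uv: "v \<in> pcl p u" "u \<in> pcl p v"
  shows "rset p u \<subseteq> rset p v"
proof
  fix T assume "T \<in> rset p u"
  then obtain \<phi> where \<phi>: "\<phi> \<in> blockmaps p" "valid p u \<phi>" "T = ocl (bmap p \<phi> u)" by (auto simp: rset_def)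
  obtain \<psi> where \<psi>: "\<psi> \<in> blockmaps p" "bmap p \<psi> (bmap p \<phi> u) = u" using \<phi>(2) by (auto simp: valid_def)
  have "bmap p \<psi> (bmap p \<phi> v) j = v j" for j
  proof -
    let ?n = "nat \<bar>j\<bar>"
    \<comment> \<open>Each of the two block maps consumes a margin of p.\<close>
    obtain k where k: "agree (?n + nat p + nat p) v (shift (k * p) u)" using uv(1) by (auto simp: pcl_def)
    have "agree ?n (bmap p \<psi> (bmap p \<phi> v)) (bmap p \<psi> (bmap p \<phi> (shift (k * p) u)))"
      using bmap_agree[OF p bmap_agree[OF p k]] .
    also have "bmap p \<psi> (bmap p \<phi> (shift (k * p) u)) = shift (k * p) u"
      using \<psi>(2) by (simp add: bmap_shift[OF p])
    finally have "bmap p \<psi> (bmap p \<phi> v) j = shift (k * p) u j" by (simp add: agree_def)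
    also have "\<dots> = v j" using k by (simp add: agree_def)
    finally show ?thesis .
  qed
  then have "bmap p \<psi> (bmap p \<phi> v) = v" by auto
  moreover have "ocl (bmap p \<phi> v) = ocl (bmap p \<phi> u)"
    using ocl_eq_if_pcl[OF bmap_pcl[OF p uv(2)] bmap_pcl[OF p uv(1)]] .
  moreover have "ocl v = ocl u" using ocl_eq_if_pcl[OF uv(2,1)] .
  ultimately have "valid p v \<phi>" "T = ocl (bmap p \<phi> v)"
    using \<phi> \<psi> by (auto simp: valid_def)
  then show "T \<in> rset p v" using \<phi>(1) by (auto simp: rset_def)
qed

lemma rval_pcl:
  assumes "p \<ge> 1" "v \<in> pcl p u" "u \<in> pcl p v"
  shows "rval p u = rval p v"
proof -
  have "rset p u = rset p v" using rset_pcl_subset[OF assms(1)] assms(2,3) by blast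
  then show ?thesis by (simp add: rval_def)
qed

lemma rval_shift_mult: "p \<ge> 1 \<Longrightarrow> rval p (shift (i + k * p) x) = rval p (shift i x)"
  using rval_pcl[OF _ in_pcl_shift[of "shift i x" p k] shift_in_pcl[of k p "shift i x"]]
  by (simp add: add.commute)

text \<open>Every point of S approximates, and is approximated by, some shift of x0 under multiples
  of p. The value sequences of all points are thus translates of one sequence.\<close>

lemma rval_vector_shift:
  assumes S: "S \<in> toeplitz_sep" and p: "p \<ge> 1" and x: "x0 \<in> S" "toeplitz_word x0" "x \<in> S"
  shows "\<exists>s. \<forall>i. rval p (shift i x) = rval p (shift (i + s) x0)"
proof -
  have "x \<in> ocl x0" using toeplitz_sepD(3)[OF S x(1)] x(3) by simp
  then obtain s where s: "x \<in> pcl p (shift s x0)" "shift s x0 \<in> pcl p x"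
    using pcl_toeplitz_point[OF x(2) _ p] by blast
  have "rval p (shift i x) = rval p (shift (i + s) x0)" for i
    using rval_pcl[OF p pcl_shift_both[OF s(2), of i] pcl_shift_both[OF s(1), of i]] by simp
  then show ?thesis by blast
qed

lemma card_periodic_shift:
  fixes p :: int
  assumes p: "p \<ge> 1" and per: "\<And>i k. P (i + k * p) = P i"
  shows "card {i \<in> {0..<p}. P (i + s)} = card {i \<in> {0..<p}. P i}"
proof -
  have m: "P (i mod p) = P i" for i
    using per[of "i mod p" "i div p"] by simp
  have "bij_betw (\<lambda>i. (i + s) mod p) {i \<in> {0..<p}. P (i + s)} {i \<in> {0..<p}. P i}"
  proof (rule bij_betw_byWitness[where f' = "\<lambda>i. (i - s) mod p"])
    show "\<forall>a\<in>{i \<in> {0..<p}. P (i + s)}. ((a + s) mod p - s) mod p = a" by (auto simp: mod_simps)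
    show "\<forall>a\<in>{i \<in> {0..<p}. P i}. ((a - s) mod p + s) mod p = a" by (auto simp: mod_simps)
    show "(\<lambda>i. (i + s) mod p) ` {i \<in> {0..<p}. P (i + s)} \<subseteq> {i \<in> {0..<p}. P i}" using p m by auto
    have "P ((i - s) mod p + s) = P i" for i
      using m[of "(i - s) mod p + s"] m[of i] by (simp add: mod_simps)
    then show "(\<lambda>i. (i - s) mod p) ` {i \<in> {0..<p}. P i} \<subseteq> {i \<in> {0..<p}. P (i + s)}"
      using p by auto
  qed
  then show ?thesis by (rule bij_betw_same_card)
qed

text \<open>Translating a p-periodic sequence preserves counts over one period. This makes the
  distribution of values an invariant of S.\<close>

lemma card_rval_eq:
  assumes S: "S \<in> toeplitz_sep" and p: "p \<ge> 1" and xy: "x \<in> S" "y \<in> S"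
  shows "card {i \<in> {0..<p}. Q (rval p (shift i x))} = card {i \<in> {0..<p}. Q (rval p (shift i y))}"
proof -
  obtain x0 where x0: "x0 \<in> S" "toeplitz_word x0" using toeplitz_sepD(4)[OF S] by blast
  have "card {i \<in> {0..<p}. Q (rval p (shift i z))} = card {i \<in> {0..<p}. Q (rval p (shift i x0))}" if z: "z \<in> S" for z
  proof -
    obtain s where s: "\<And>i. rval p (shift i z) = rval p (shift (i + s) x0)"
      using rval_vector_shift[OF S p x0 z] by blast
    show ?thesis unfolding s
      by (rule card_periodic_shift[OF p, of "\<lambda>i. Q (rval p (shift i x0))"]) (simp add: rval_shift_mult[OF p])
  qed
  then show ?thesis using xy by simp
qed

text \<open>The block map that produced the value can be inverted: S is recovered from the subshift
  T with \<open>tau T = t\<close> by one of finitely many block maps, applied at one of the p phases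
  of a fixed Toeplitz point of T.\<close>

lemma finite_rval_fiber:
  assumes p: "p \<ge> 1"
  shows "finite {S \<in> toeplitz_sep. \<exists>x\<in>S. rval p x = t}"
proof (cases "\<exists>T\<in>toeplitz_sep. tau T = t")
  case False
  have "{S \<in> toeplitz_sep. \<exists>x\<in>S. rval p x = t} = {}"
  proof (rule ccontr)
    assume "{S \<in> toeplitz_sep. \<exists>x\<in>S. rval p x = t} \<noteq> {}"
    then obtain S x where S: "S \<in> toeplitz_sep" "x \<in> S" "rval p x = t" by blast
    then have "ocl x \<in> toeplitz_sep" using toeplitz_sepD(3) by simp
    from rval_in[OF p this] obtain T where "T \<in> rset p x" "t = tau T" using S by auto
    then show False using False rset_subset[of p x] by (auto simp: conjugacy_sep_def)
  qed
  then show ?thesis by (simp only: finite.emptyI)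
next
  case True
  then obtain T where T: "T \<in> toeplitz_sep" "tau T = t" by blast
  obtain x0 where x0: "x0 \<in> T" "toeplitz_word x0" using toeplitz_sepD(4)[OF T(1)] by blast
  have "{S \<in> toeplitz_sep. \<exists>x\<in>S. rval p x = t} \<subseteq> (\<lambda>(\<psi>, s). ocl (bmap p \<psi> (shift s x0))) ` (blockmaps p \<times> {0..<p})"
  proof
    fix S assume "S \<in> {S \<in> toeplitz_sep. \<exists>x\<in>S. rval p x = t}"
    then obtain u where S: "S \<in> toeplitz_sep" "u \<in> S" "rval p u = t" by blast
    then have u: "ocl u = S" using toeplitz_sepD(3) by simp
    then obtain T' where T': "T' \<in> rset p u" "t = tau T'" using rval_in[OF p, of u] S by auto
    have "T' \<in> toeplitz_sep" using T'(1) rset_subset[of p u] by (auto simp: conjugacy_sep_def)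
    then have "T' = T" using tau_inj toeplitz_sepD(1) T T'(2) by metis
    then obtain \<phi> where \<phi>: "\<phi> \<in> blockmaps p" "valid p u \<phi>" "T = ocl (bmap p \<phi> u)" using T'(1) by (auto simp: rset_def)
    obtain \<psi> where \<psi>: "\<psi> \<in> blockmaps p" "bmap p \<psi> (bmap p \<phi> u) = u" using \<phi>(2) by (auto simp: valid_def)
    have "bmap p \<phi> u \<in> ocl x0" using \<phi>(3) toeplitz_sepD(3)[OF T(1) x0(1)] by simp
    then obtain s where s: "s \<in> {0..<p}" "bmap p \<phi> u \<in> pcl p (shift s x0)" "shift s x0 \<in> pcl p (bmap p \<phi> u)"
      using pcl_toeplitz_point[OF x0(2) _ p] by blast
    have "S = ocl (bmap p \<psi> (bmap p \<phi> u))" using u \<psi>(2) by simp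
    also have "\<dots> = ocl (bmap p \<psi> (shift s x0))"
      by (rule ocl_eq_if_pcl[OF bmap_pcl[OF p s(3)] bmap_pcl[OF p s(2)]])
    finally show "S \<in> (\<lambda>(\<psi>, s). ocl (bmap p \<psi> (shift s x0))) ` (blockmaps p \<times> {0..<p})"
      using \<psi>(1) s(1) by auto
  qed
  then show ?thesis by (rule finite_subset) (use finite_blockmaps in auto)
qed

section \<open>Conjugacies away from the holes\<close>

text \<open>At a position of a block the code reads the block itself and coordinates within its
  radius of the block ends. There x is p-periodic, so what is read outside the block does not depend
  on which block it is.\<close>

lemma code_is_bmap:
  assumes p: "p \<ge> 1" and c: "\<And>k. \<bar>k\<bar> \<le> int (fst c) \<Longrightarrow> cst p x k"
  shows "\<exists>\<phi>\<in>blockmaps p. code c x = bmap p \<phi> x"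
proof -
  let ?y = "code c x"
  have same: "blk p ?y k = blk p ?y k'" if b: "blk p x k = blk p x k'" for k k'
  proof -
    have "?y (k * p + i) = ?y (k' * p + i)" if i: "0 \<le> i" "i < p" for i
    proof (rule code_eq_at)
      fix d assume d: "\<bar>d\<bar> \<le> int (fst c)"
      consider "i + d < 0" | "0 \<le> i + d" "i + d < p" | "p \<le> i + d" by linarith
      then show "x (k * p + i + d) = x (k' * p + i + d)"
      proof cases
        case 1
        then have "cst p x (i + d)" using i d by (intro c) linarith
        then have "x ((i + d) + k * p) = x ((i + d) + k' * p)" by (simp add: cst_def)
        then show ?thesis by (simp add: algebra_simps)
      next
        case 2
        then have "i + d \<in> blk p x k \<longleftrightarrow> i + d \<in> blk p x k'" using b by simp
        then show ?thesis using 2 by (simp add: blk_def add.assoc)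
      next
        case 3
        \<comment> \<open>Beyond the right end the position is reduced by p, which puts it near 0,
          and the block index grows by one.\<close>
        then have "cst p x (i + d - p)" using i d by (intro c) linarith
        then have "x ((i + d - p) + (k + 1) * p) = x ((i + d - p) + (k' + 1) * p)" by (simp only: cst_def)
        then show ?thesis by (simp add: algebra_simps)
      qed
    qed
    then show ?thesis by (auto simp: blk_def)
  qed
  \<comment> \<open>Sets that do not occur as blocks of x get the arbitrary value {}.\<close>
  define \<phi> where "\<phi> = restrict (\<lambda>B. if \<exists>k. blk p x k = B then blk p ?y (SOME k. blk p x k = B) else {}) (Pow {0..<p})"
  have "\<phi> \<in> blockmaps p"
    unfolding blockmaps_def \<phi>_def
    by (rule restrict_PiE_iff[THEN iffD2]) (simp del: Pow_iff add: Pow_bottom)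
  moreover have "\<phi> (blk p x k) = blk p ?y k" for k
  proof -
    have "blk p x (SOME k'. blk p x k' = blk p x k) = blk p x k" by (rule someI) simp
    then have "blk p ?y (SOME k'. blk p x k' = blk p x k) = blk p ?y k" by (rule same)
    then show ?thesis unfolding \<phi>_def by (auto simp del: Pow_iff)
  qed
  then have "?y = bmap p \<phi> x"
    using p by (auto simp: bmap_def blk_def)
  ultimately show ?thesis by blast
qed

text \<open>Both the code and its inverse have to act blockwise. For the inverse, the image must be
  p-periodic within the radius of d, and the code c looks \<open>fst c\<close> further out; hence
  the sum of the radii.\<close>

lemma rval_code:
  assumes ST: "S \<in> toeplitz_sep" "T \<in> toeplitz_sep" "code_conj c d S T" and x: "x \<in> S" and p: "p \<ge> 1"
    and h: "\<And>k. \<bar>k\<bar> \<le> int (fst c + fst d) \<Longrightarrow> cst p x k"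
  shows "rval p (code c x) = rval p x"
proof -
  let ?y = "code c x"
  have y: "?y \<in> T" "code d ?y = x" using ST(3) x by (auto simp: code_conj_def)
  obtain \<phi> where \<phi>: "\<phi> \<in> blockmaps p" "?y = bmap p \<phi> x"
    using code_is_bmap[OF p, of c x] h by auto
  have "cst p ?y k" if k: "\<bar>k\<bar> \<le> int (fst d)" for k
    unfolding cst_def
  proof (intro allI code_eq_at)
    fix l e assume e: "\<bar>e\<bar> \<le> int (fst c)"
    have "cst p x (k + e)" using k e by (intro h) simp
    then have "x ((k + e) + l * p) = x (k + e)" by (simp only: cst_def)
    then show "x (k + l * p + e) = x (k + e)" by (simp add: algebra_simps)
  qed
  then obtain \<psi> where \<psi>: "\<psi> \<in> blockmaps p" "code d ?y = bmap p \<psi> ?y"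
    using code_is_bmap[OF p, of d ?y] by auto
  have "(ocl x, ocl ?y) \<in> conjugacy_sep"
    unfolding toeplitz_sepD(3)[OF ST(1) x] toeplitz_sepD(3)[OF ST(2) y(1)] conjugacy_sep_iff
    using ST by blast
  then show ?thesis
    using rval_bmap[OF \<phi>(1) \<psi>(1)] \<phi>(2) \<psi>(2) y(2) by auto
qed

text \<open>Two holes at distance below N would be congruent modulo p, which N \<le> p excludes for
  distinct indices. So i div N is injective on the holes, and it takes at most p div N + 1
  values.\<close>

lemma card_holes_le:
  assumes x: "x \<in> gapset p N" and N: "1 \<le> N" "int N \<le> p"
  shows "real (card {i \<in> {0..<p}. \<not> cst p x (k - i)}) \<le> p / N + 1"
proof -
  let ?H = "{i \<in> {0..<p}. \<not> cst p x (k - i)}"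
  have "inj_on (\<lambda>i. i div int N) ?H"
  proof (rule inj_onI, rule ccontr)
    fix i j assume ij: "i \<in> ?H" "j \<in> ?H" "i div int N = j div int N" "i \<noteq> j"
    have "i - j = i mod int N - j mod int N"
      using ij(3) by (metis add_diff_cancel_left mult_div_mod_eq)
    moreover have "0 \<le> i mod int N" "i mod int N < int N" "0 \<le> j mod int N" "j mod int N < int N" using N by auto
    ultimately have lt: "\<bar>i - j\<bar> < int N" by linarith
    have "\<not> p dvd (k - i) - (k - j)"
    proof
      assume "p dvd (k - i) - (k - j)"
      then have "p \<le> \<bar>(k - i) - (k - j)\<bar>" using ij(4) by (intro zdvd_imp_le) auto
      then show False using lt N by simp
    qed
    moreover have "\<bar>(k - i) - (k - j)\<bar> < int N" using lt by simp
    ultimately have "cst p x (k - i) \<or> cst p x (k - j)" using x unfolding gapset_def by blast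
    then show False using ij by auto
  qed
  moreover have "(\<lambda>i. i div int N) ` ?H \<subseteq> {0..p div int N}"
    using N zdiv_mono1[of _ p "int N"] by (auto simp: pos_imp_zdiv_nonneg_iff)
  ultimately have "card ?H \<le> card {0..p div int N}"
    by (rule card_inj_on_le) simp
  also have "\<dots> = nat (p div int N + 1)" by simp
  finally have "real (card ?H) \<le> real (nat (p div int N + 1))" by simp
  also have "\<dots> = real_of_int (p div int N) + 1" using N by (simp add: pos_imp_zdiv_nonneg_iff)
  also have "\<dots> \<le> p / N + 1" using real_of_int_div4[of p "int N"] by simp
  finally show ?thesis .
qed

text \<open>The values can differ at i only if \<open>shift i x\<close> has a hole within the total
  radius of 0. Each of the offsets in that range contributes one hole count.\<close>

lemma card_rval_code_le:
  assumes ST: "S \<in> toeplitz_sep" "T \<in> toeplitz_sep" "code_conj c d S T" and x: "x \<in> S"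
    and N: "1 \<le> N" "int N \<le> p" and g: "S \<subseteq> gapset p N"
  shows "real (card {i \<in> {0..<p}. rval p (shift i x) \<noteq> rval p (shift i (code c x))})
    \<le> real (2 * (fst c + fst d) + 1) * (p / N + 1)"
proof -
  let ?R = "int (fst c + fst d)"
  let ?H = "\<lambda>k. {i \<in> {0..<p}. \<not> cst p x (k - i)}"
  have "{i \<in> {0..<p}. rval p (shift i x) \<noteq> rval p (shift i (code c x))} \<subseteq> (\<Union>k\<in>{-?R..?R}. ?H k)"
  proof
    fix i assume "i \<in> {i \<in> {0..<p}. rval p (shift i x) \<noteq> rval p (shift i (code c x))}"
    then have i: "i \<in> {0..<p}" "rval p (shift i x) \<noteq> rval p (code c (shift i x))" by (auto simp: code_shift)
    have "shift i x \<in> S" using x subshiftsD(3) toeplitz_sepD(1)[OF ST(1)] by blast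
    then obtain k where "\<bar>k\<bar> \<le> ?R" "\<not> cst p (shift i x) k"
      using rval_code[OF ST, of "shift i x" p] i(2) N by fastforce
    then show "i \<in> (\<Union>k\<in>{-?R..?R}. ?H k)" using i(1) by (auto simp: cst_shift abs_le_iff)
  qed
  moreover have fin: "finite (\<Union>k\<in>{-?R..?R}. ?H k)"
    by (rule finite_subset[of _ "{0..<p}"]) auto
  ultimately have "card {i \<in> {0..<p}. rval p (shift i x) \<noteq> rval p (shift i (code c x))} \<le> card (\<Union>k\<in>{-?R..?R}. ?H k)"
    by (rule card_mono[rotated])
  also have "\<dots> \<le> (\<Sum>k\<in>{-?R..?R}. card (?H k))" by (rule card_UN_le) simp
  finally have "real (card {i \<in> {0..<p}. rval p (shift i x) \<noteq> rval p (shift i (code c x))}) \<le> (\<Sum>k\<in>{-?R..?R}. real (card (?H k)))"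
    unfolding of_nat_sum[symmetric] of_nat_le_iff .
  also have "\<dots> \<le> (\<Sum>k\<in>{-?R..?R}. p / N + 1)"
    using card_holes_le[of x p N] N g x by (intro sum_mono) auto
  also have "\<dots> = real (2 * (fst c + fst d) + 1) * (p / N + 1)" by simp
  finally show ?thesis .
qed

lemma rval_code_density:
  assumes ST: "S \<in> toeplitz_sep" "T \<in> toeplitz_sep" "code_conj c d S T" and x: "x \<in> S"
  shows "(\<lambda>n. real (card {i \<in> {0..<fact n}. rval (fact n) (shift i x) \<noteq> rval (fact n) (shift i (code c x))}) / fact n)
    \<longlonglongrightarrow> 0"
proof (rule LIMSEQ_I)
  fix e :: real assume e: "e > 0"
  define R where "R = real (2 * (fst c + fst d) + 1)"
  have R: "R > 0" by (simp add: R_def)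
  \<comment> \<open>With this N both R / N and, once n! is at least N, R / n! are below e /
    2.\<close>
  obtain N where N: "real N > 2 * R / e" using reals_Archimedean2 by blast
  then have N0: "N \<ge> 1" using R e by (cases N) (auto simp: field_simps)
  have RN: "R / N < e / 2" using N R e N0 by (simp add: field_simps)
  obtain q where q: "q \<ge> 1" "\<And>p. p \<ge> 1 \<Longrightarrow> q dvd p \<Longrightarrow> S \<subseteq> gapset (int p) N"
    using toeplitz_sepD(5)[OF ST(1), of N] by blast
  show "\<exists>no. \<forall>n\<ge>no. norm (real (card {i \<in> {0..<fact n}. rval (fact n) (shift i x) \<noteq> rval (fact n) (shift i (code c x))}) / fact n - 0) < e"
  proof (intro exI allI impI)
    \<comment> \<open>\<open>n \<ge> q\<close> makes q divide n!, and \<open>n \<ge> N\<close> gives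
      N \<le> n!.\<close>
    fix n assume n: "n \<ge> max q N"
    let ?p = "fact n :: int"
    have pn: "int n \<le> ?p" using fact_ge_self[of n] by (metis of_nat_fact of_nat_le_iff)
    have "S \<subseteq> gapset ?p N"
      using q(2)[of "fact n"] dvd_fact[of q n] n q(1) by (simp add: fact_ge_1)
    then have "real (card {i \<in> {0..<?p}. rval ?p (shift i x) \<noteq> rval ?p (shift i (code c x))}) \<le> R * (?p / N + 1)"
      unfolding R_def using card_rval_code_le[OF ST x N0, of ?p] pn n by simp
    then have "real (card {i \<in> {0..<?p}. rval ?p (shift i x) \<noteq> rval ?p (shift i (code c x))}) / fact n \<le> R * (?p / N + 1) / fact n"
      by (simp add: divide_right_mono)
    also have "\<dots> = R / N + R / fact n" by (simp add: field_simps)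
    also have "R / fact n \<le> R / real N"
    proof (rule divide_left_mono)
      have "real N \<le> real n" using n by simp
      also have "real n \<le> fact n" using fact_ge_self[of n] by (metis of_nat_fact of_nat_le_iff)
      finally show "real N \<le> fact n" .
    qed (use R N0 in auto)
    finally show "norm (real (card {i \<in> {0..<?p}. rval ?p (shift i x) \<noteq> rval ?p (shift i (code c x))}) / fact n - 0) < e"
      using RN by (simp add: mult.commute)
  qed
qed

section \<open>Amenability\<close>

lemma id_pair_measurable:
  assumes "(\<lambda>S. S) \<in> measurable N subshift_space"
  shows "(\<lambda>z. z) \<in> measurable (N \<Otimes>\<^sub>M N) (subshift_space \<Otimes>\<^sub>M subshift_space)"
proof -
  have "(\<lambda>z. (fst z, snd z)) \<in> measurable (N \<Otimes>\<^sub>M N) (subshift_space \<Otimes>\<^sub>M subshift_space)"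
    by (intro measurable_Pair measurable_compose[OF measurable_fst assms] measurable_compose[OF measurable_snd assms])
  then show ?thesis by simp
qed

text \<open>Stated for any space with measurable identity into the subshifts, so that it serves both
  for the whole Toeplitz space and for conull subsets of a measure.\<close>

lemma countable_borel_equiv_conjugacy:
  assumes N: "(\<lambda>S. S) \<in> measurable N subshift_space" "space N \<subseteq> toeplitz_sep"
  shows "countable_borel_equiv N (conjugacy_sep \<inter> space N \<times> space N)"
  unfolding countable_borel_equiv_def borel_equiv_def
proof (intro conjI ballI)
  show "equiv (space N) (conjugacy_sep \<inter> space N \<times> space N)"
    using equiv_conjugacy_sep N(2) unfolding equiv_def refl_on_def sym_on_def trans_on_def by blast
  have "(\<lambda>z. z) -` conjugacy_sep \<inter> space (N \<Otimes>\<^sub>M N) \<in> sets (N \<Otimes>\<^sub>M N)"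
    using id_pair_measurable[OF N(1)] conjugacy_sep_measurable by (rule measurable_sets)
  then show "conjugacy_sep \<inter> space N \<times> space N \<in> sets (N \<Otimes>\<^sub>M N)"
    by (simp add: space_pair_measure)
  show "countable ((conjugacy_sep \<inter> space N \<times> space N) `` {S})" for S
    by (rule countable_subset[OF _ countable_conjugacy_class[of S]]) auto
qed

lemma id_restrict_measurable: "(\<lambda>S. S) \<in> measurable (restrict_space subshift_space A) subshift_space"
  by (intro measurable_restrict_space1) simp

lemma space_restrict_toeplitz [simp]: "space (restrict_space subshift_space toeplitz_sep) = toeplitz_sep"
  using toeplitz_sepD(1) by (auto simp: space_restrict_space)

lemma sum_card_fibre_le:
  assumes "finite F" "finite B" "inj_on \<tau> F"
  shows "(\<Sum>z\<in>F. card {i \<in> B. a i = \<tau> z}) \<le> card B"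
proof -
  have "(\<Sum>z\<in>F. card {i \<in> B. a i = \<tau> z}) = card (\<Union>z\<in>F. {i \<in> B. a i = \<tau> z})"
    using assms by (intro card_UN_disjoint[symmetric]) (auto dest: inj_onD)
  also have "\<dots> \<le> card B" using assms by (intro card_mono) auto
  finally show ?thesis .
qed

lemma inj_on_tau: "inj_on tau toeplitz_sep"
  using tau_inj toeplitz_sepD(1) by (blast intro: inj_onI)

definition weight :: "nat \<Rightarrow> config set \<times> config set \<Rightarrow> real" where
  "weight n z = card {i \<in> {0..<fact n}. rval (fact n) (shift i (point (fst z))) = tau (snd z)} / fact n"

lemma weight_measurable: "weight n \<in> borel_measurable (subshift_space \<Otimes>\<^sub>M subshift_space)"
proof -
  have "weight n = (\<lambda>z. (\<Sum>i\<in>{0..<fact n}. if rval (fact n) (shift i (point (fst z))) = tau (snd z) then 1 else 0) / fact n)"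
    by (auto simp: weight_def fun_eq_iff sum.If_cases Int_def)
  also have "\<dots> \<in> borel_measurable (subshift_space \<Otimes>\<^sub>M subshift_space)"
    by measurable
  finally show ?thesis .
qed

lemma rval_orbit_in:
  assumes S: "S \<in> toeplitz_sep" and x: "x \<in> S" and p: "p \<ge> 1"
  shows "\<exists>T\<in>conjugacy_sep `` {S}. rval p (shift i x) = tau T"
proof -
  have o: "ocl (shift i x) = S" using toeplitz_sepD(3)[OF S x] by simp
  then obtain T where "T \<in> rset p (shift i x)" "rval p (shift i x) = tau T"
    using rval_in[OF p, of "shift i x"] S by auto
  then show ?thesis using rset_subset[of p "shift i x"] o by auto
qed

lemma weight_has_sum:
  assumes S: "S \<in> toeplitz_sep"
  shows "((\<lambda>T. \<bar>weight n (S, T)\<bar>) has_sum 1) (conjugacy_sep `` {S})"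
proof -
  let ?p = "fact n :: int"
  have x: "point S \<in> S" using point_in toeplitz_sepD(1)[OF S] by blast
  \<comment> \<open>g i is the subshift whose rank is the i-th value; by injectivity of
    \<open>tau\<close>, weights become fibre counts of g divided by n!.\<close>
  obtain g where g: "\<And>i. g i \<in> conjugacy_sep `` {S}" "\<And>i. rval ?p (shift i (point S)) = tau (g i)"
    using rval_orbit_in[OF S x, of ?p] fact_ge_1[of n] by metis
  let ?F = "g ` {0..<?p}"
  have w: "weight n (S, T) = card {i \<in> {0..<?p}. g i = T} / ?p" if "T \<in> toeplitz_sep" for T
  proof -
    have "tau (g i) = tau T \<longleftrightarrow> g i = T" for i
      using g(1)[of i] that inj_on_tau by (auto simp: conjugacy_sep_def dest: inj_onD)
    then show ?thesis by (simp add: weight_def g(2))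
  qed
  have "(\<Sum>T\<in>?F. \<bar>weight n (S, T)\<bar>) = (\<Sum>T\<in>?F. real (card {i \<in> {0..<?p}. g i = T})) / ?p"
    unfolding sum_divide_distrib using g(1) by (intro sum.cong) (auto simp: w conjugacy_sep_def)
  also have "(\<Sum>T\<in>?F. real (card {i \<in> {0..<?p}. g i = T})) = (\<Sum>T\<in>?F. \<Sum>i\<in>{i \<in> {0..<?p}. g i = T}. 1)"
    by simp
  also have "\<dots> = (\<Sum>i\<in>{0..<?p}. 1)" by (rule sum.group) auto
  finally have s: "(\<Sum>T\<in>?F. \<bar>weight n (S, T)\<bar>) = 1" by simp
  have "((\<lambda>T. \<bar>weight n (S, T)\<bar>) has_sum (\<Sum>T\<in>?F. \<bar>weight n (S, T)\<bar>)) ?F"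
    by (rule has_sum_finite) simp
  then have "((\<lambda>T. \<bar>weight n (S, T)\<bar>) has_sum 1) ?F" unfolding s .
  moreover have "\<bar>weight n (S, T)\<bar> = 0" if "T \<in> conjugacy_sep `` {S} - ?F" for T
  proof -
    have "{i \<in> {0..<?p}. g i = T} = {}" using that by auto
    moreover have "T \<in> toeplitz_sep" using that by (auto simp: conjugacy_sep_def)
    ultimately show ?thesis using w by (metis abs_0 card.empty div_0 of_nat_0)
  qed
  ultimately show ?thesis
    using g(1) by (subst has_sum_cong_neutral[of ?F _ _ "\<lambda>T. \<bar>weight n (S, T)\<bar>"]) auto
qed

text \<open>By independence of the point, the weights of T may be computed at
  \<open>code c x\<close> instead of \<open>point T\<close>. The two value lists then differ only at
  the bad indices, and each of these affects at most one count for its value in either list; hence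
  the factor 2.\<close>

lemma weight_diff_tendsto:
  assumes E: "(S, T) \<in> conjugacy_sep"
  shows "(\<lambda>n. \<Sum>\<^sub>\<infinity>z\<in>conjugacy_sep `` {S}. \<bar>weight n (S, z) - weight n (T, z)\<bar>) \<longlonglongrightarrow> 0"
proof -
  obtain c d where ST: "S \<in> toeplitz_sep" "T \<in> toeplitz_sep" "code_conj c d S T"
    using E by (auto simp: conjugacy_sep_iff)
  define x where "x = point S"
  have x: "x \<in> S" unfolding x_def using point_in toeplitz_sepD(1)[OF ST(1)] by blast
  have y: "code c x \<in> T" using ST(3) x by (auto simp: code_conj_def)
  have pT: "point T \<in> T" using point_in toeplitz_sepD(1)[OF ST(2)] by blast
  let ?B = "\<lambda>n. {i \<in> {0..<fact n}. rval (fact n) (shift i x) \<noteq> rval (fact n) (shift i (code c x))}"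
  have bound: "(\<Sum>\<^sub>\<infinity>z\<in>conjugacy_sep `` {S}. \<bar>weight n (S, z) - weight n (T, z)\<bar>) \<le> 2 * (real (card (?B n)) / fact n)" for n
  proof -
    let ?p = "fact n :: int"
    define a where "a i = rval ?p (shift i x)" for i
    define b where "b i = rval ?p (shift i (code c x))" for i
    have finB: "finite (?B n)" by (rule finite_subset[of _ "{0..<?p}"]) auto
    have wS: "weight n (S, z) = card {i \<in> {0..<?p}. a i = tau z} / fact n" for z
      by (simp add: weight_def a_def x_def)
    have wT: "weight n (T, z) = card {i \<in> {0..<?p}. b i = tau z} / fact n" for z
      using card_rval_eq[OF ST(2) _ pT y, of ?p "\<lambda>t. t = tau z"] fact_ge_1[of n]
      by (simp add: weight_def b_def)
    have diff: "\<bar>weight n (S, z) - weight n (T, z)\<bar>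
      \<le> (real (card {i \<in> ?B n. a i = tau z}) + real (card {i \<in> ?B n. b i = tau z})) / fact n" for z
    proof -
      let ?A = "{i \<in> {0..<?p}. a i = tau z}" and ?C = "{i \<in> {0..<?p}. b i = tau z}"
      let ?A' = "{i \<in> ?B n. a i = tau z}" and ?C' = "{i \<in> ?B n. b i = tau z}"
      have fin: "finite ?A" "finite ?C" "finite ?A'" "finite ?C'"
        using finB by (auto intro: finite_subset[of _ "{0..<?p}"])
      have "?A \<subseteq> ?C \<union> ?A'" "?C \<subseteq> ?A \<union> ?C'" by (auto simp: a_def b_def)
      then have "card ?A \<le> card ?C + card ?A'" "card ?C \<le> card ?A + card ?C'"
        using fin by (meson card_Un_le card_mono finite_UnI order_trans)+
      then have "\<bar>real (card ?A) - real (card ?C)\<bar> \<le> real (card ?A') + real (card ?C')" by linarith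
      then have "\<bar>real (card ?A) - real (card ?C)\<bar> / fact n \<le> (real (card ?A') + real (card ?C')) / fact n"
        by (rule divide_right_mono) simp
      moreover have "\<bar>weight n (S, z) - weight n (T, z)\<bar> = \<bar>real (card ?A) - real (card ?C)\<bar> / fact n"
        unfolding wS wT by (simp add: diff_divide_distrib[symmetric])
      ultimately show ?thesis by simp
    qed
    \<comment> \<open>The subshifts named by either list; both weights vanish outside F, so the
      infinite sum reduces to a finite one.\<close>
    define F where "F = {z \<in> conjugacy_sep `` {S}. tau z \<in> a ` {0..<?p} \<union> b ` {0..<?p}}"
    have inj: "inj_on tau F"
      by (rule inj_on_subset[OF inj_on_tau]) (auto simp: F_def conjugacy_sep_def)
    have finF: "finite F"
      by (rule inj_on_finite[OF inj, of "a ` {0..<?p} \<union> b ` {0..<?p}"]) (auto simp: F_def)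
    have "(\<Sum>\<^sub>\<infinity>z\<in>conjugacy_sep `` {S}. \<bar>weight n (S, z) - weight n (T, z)\<bar>) = (\<Sum>\<^sub>\<infinity>z\<in>F. \<bar>weight n (S, z) - weight n (T, z)\<bar>)"
    proof (rule infsum_cong_neutral)
      fix z assume z: "z \<in> conjugacy_sep `` {S} - F"
      then have "tau z \<notin> a ` {0..<?p}" "tau z \<notin> b ` {0..<?p}" by (auto simp: F_def)
      then have "{i \<in> {0..<?p}. a i = tau z} = {}" "{i \<in> {0..<?p}. b i = tau z} = {}"
        by (metis (mono_tags, lifting) Collect_empty_eq imageI)+
      then show "\<bar>weight n (S, z) - weight n (T, z)\<bar> = 0" unfolding wS wT by (simp only: card.empty)
    qed (auto simp: F_def)
    also have "\<dots> = (\<Sum>z\<in>F. \<bar>weight n (S, z) - weight n (T, z)\<bar>)" using finF by simp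
    also have "\<dots> \<le> (\<Sum>z\<in>F. (real (card {i \<in> ?B n. a i = tau z}) + real (card {i \<in> ?B n. b i = tau z})) / fact n)"
      by (rule sum_mono) (rule diff)
    also have "\<dots> = (real (\<Sum>z\<in>F. card {i \<in> ?B n. a i = tau z}) + real (\<Sum>z\<in>F. card {i \<in> ?B n. b i = tau z})) / fact n"
      by (simp only: sum_divide_distrib[symmetric] sum.distrib of_nat_sum)
    also have "\<dots> \<le> (real (card (?B n)) + real (card (?B n))) / fact n"
      using sum_card_fibre_le[OF finF finB inj] by (intro divide_right_mono add_mono) (simp_all only: of_nat_le_iff, auto)
    finally show ?thesis by simp
  qed
  show ?thesis
  proof (rule tendsto_sandwich[of "\<lambda>_. 0"])
    show "\<forall>\<^sub>F n in sequentially. 0 \<le> (\<Sum>\<^sub>\<infinity>z\<in>conjugacy_sep `` {S}. \<bar>weight n (S, z) - weight n (T, z)\<bar>)"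
      by (intro always_eventually allI infsum_nonneg) simp
    show "\<forall>\<^sub>F n in sequentially. (\<Sum>\<^sub>\<infinity>z\<in>conjugacy_sep `` {S}. \<bar>weight n (S, z) - weight n (T, z)\<bar>) \<le> 2 * (real (card (?B n)) / fact n)"
      using bound by (intro always_eventually allI)
    show "(\<lambda>n. 2 * (real (card (?B n)) / fact n)) \<longlonglongrightarrow> 0"
      using tendsto_mult_right_zero[OF rval_code_density[OF ST x], of 2] .
  qed simp
qed

lemma conjugacy_sep_subset: "conjugacy_sep \<subseteq> toeplitz_sep \<times> toeplitz_sep"
  by (auto simp: conjugacy_sep_def)

lemma amenable_conjugacy_sep: "amenable (restrict_space subshift_space toeplitz_sep) conjugacy_sep"
  unfolding amenable_def
proof (intro conjI exI[of _ weight] allI ballI)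
  let ?M = "restrict_space subshift_space toeplitz_sep"
  show "countable_borel_equiv ?M conjugacy_sep"
    using countable_borel_equiv_conjugacy[OF id_restrict_measurable, of toeplitz_sep] conjugacy_sep_subset
    by (simp add: Int_absorb2)
  fix n
  have "weight n \<in> borel_measurable (?M \<Otimes>\<^sub>M ?M)"
    using measurable_compose[OF id_pair_measurable[OF id_restrict_measurable] weight_measurable] by simp
  then show "weight n \<in> borel_measurable (restrict_space (?M \<Otimes>\<^sub>M ?M) conjugacy_sep)"
    by (rule measurable_restrict_space1)
  show "0 \<le> weight n e" for e by (simp add: weight_def)
  show "((\<lambda>y. \<bar>weight n (S, y)\<bar>) has_sum 1) (conjugacy_sep `` {S})" if "S \<in> space ?M" for S
    using weight_has_sum that by simp
next
  fix z assume "z \<in> conjugacy_sep"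
  then show "case z of (x, y) \<Rightarrow> (\<lambda>n. \<Sum>\<^sub>\<infinity>z\<in>conjugacy_sep `` {x}. \<bar>weight n (x, z) - weight n (y, z)\<bar>) \<longlonglongrightarrow> 0"
    using weight_diff_tendsto by (cases z) auto
qed

section \<open>Choosing an element by a random order\<close>

definition amin :: "(nat \<Rightarrow> nat) \<Rightarrow> nat set \<Rightarrow> nat" where
  "amin \<sigma> A = inv \<sigma> (Min (\<sigma> ` A))"

lemma amin_eqI:
  assumes "\<sigma> permutes U" "finite A" "d \<in> A" "\<And>e. e \<in> A \<Longrightarrow> \<sigma> d \<le> \<sigma> e"
  shows "amin \<sigma> A = d"
proof -
  have "Min (\<sigma> ` A) = \<sigma> d" using assms(2-4) by (intro Min_eqI) auto
  then show ?thesis unfolding amin_def using permutes_inverses(2)[OF assms(1)] by simp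
qed

lemma amin_least:
  assumes "\<sigma> permutes U" "finite A" "A \<noteq> {}"
  shows "amin \<sigma> A \<in> A" "e \<in> A \<Longrightarrow> \<sigma> (amin \<sigma> A) \<le> \<sigma> e"
proof -
  have "Min (\<sigma> ` A) \<in> \<sigma> ` A" using assms by (intro Min_in) auto
  then obtain d where d: "d \<in> A" "Min (\<sigma> ` A) = \<sigma> d" by auto
  have le: "\<sigma> d \<le> \<sigma> e" if "e \<in> A" for e using assms(2) that unfolding d(2)[symmetric] by (intro Min_le) auto
  have eq: "amin \<sigma> A = d" using amin_eqI[OF assms(1,2) d(1) le] by simp
  show "amin \<sigma> A \<in> A" using eq d by simp
  show "e \<in> A \<Longrightarrow> \<sigma> (amin \<sigma> A) \<le> \<sigma> e" using eq le by simp
qed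

text \<open>Composing with a transposition turns the orders in which a is first into those in which
  b is first, so all elements of D are first equally often.\<close>

lemma card_amin_eq:
  assumes U: "finite U" and D: "D \<subseteq> U" and d: "d \<in> D"
  shows "card {\<sigma>. \<sigma> permutes U \<and> amin \<sigma> D = d} * card D = card {\<sigma>. \<sigma> permutes U}"
proof -
  let ?N = "\<lambda>d. {\<sigma>. \<sigma> permutes U \<and> amin \<sigma> D = d}"
  have finD: "finite D" "D \<noteq> {}" using D U d finite_subset by auto
  have finP: "finite {\<sigma>. \<sigma> permutes U}" using finite_permutations[OF U] .
  have le: "card (?N a) \<le> card (?N b)" if ab: "a \<in> D" "b \<in> D" for a b
  proof (rule card_inj_on_le)
    let ?t = "Transposition.transpose a b"
    have t: "?t permutes U" using ab D by (intro permutes_swap_id) auto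
    show "inj_on (\<lambda>\<sigma>. \<sigma> \<circ> ?t) (?N a)"
      by (rule inj_onI) (metis comp_assoc comp_id transpose_comp_involutory)
    show "finite (?N b)" using finP by (rule rev_finite_subset) auto
    show "(\<lambda>\<sigma>. \<sigma> \<circ> ?t) ` ?N a \<subseteq> ?N b"
    proof
      fix \<rho> assume "\<rho> \<in> (\<lambda>\<sigma>. \<sigma> \<circ> ?t) ` ?N a"
      then obtain \<sigma> where \<sigma>: "\<sigma> permutes U" "amin \<sigma> D = a" "\<rho> = \<sigma> \<circ> ?t" by auto
      have \<rho>: "\<rho> permutes U" unfolding \<sigma>(3) using t \<sigma>(1) by (rule permutes_compose)
      have "amin \<rho> D = b"
      proof (rule amin_eqI[OF \<rho> finD(1) ab(2)])
        fix e assume e: "e \<in> D"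
        have "?t e \<in> D" using e ab by (auto simp: Transposition.transpose_def)
        then have "\<sigma> a \<le> \<sigma> (?t e)" using amin_least(2)[OF \<sigma>(1) finD] \<sigma>(2) by blast
        then show "\<rho> b \<le> \<rho> e" using \<sigma>(3) by simp
      qed
      then show "\<rho> \<in> ?N b" using \<rho> by simp
    qed
  qed
  have "{\<sigma>. \<sigma> permutes U} = (\<Union>e\<in>D. ?N e)"
    using amin_least(1)[OF _ finD] by auto
  then have "card {\<sigma>. \<sigma> permutes U} = (\<Sum>e\<in>D. card (?N e))"
    using finD finP by (simp only:) (intro card_UN_disjoint, auto intro: rev_finite_subset[OF finP])
  also have "\<dots> = (\<Sum>e\<in>D. card (?N d))" using le d by (intro sum.cong) (auto intro: antisym)
  finally show ?thesis by simp
qed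

text \<open>If the first element of A \<union> B lies in G, it is the first of both sets. Otherwise
  it is one of at most 2 d elements, each first with frequency 1 / |A \<union> B| \<le> 1 /
  |A|.\<close>

lemma card_amin_neq:
  assumes U: "finite U" and AB: "A \<subseteq> U" "B \<subseteq> U" and G: "G \<subseteq> A" "G \<subseteq> B"
    and d: "card (A - G) \<le> d" "card (B - G) \<le> d" and A: "A \<noteq> {}" "B \<noteq> {}"
  shows "card {\<sigma>. \<sigma> permutes U \<and> amin \<sigma> A \<noteq> amin \<sigma> B} * card A \<le> 2 * d * card {\<sigma>. \<sigma> permutes U}"
proof -
  let ?D = "A \<union> B"
  let ?P = "{\<sigma>. \<sigma> permutes U}"
  let ?N = "\<lambda>e. {\<sigma>. \<sigma> permutes U \<and> amin \<sigma> ?D = e}"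
  have fin: "finite A" "finite B" "finite ?D" using AB U finite_subset by auto
  have "{\<sigma>. \<sigma> permutes U \<and> amin \<sigma> A \<noteq> amin \<sigma> B} \<subseteq> (\<Union>e\<in>?D - G. ?N e)"
  proof
    fix \<sigma> assume "\<sigma> \<in> {\<sigma>. \<sigma> permutes U \<and> amin \<sigma> A \<noteq> amin \<sigma> B}"
    then have \<sigma>: "\<sigma> permutes U" "amin \<sigma> A \<noteq> amin \<sigma> B" by auto
    have m: "amin \<sigma> ?D \<in> ?D" "\<And>e. e \<in> ?D \<Longrightarrow> \<sigma> (amin \<sigma> ?D) \<le> \<sigma> e"
      using amin_least[OF \<sigma>(1) fin(3)] A by auto
    have "amin \<sigma> ?D \<notin> G"
    proof
      assume g: "amin \<sigma> ?D \<in> G"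
      have "amin \<sigma> A = amin \<sigma> ?D" by (rule amin_eqI[OF \<sigma>(1) fin(1)]) (use g G m in auto)
      moreover have "amin \<sigma> B = amin \<sigma> ?D" by (rule amin_eqI[OF \<sigma>(1) fin(2)]) (use g G m in auto)
      ultimately show False using \<sigma>(2) by simp
    qed
    then show "\<sigma> \<in> (\<Union>e\<in>?D - G. ?N e)" using m(1) \<sigma>(1) by auto
  qed
  then have "card {\<sigma>. \<sigma> permutes U \<and> amin \<sigma> A \<noteq> amin \<sigma> B} \<le> card (\<Union>e\<in>?D - G. ?N e)"
    by (rule card_mono[rotated]) (rule finite_subset[OF _ finite_permutations[OF U]], auto)
  also have "\<dots> \<le> (\<Sum>e\<in>?D - G. card (?N e))" using fin by (intro card_UN_le) auto
  finally have "card {\<sigma>. \<sigma> permutes U \<and> amin \<sigma> A \<noteq> amin \<sigma> B} * card ?D \<le> (\<Sum>e\<in>?D - G. card (?N e)) * card ?D"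
    by simp
  also have "\<dots> = (\<Sum>e\<in>?D - G. card (?N e) * card ?D)" by (rule sum_distrib_right)
  also have "\<dots> = (\<Sum>e\<in>?D - G. card ?P)"
    using AB by (intro sum.cong refl card_amin_eq[OF U]) auto
  also have "\<dots> = card (?D - G) * card ?P" by simp
  also have "\<dots> \<le> (2 * d) * card ?P"
  proof (rule mult_right_mono)
    have "card (?D - G) \<le> card (A - G) + card (B - G)" unfolding Un_Diff by (rule card_Un_le)
    then show "card (?D - G) \<le> 2 * d" using d by simp
  qed simp
  finally have "card {\<sigma>. \<sigma> permutes U \<and> amin \<sigma> A \<noteq> amin \<sigma> B} * card ?D \<le> 2 * d * card ?P" .
  moreover have "card A \<le> card ?D" using fin by (intro card_mono) auto
  ultimately show ?thesis by (meson mult_le_mono2 order_trans)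
qed

text \<open>A multiset of at most \<open>P\<close> colours is coded by the set of numbers \<open>c * P + j\<close>, where \<open>j\<close> runs below
  the multiplicity of the colour \<open>c\<close>.\<close>

definition cset :: "nat \<Rightarrow> 'i set \<Rightarrow> ('i \<Rightarrow> nat) \<Rightarrow> nat set" where
  "cset P J \<kappa> = {u. u mod P < card {i \<in> J. \<kappa> i = u div P}}"

lemma cset_color:
  assumes "u \<in> cset P J \<kappa>"
  shows "\<exists>i\<in>J. \<kappa> i = u div P"
proof (rule ccontr)
  assume "\<not> ?thesis"
  then have e: "{i \<in> J. \<kappa> i = u div P} = {}" by auto
  show False using assms unfolding cset_def mem_Collect_eq e by simp
qed

lemma cset_eq_Sigma:
  assumes J: "finite J" "card J \<le> P"
  shows "cset P J \<kappa> = (\<lambda>(c, j). c * P + j) ` (SIGMA c:\<kappa> ` J. {..<card {i \<in> J. \<kappa> i = c}})"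
proof (intro subset_antisym subsetI)
  fix u assume u: "u \<in> cset P J \<kappa>"
  then obtain i where "i \<in> J" "\<kappa> i = u div P" using cset_color by blast
  then have "u div P \<in> \<kappa> ` J" by (metis imageI)
  moreover have "u mod P < card {i \<in> J. \<kappa> i = u div P}" using u by (simp add: cset_def)
  ultimately show "u \<in> (\<lambda>(c, j). c * P + j) ` (SIGMA c:\<kappa> ` J. {..<card {i \<in> J. \<kappa> i = c}})"
    by (intro image_eqI[of _ _ "(u div P, u mod P)"]) auto
next
  fix u assume "u \<in> (\<lambda>(c, j). c * P + j) ` (SIGMA c:\<kappa> ` J. {..<card {i \<in> J. \<kappa> i = c}})"
  then obtain c j where cj: "j < card {i \<in> J. \<kappa> i = c}" "u = c * P + j" by auto
  have "card {i \<in> J. \<kappa> i = c} \<le> card J" using J(1) by (intro card_mono) auto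
  then have "j < P" using cj J by simp
  then show "u \<in> cset P J \<kappa>" using cj by (simp add: cset_def)
qed

lemma finite_cset: "finite J \<Longrightarrow> card J \<le> P \<Longrightarrow> finite (cset P J \<kappa>)"
  by (simp only: cset_eq_Sigma) (intro finite_imageI finite_SigmaI finite_lessThan)

lemma card_cset:
  assumes J: "finite J" "card J \<le> P"
  shows "card (cset P J \<kappa>) = card J"
proof -
  have lt: "j < P" if "j < card {i \<in> J. \<kappa> i = c}" for j c
  proof -
    have "card {i \<in> J. \<kappa> i = c} \<le> card J" using J(1) by (intro card_mono) auto
    then show ?thesis using that J by simp
  qed
  have "inj_on (\<lambda>(c, j). c * P + j) (SIGMA c:\<kappa> ` J. {..<card {i \<in> J. \<kappa> i = c}})"
  proof (rule inj_onI)
    fix v w assume v: "v \<in> (SIGMA c:\<kappa> ` J. {..<card {i \<in> J. \<kappa> i = c}})"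
      and w: "w \<in> (SIGMA c:\<kappa> ` J. {..<card {i \<in> J. \<kappa> i = c}})"
      and e: "(\<lambda>(c, j). c * P + j) v = (\<lambda>(c, j). c * P + j) w"
    obtain a j b k where vw: "v = (a, j)" "w = (b, k)" by (cases v, cases w)
    have "j < P" "k < P" using lt v w by (auto simp: vw)
    then show "v = w"
      using arg_cong[OF e, of "\<lambda>u. u div P"] arg_cong[OF e, of "\<lambda>u. u mod P"] by (auto simp: vw)
  qed
  then have "card (cset P J \<kappa>) = card (SIGMA c:\<kappa> ` J. {..<card {i \<in> J. \<kappa> i = c}})"
    unfolding cset_eq_Sigma[OF J] by (rule card_image)
  also have "\<dots> = (\<Sum>c\<in>\<kappa> ` J. card {i \<in> J. \<kappa> i = c})" using J(1) by (simp add: card_SigmaI)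
  also have "\<dots> = (\<Sum>c\<in>\<kappa> ` J. \<Sum>i\<in>{i \<in> J. \<kappa> i = c}. 1)" by simp
  also have "\<dots> = (\<Sum>i\<in>J. 1)" using J(1) by (intro sum.group) auto
  finally show ?thesis by simp
qed

lemma cset_mono: "finite I \<Longrightarrow> J \<subseteq> I \<Longrightarrow> cset P J \<kappa> \<subseteq> cset P I \<kappa>"
  unfolding cset_def by (auto elim!: order.strict_trans2 intro!: card_mono)

lemma cset_bound:
  assumes "u \<in> cset P J \<kappa>" "P > 0" "\<And>i. i \<in> J \<Longrightarrow> \<kappa> i < L"
  shows "u < L * P"
proof -
  obtain i where "i \<in> J" "\<kappa> i = u div P" using cset_color[OF assms(1)] by blast
  then have "u div P < L" using assms(3) by metis
  then show ?thesis using assms(2) by (simp add: div_less_iff_less_mult)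
qed

text \<open>Both codings have size \<open>card I\<close> and contain the coding of the indices where
  the colours agree. Each exceeds this common part by exactly the number of disagreements, so
  \<open>card_amin_neq\<close> applies.\<close>

lemma card_pick_neq:
  assumes I: "finite I" "I \<noteq> {}" and L: "\<And>i. i \<in> I \<Longrightarrow> \<kappa> i < L" "\<And>i. i \<in> I \<Longrightarrow> \<kappa>' i < L"
  defines "U \<equiv> {..<L * card I}"
  shows "card {\<sigma>. \<sigma> permutes U \<and> amin \<sigma> (cset (card I) I \<kappa>) \<noteq> amin \<sigma> (cset (card I) I \<kappa>')} * card I
    \<le> 2 * card {i \<in> I. \<kappa> i \<noteq> \<kappa>' i} * card {\<sigma>. \<sigma> permutes U}"
proof -
  let ?P = "card I"
  have P: "?P > 0" using I by (simp add: card_gt_0_iff)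
  let ?J = "{i \<in> I. \<kappa> i = \<kappa>' i}"
  let ?G = "cset ?P ?J \<kappa>"
  have J: "finite ?J" "card ?J \<le> ?P" using I by (auto intro: card_mono)
  have G': "?G = cset ?P ?J \<kappa>'"
  proof -
    have "{i \<in> ?J. \<kappa> i = c} = {i \<in> ?J. \<kappa>' i = c}" for c by auto
    then show ?thesis unfolding cset_def by simp
  qed
  have sub: "?G \<subseteq> cset ?P I \<kappa>" "?G \<subseteq> cset ?P I \<kappa>'"
    using cset_mono[OF I(1), of ?J ?P \<kappa>] cset_mono[OF I(1), of ?J ?P \<kappa>'] unfolding G'[symmetric] by auto
  have "I - ?J = {i \<in> I. \<kappa> i \<noteq> \<kappa>' i}" by auto
  then have cJ: "card I - card ?J = card {i \<in> I. \<kappa> i \<noteq> \<kappa>' i}"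
    using card_Diff_subset[of ?J I] J by auto
  have d: "card (cset ?P I \<theta> - ?G) = card {i \<in> I. \<kappa> i \<noteq> \<kappa>' i}" if "?G \<subseteq> cset ?P I \<theta>" for \<theta>
    using card_Diff_subset[OF finite_cset[OF J] that] card_cset[OF I(1), of ?P] card_cset[OF J] cJ by simp
  have UI: "cset ?P I \<theta> \<subseteq> U" if "\<And>i. i \<in> I \<Longrightarrow> \<theta> i < L" for \<theta>
    using cset_bound[OF _ P that] by (auto simp: U_def)
  have ne: "cset ?P I \<theta> \<noteq> {}" for \<theta> using card_cset[OF I(1), of ?P \<theta>] P by auto
  have "card {\<sigma>. \<sigma> permutes U \<and> amin \<sigma> (cset ?P I \<kappa>) \<noteq> amin \<sigma> (cset ?P I \<kappa>')} * card (cset ?P I \<kappa>)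
    \<le> 2 * card {i \<in> I. \<kappa> i \<noteq> \<kappa>' i} * card {\<sigma>. \<sigma> permutes U}"
    by (rule card_amin_neq[OF _ UI UI sub]) (use L d sub ne in \<open>auto simp: U_def\<close>)
  then show ?thesis using card_cset[OF I(1), of ?P \<kappa>] by simp
qed

section \<open>Hyperfiniteness almost everywhere\<close>

definition color :: "nat \<Rightarrow> real \<Rightarrow> nat" where
  "color L t = nat \<lfloor>real L * t\<rfloor>"

definition coding :: "nat \<Rightarrow> nat \<Rightarrow> config \<Rightarrow> nat set" where
  "coding n L x = cset (fact n) {0..<fact n :: int} (\<lambda>i. color L (rval (fact n) (shift i x)))"

text \<open>The order selects only a colour, which may cover several values. Taking the least value
  of that colour returns an actual value of \<open>rval\<close>, so that
  \<open>finite_rval_fiber\<close> can be used.\<close>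

definition chosen :: "(nat \<Rightarrow> nat) \<Rightarrow> nat \<Rightarrow> nat \<Rightarrow> config \<Rightarrow> real" where
  "chosen \<sigma> n L x = Min ((\<lambda>i. rval (fact n) (shift i x)) `
     {i \<in> {0..<fact n}. color L (rval (fact n) (shift i x)) = amin \<sigma> (coding n L x) div fact n})"

lemma card_index: "card {0..<fact n :: int} = fact n"
  by (metis card_atLeastZeroLessThan_int nat_int of_nat_fact)

lemma rval_bounds: "0 \<le> rval p x" "rval p x \<le> 2"
  unfolding rval_def using finite_rset tau_nonneg by auto

text \<open>The bound is 2 L + 1 because \<open>rval\<close> may take the default value 2, whose
  colour is 2 L.\<close>

lemma color_rval_less: "color L (rval p x) < 2 * L + 1"
proof -
  have "real L * rval p x \<le> real L * 2" using rval_bounds(2) by (rule mult_left_mono) simp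
  then have "\<lfloor>real L * rval p x\<rfloor> \<le> int (2 * L)" by (simp add: floor_le_iff)
  then show ?thesis by (simp add: color_def)
qed

lemma coding_nonempty: "coding n L x \<noteq> {}" "finite (coding n L x)"
proof -
  have c: "card (coding n L x) = fact n"
    unfolding coding_def using card_cset[of "{0..<fact n :: int}" "fact n"] card_index by simp
  show "coding n L x \<noteq> {}" using c by (metis card.empty fact_nonzero)
  show "finite (coding n L x)" using c by (metis card.infinite fact_nonzero)
qed

lemma chosen_obtain:
  assumes "\<sigma> permutes U"
  shows "\<exists>i\<in>{0..<fact n}. chosen \<sigma> n L x = rval (fact n) (shift i x)
    \<and> color L (rval (fact n) (shift i x)) = amin \<sigma> (coding n L x) div fact n"
proof -
  let ?J = "{i \<in> {0..<fact n}. color L (rval (fact n) (shift i x)) = amin \<sigma> (coding n L x) div fact n}"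
  have fin: "finite ?J" by (rule finite_subset[of _ "{0..<fact n}"]) auto
  have "amin \<sigma> (coding n L x) \<in> coding n L x"
    using amin_least(1)[OF assms coding_nonempty(2,1)] .
  from cset_color[OF this[unfolded coding_def]] have ne: "?J \<noteq> {}" by (auto simp: coding_def)
  have "chosen \<sigma> n L x \<in> (\<lambda>i. rval (fact n) (shift i x)) ` ?J"
    unfolding chosen_def using fin ne by (intro Min_in) auto
  then show ?thesis by auto
qed

lemma coding_eq:
  assumes "S \<in> toeplitz_sep" "x \<in> S" "y \<in> S"
  shows "coding n L x = coding n L y"
  unfolding coding_def cset_def
  using card_rval_eq[OF assms(1) _ assms(2,3), of "fact n" "\<lambda>t. color L t = c" for c] fact_ge_1[of n] by simp

lemma rval_range_eq:
  assumes S: "S \<in> toeplitz_sep" "x \<in> S" "y \<in> S"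
  shows "(\<lambda>i. rval (fact n) (shift i x)) ` {0..<fact n} = (\<lambda>i. rval (fact n) (shift i y)) ` {0..<fact n}"
proof -
  have "t \<in> (\<lambda>i. rval (fact n) (shift i x)) ` {0..<fact n} \<longleftrightarrow> card {i \<in> {0..<fact n :: int}. rval (fact n) (shift i x) = t} \<noteq> 0" for x t
  proof -
    have "finite {i \<in> {0..<fact n :: int}. rval (fact n) (shift i x) = t}"
      by (rule finite_subset[of _ "{0..<fact n}"]) auto
    then show ?thesis unfolding card_eq_0_iff by auto
  qed
  then show ?thesis
    using card_rval_eq[OF S(1) fact_ge_1[of n] S(2,3), of "\<lambda>s. s = t" for t] by (intro set_eqI) (simp only:)
qed

text \<open>Only the counts and the set of values enter, and both are the same for all points of S.
  An image of the selected point under a code may therefore stand in for the selected point of the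
  image.\<close>

lemma chosen_eq:
  assumes "S \<in> toeplitz_sep" "x \<in> S" "y \<in> S"
  shows "chosen \<sigma> n L x = chosen \<sigma> n L y"
proof -
  have *: "(\<lambda>i. rval (fact n) (shift i x)) ` {i \<in> {0..<fact n}. color L (rval (fact n) (shift i x)) = c}
    = {t \<in> (\<lambda>i. rval (fact n) (shift i x)) ` {0..<fact n}. color L t = c}" for x c
    by auto
  show ?thesis
    unfolding chosen_def * coding_eq[OF assms] rval_range_eq[OF assms] ..
qed

text \<open>Rounding does not confuse a value of x with a different value of y; equal selected
  colours then force equal chosen values.\<close>

definition separates :: "nat \<Rightarrow> nat \<Rightarrow> config \<Rightarrow> config \<Rightarrow> bool" where
  "separates n L x y \<longleftrightarrow> (\<forall>i\<in>{0..<fact n}. \<forall>j\<in>{0..<fact n}.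
     color L (rval (fact n) (shift i x)) = color L (rval (fact n) (shift j y)) \<longrightarrow>
       rval (fact n) (shift i x) = rval (fact n) (shift j y))"

lemma chosen_eq_if_separates:
  assumes "\<sigma> permutes U" "separates n L x y" "amin \<sigma> (coding n L x) = amin \<sigma> (coding n L y)"
  shows "chosen \<sigma> n L x = chosen \<sigma> n L y"
  using chosen_obtain[OF assms(1), of n L x] chosen_obtain[OF assms(1), of n L y] assms(2,3)
  unfolding separates_def by metis

lemma color_eventually_neq:
  assumes "0 \<le> s" "0 \<le> t" "s \<noteq> t"
  shows "\<forall>\<^sub>F L in sequentially. color L s \<noteq> color L t"
proof -
  \<comment> \<open>For L \<ge> K the mesh 1 / L is smaller than |s - t|, whereas equal colours
    would bring s and t closer than the mesh.\<close>
  obtain K where K: "real K > 1 / \<bar>s - t\<bar>" using reals_Archimedean2 by blast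
  have "color L s \<noteq> color L t" if L: "L \<ge> K" for L
  proof
    assume "color L s = color L t"
    then have "\<lfloor>real L * s\<rfloor> = \<lfloor>real L * t\<rfloor>" using assms by (simp add: color_def eq_nat_nat_iff)
    then have "\<bar>real L * s - real L * t\<bar> < 1" by linarith
    moreover have "real L * \<bar>s - t\<bar> > 1"
    proof -
      have "1 < real K * \<bar>s - t\<bar>" using K assms by (simp add: field_simps)
      also have "\<dots> \<le> real L * \<bar>s - t\<bar>" using L by (intro mult_right_mono) auto
      finally show ?thesis .
    qed
    ultimately show False by (simp add: abs_mult right_diff_distrib[symmetric])
  qed
  then show ?thesis unfolding eventually_sequentially by blast
qed

lemma separates_eventually: "\<forall>\<^sub>F L in sequentially. separates n L x y"
  unfolding separates_def
proof (intro eventually_ball_finite ballI)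
  fix i j
  show "\<forall>\<^sub>F L in sequentially. color L (rval (fact n) (shift i x)) = color L (rval (fact n) (shift j y)) \<longrightarrow>
       rval (fact n) (shift i x) = rval (fact n) (shift j y)"
  proof (cases "rval (fact n) (shift i x) = rval (fact n) (shift j y)")
    case False
    from color_eventually_neq[OF rval_bounds(1) rval_bounds(1) this] show ?thesis
      by eventually_elim simp
  qed simp
qed auto

lemma color_measurable: "color L \<in> measurable borel (count_space UNIV)"
  unfolding color_def by measurable

lemma measurable_eq_countable:
  fixes f g :: "'a \<Rightarrow> nat"
  assumes [measurable]: "f \<in> measurable M (count_space UNIV)" "g \<in> measurable M (count_space UNIV)"
  shows "Measurable.pred M (\<lambda>x. f x = g x)"
proof -
  have "Measurable.pred M (\<lambda>x. \<exists>c. f x = c \<and> g x = c)" by measurable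
  then show ?thesis by (rule measurable_cong[THEN iffD1, rotated]) auto
qed

lemma color_rval_measurable [measurable]:
  "(\<lambda>x. color L (rval p (shift i x))) \<in> measurable config_space (count_space UNIV)"
  by (rule measurable_compose[OF _ color_measurable]) measurable

lemma coding_measurable [measurable]: "Measurable.pred config_space (\<lambda>x. u \<in> coding n L x)"
proof -
  have *: "u \<in> coding n L x \<longleftrightarrow> real (u mod fact n) <
    (\<Sum>i\<in>{0..<fact n :: int}. if color L (rval (fact n) (shift i x)) = u div fact n then 1 else 0)" for x
  proof -
    have "(\<Sum>i\<in>{0..<fact n :: int}. if color L (rval (fact n) (shift i x)) = u div fact n then 1 else 0) =
      real (card {i \<in> {0..<fact n :: int}. color L (rval (fact n) (shift i x)) = u div fact n})"
      by (simp add: sum.If_cases Int_def)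
    then show ?thesis unfolding coding_def cset_def by simp
  qed
  show ?thesis unfolding * by measurable
qed

lemma amin_coding_measurable:
  assumes \<sigma>: "\<sigma> permutes U"
  shows "(\<lambda>x. amin \<sigma> (coding n L x)) \<in> measurable config_space (count_space UNIV)"
proof -
  have *: "amin \<sigma> (coding n L x) = u \<longleftrightarrow> u \<in> coding n L x \<and> (\<forall>v. v \<in> coding n L x \<longrightarrow> \<sigma> u \<le> \<sigma> v)" for u x
    using amin_least[OF \<sigma> coding_nonempty(2,1)] amin_eqI[OF \<sigma> coding_nonempty(2)] by metis
  have "Measurable.pred config_space (\<lambda>x. amin \<sigma> (coding n L x) = u)" for u
    unfolding * by measurable
  from predE[OF this] show ?thesis
    unfolding measurable_count_space_eq2_countable by (auto simp: vimage_def Int_def conj_commute)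
qed

lemma chosen_measurable:
  assumes \<sigma>: "\<sigma> permutes U"
  shows "chosen \<sigma> n L \<in> borel_measurable config_space"
proof (rule borel_measurable_iff_le[THEN iffD2], rule allI)
  fix a
  have eq: "Measurable.pred config_space (\<lambda>x. color L (rval (fact n) (shift i x)) = amin \<sigma> (coding n L x) div fact n)" for i
  proof -
    have "(\<lambda>x. amin \<sigma> (coding n L x) div fact n) \<in> measurable config_space (count_space UNIV)"
      by (rule measurable_compose[OF amin_coding_measurable[OF \<sigma>]]) simp
    then show ?thesis by (intro measurable_eq_countable color_rval_measurable)
  qed
  have le: "Measurable.pred config_space (\<lambda>x. rval (fact n) (shift i x) \<le> a)" for i
    by measurable
  have *: "chosen \<sigma> n L x \<le> a \<longleftrightarrow> (\<exists>i\<in>{0..<fact n}.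
    color L (rval (fact n) (shift i x)) = amin \<sigma> (coding n L x) div fact n \<and> rval (fact n) (shift i x) \<le> a)" for x
  proof
    assume "chosen \<sigma> n L x \<le> a"
    then show "\<exists>i\<in>{0..<fact n}.
      color L (rval (fact n) (shift i x)) = amin \<sigma> (coding n L x) div fact n \<and> rval (fact n) (shift i x) \<le> a"
      using chosen_obtain[OF \<sigma>, of n L x] by auto
  next
    assume "\<exists>i\<in>{0..<fact n}.
      color L (rval (fact n) (shift i x)) = amin \<sigma> (coding n L x) div fact n \<and> rval (fact n) (shift i x) \<le> a"
    then obtain i where i: "i \<in> {0..<fact n}" "color L (rval (fact n) (shift i x)) = amin \<sigma> (coding n L x) div fact n"
      "rval (fact n) (shift i x) \<le> a" by blast
    have "chosen \<sigma> n L x \<le> rval (fact n) (shift i x)"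
      unfolding chosen_def using i(1,2)
      by (intro Min_le finite_imageI imageI) (auto intro: finite_subset[of _ "{0..<fact n}"])
    then show "chosen \<sigma> n L x \<le> a" using i(3) by simp
  qed
  have "Measurable.pred config_space (\<lambda>x. \<exists>i\<in>{0..<fact n}.
    color L (rval (fact n) (shift i x)) = amin \<sigma> (coding n L x) div fact n \<and> rval (fact n) (shift i x) \<le> a)"
    by (intro pred_intros_finite pred_intros_logic eq le) simp
  from predE[OF this] show "{x \<in> space config_space. chosen \<sigma> n L x \<le> a} \<in> sets config_space"
    unfolding * .
qed

section \<open>Finite subrelations given by equal chosen values\<close>

definition hash_rel :: "(nat \<Rightarrow> nat) \<Rightarrow> nat \<Rightarrow> nat \<Rightarrow> (config set \<times> config set) set" where
  "hash_rel \<sigma> n L = {(S, T) \<in> conjugacy_sep. chosen \<sigma> n L (point S) = chosen \<sigma> n L (point T)}"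

lemma hash_rel_measurable:
  assumes "\<sigma> permutes U"
  shows "hash_rel \<sigma> n L \<in> sets (subshift_space \<Otimes>\<^sub>M subshift_space)"
proof -
  note [measurable] = chosen_measurable[OF assms] conjugacy_sep_measurable
  have "{z \<in> space (subshift_space \<Otimes>\<^sub>M subshift_space). z \<in> conjugacy_sep
    \<and> chosen \<sigma> n L (point (fst z)) = chosen \<sigma> n L (point (snd z))} \<in> sets (subshift_space \<Otimes>\<^sub>M subshift_space)"
    by measurable
  moreover have "{z \<in> space (subshift_space \<Otimes>\<^sub>M subshift_space). z \<in> conjugacy_sep
    \<and> chosen \<sigma> n L (point (fst z)) = chosen \<sigma> n L (point (snd z))} = hash_rel \<sigma> n L"
    using sets.sets_into_space[OF conjugacy_sep_measurable] by (auto simp: hash_rel_def)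
  ultimately show ?thesis by simp
qed

text \<open>The chosen value is attained by \<open>rval\<close> at a shift of the selected point of
  T, so fixing it confines T to a finite fibre of \<open>rval\<close>.\<close>

lemma finite_hash_rel:
  assumes \<sigma>: "\<sigma> permutes U"
  shows "finite (hash_rel \<sigma> n L `` {S})"
proof (rule finite_subset[OF _ finite_rval_fiber[of "fact n" "chosen \<sigma> n L (point S)"]])
  show "hash_rel \<sigma> n L `` {S} \<subseteq> {T \<in> toeplitz_sep. \<exists>x\<in>T. rval (fact n) x = chosen \<sigma> n L (point S)}"
  proof
    fix T assume "T \<in> hash_rel \<sigma> n L `` {S}"
    then have T: "T \<in> toeplitz_sep" "chosen \<sigma> n L (point T) = chosen \<sigma> n L (point S)"
      by (auto simp: hash_rel_def conjugacy_sep_def)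
    obtain i where "chosen \<sigma> n L (point T) = rval (fact n) (shift i (point T))"
      using chosen_obtain[OF \<sigma>, of n L "point T"] by blast
    moreover have "shift i (point T) \<in> T"
      using toeplitz_sepD(1)[OF T(1)] point_in subshiftsD(3) by blast
    ultimately show "T \<in> {T \<in> toeplitz_sep. \<exists>x\<in>T. rval (fact n) x = chosen \<sigma> n L (point S)}"
      using T by (auto intro!: bexI[of _ "shift i (point T)"])
  qed
qed (rule fact_ge_1)

lemma equiv_hash_rel: "equiv toeplitz_sep (hash_rel \<sigma> n L)"
proof (rule equivI)
  show "hash_rel \<sigma> n L \<subseteq> toeplitz_sep \<times> toeplitz_sep"
    by (auto simp: hash_rel_def conjugacy_sep_def)
  show "refl_on toeplitz_sep (hash_rel \<sigma> n L)"
    by (auto simp: hash_rel_def conjugacy_sep_def refl_on_def intro: top_conjugate_refl)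
  show "sym (hash_rel \<sigma> n L)"
    using equiv_conjugacy_sep unfolding equiv_def sym_on_def hash_rel_def by auto
  show "trans (hash_rel \<sigma> n L)"
  proof (rule transI)
    fix S T V assume a: "(S, T) \<in> hash_rel \<sigma> n L" "(T, V) \<in> hash_rel \<sigma> n L"
    then have "(S, V) \<in> conjugacy_sep"
      using equiv_conjugacy_sep unfolding equiv_def by (auto simp: hash_rel_def dest: transD)
    then show "(S, V) \<in> hash_rel \<sigma> n L" using a by (auto simp: hash_rel_def)
  qed
qed

text \<open>The \<open>k\<close>-th partial conjugacy sends \<open>S\<close> to \<open>move k S\<close>; \<open>moved k S\<close> is the image of the chosen
  point of \<open>S\<close>. Where the code is not a conjugacy it is replaced by the identity.\<close>

definition moved :: "nat \<Rightarrow> config set \<Rightarrow> config" where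
  "moved k S = (case from_nat k of (c, d) \<Rightarrow>
     if ocl (code c (point S)) \<in> toeplitz_sep \<and> code_conj c d S (ocl (code c (point S)))
     then code c (point S) else point S)"

definition move :: "nat \<Rightarrow> config set \<Rightarrow> config set" where
  "move k S = ocl (moved k S)"

lemma moved_measurable [measurable]: "moved k \<in> measurable subshift_space config_space"
proof -
  note [measurable] = toeplitz_sep_measurable
  obtain c d :: "nat \<times> bool list list" where cd: "from_nat k = (c, d)"
    by (cases "from_nat k :: (nat \<times> bool list list) \<times> (nat \<times> bool list list)")
  have "Measurable.pred subshift_space (\<lambda>S. case (S, ocl (code c (point S))) of (S, T) \<Rightarrow> code_conj c d S T)"
    by (rule measurable_compose[OF _ code_conj_measurable]) measurable
  then have [measurable]: "Measurable.pred subshift_space (\<lambda>S. code_conj c d S (ocl (code c (point S))))"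
    by simp
  have "moved k = (\<lambda>S. if ocl (code c (point S)) \<in> toeplitz_sep \<and> code_conj c d S (ocl (code c (point S)))
     then code c (point S) else point S)"
    by (auto simp: moved_def cd)
  also have "\<dots> \<in> measurable subshift_space config_space" by measurable
  finally show ?thesis .
qed

lemma move_measurable [measurable]: "move k \<in> measurable subshift_space subshift_space"
  unfolding move_def[abs_def] by measurable

lemma moved_in [simp]: "moved k S \<in> move k S"
  by (simp add: move_def)

lemma move_conj:
  assumes S: "S \<in> toeplitz_sep"
  shows "(S, move k S) \<in> conjugacy_sep"
proof -
  obtain c d :: "nat \<times> bool list list" where cd: "from_nat k = (c, d)"
    by (cases "from_nat k :: (nat \<times> bool list list) \<times> (nat \<times> bool list list)")
  have p: "ocl (point S) = S" using toeplitz_sepD(3)[OF S] point_in toeplitz_sepD(1)[OF S] by blast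
  show ?thesis
  proof (cases "ocl (code c (point S)) \<in> toeplitz_sep \<and> code_conj c d S (ocl (code c (point S)))")
    case True
    then have "move k S = ocl (code c (point S))" by (simp add: move_def moved_def cd)
    then show ?thesis using True S unfolding conjugacy_sep_iff by metis
  next
    case False
    then have "move k S = S" using p by (auto simp: move_def moved_def cd)
    then show ?thesis using S by (simp add: conjugacy_sep_def top_conjugate_refl)
  qed
qed

lemma move_sep: "S \<in> toeplitz_sep \<Longrightarrow> move k S \<in> toeplitz_sep"
  using move_conj by (auto simp: conjugacy_sep_def)

text \<open>Countably many Borel maps cover the relation, so an exhaustion has to be verified only
  on the pairs (S, move k S).\<close>

lemma move_surj:
  assumes "(S, T) \<in> conjugacy_sep"
  shows "\<exists>k. T = move k S"
proof -
  obtain c d where ST: "S \<in> toeplitz_sep" "T \<in> toeplitz_sep" "code_conj c d S T"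
    using assms by (auto simp: conjugacy_sep_iff)
  have "code c (point S) \<in> T"
    using ST(3) point_in[OF toeplitz_sepD(1)[OF ST(1)]] by (auto simp: code_conj_def)
  then have "ocl (code c (point S)) = T" using toeplitz_sepD(3)[OF ST(2)] by blast
  then have "move (to_nat (c, d)) S = T" using ST by (simp add: move_def moved_def)
  then show ?thesis by blast
qed

lemma moved_density:
  assumes S: "S \<in> toeplitz_sep"
  shows "(\<lambda>n. real (card {i \<in> {0..<fact n}. rval (fact n) (shift i (point S)) \<noteq> rval (fact n) (shift i (moved k S))}) / fact n)
    \<longlonglongrightarrow> 0"
proof -
  obtain c d :: "nat \<times> bool list list" where cd: "from_nat k = (c, d)"
    by (cases "from_nat k :: (nat \<times> bool list list) \<times> (nat \<times> bool list list)")
  show ?thesis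
  proof (cases "ocl (code c (point S)) \<in> toeplitz_sep \<and> code_conj c d S (ocl (code c (point S)))")
    case True
    then have "moved k S = code c (point S)" by (simp add: moved_def cd)
    then show ?thesis
      using rval_code_density[OF S conjunct1[OF True] conjunct2[OF True] point_in[OF toeplitz_sepD(1)[OF S]]] by simp
  next
    case False
    then have "moved k S = point S" by (auto simp: moved_def cd)
    then show ?thesis by simp
  qed
qed

section \<open>Measure estimates and the choice of a single order\<close>

lemma (in prob_space) measure_tendsto_0:
  assumes [measurable]: "\<And>n. A n \<in> sets M" and ev: "\<And>x. x \<in> space M \<Longrightarrow> \<forall>\<^sub>F n in sequentially. x \<notin> A n"
  shows "(\<lambda>n. measure M (A n)) \<longlonglongrightarrow> 0"
proof -
  have "(\<lambda>n. \<integral>x. indicator (A n) x \<partial>M) \<longlonglongrightarrow> (\<integral>x. (0::real) \<partial>M)"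
  proof (rule integral_dominated_convergence[where w = "\<lambda>_. 1"])
    show "AE x in M. (\<lambda>n. indicator (A n) x :: real) \<longlonglongrightarrow> 0"
    proof (rule AE_I2)
      fix x assume "x \<in> space M"
      from ev[OF this] have "\<forall>\<^sub>F n in sequentially. (indicator (A n) x :: real) = 0"
        by eventually_elim simp
      then show "(\<lambda>n. indicator (A n) x :: real) \<longlonglongrightarrow> 0" by (rule tendsto_eventually)
    qed
  qed (auto simp: indicator_def)
  then show ?thesis by (simp add: emeasure_eq_measure)
qed

text \<open>Exchanging sum and integral turns a bound, for each single point, on the number of bad
  indices into a bound on the total measure.\<close>

lemma (in prob_space) sum_measure_le:
  assumes "finite I" and [measurable]: "\<And>i. i \<in> I \<Longrightarrow> A i \<in> sets M"
    and c: "\<And>x. x \<in> space M \<Longrightarrow> real (card {i \<in> I. x \<in> A i}) \<le> c"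
  shows "(\<Sum>i\<in>I. measure M (A i)) \<le> c"
proof -
  have "(\<Sum>i\<in>I. measure M (A i)) = (\<Sum>i\<in>I. \<integral>x. indicator (A i) x \<partial>M)"
    by (intro sum.cong) (auto simp: emeasure_eq_measure)
  also have "\<dots> = (\<integral>x. (\<Sum>i\<in>I. indicator (A i) x) \<partial>M)"
    by (rule Bochner_Integration.integral_sum[symmetric]) (auto simp: emeasure_eq_measure intro!: integrable_real_indicator)
  also have "\<dots> \<le> (\<integral>x. c \<partial>M)"
  proof (rule integral_mono)
    fix x assume "x \<in> space M"
    have "(\<Sum>i\<in>I. indicator (A i) x :: real) = real (card {i \<in> I. x \<in> A i})"
      using assms(1) by (simp add: indicator_def sum.If_cases Int_def)
    then show "(\<Sum>i\<in>I. indicator (A i) x) \<le> c" using c[OF \<open>x \<in> space M\<close>] by simp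
  qed (auto simp: emeasure_eq_measure intro!: integrable_real_indicator Bochner_Integration.integrable_sum)
  also have "\<dots> = c" by (simp add: prob_space)
  finally show ?thesis .
qed

lemma toeplitz_measure:
  assumes "sets \<mu> = sets (restrict_space subshift_space toeplitz_sep)"
  shows "space \<mu> = toeplitz_sep" "(\<lambda>S. S) \<in> measurable \<mu> subshift_space"
  using sets_eq_imp_space_eq[OF assms] id_restrict_measurable measurable_cong_sets[OF assms refl] by auto

text \<open>Three errors, each at most e / 3: too many disagreements (\<open>A\<close>, small for
  large n), confusion by rounding (\<open>B\<close>, small for large L once n is fixed), and an
  order that picks differently (\<open>C\<close>, small on average over all orders).\<close>

lemma finite_approximation:
  assumes "prob_space \<mu>" and sets: "sets \<mu> = sets (restrict_space subshift_space toeplitz_sep)" and e: "e > 0"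
  shows "\<exists>\<sigma> U n L. \<sigma> permutes U \<and> (\<forall>k<K. measure \<mu> {S \<in> space \<mu>. (S, move k S) \<notin> hash_rel \<sigma> n L} \<le> e)"
proof -
  interpret prob_space \<mu> by fact
  note sp = toeplitz_measure(1)[OF sets] and id = toeplitz_measure(2)[OF sets]
  note [measurable] = measurable_compose[OF id point_measurable] measurable_compose[OF id moved_measurable]
  \<comment> \<open>On average over the orders each of the K maps has error at most 2 \<delta> in
    \<open>C\<close>, in total 2 K \<delta> \<le> e / 3; the summand 1 avoids division by 0.\<close>
  define \<delta> where "\<delta> = e / (6 * (real K + 1))"
  have \<delta>: "\<delta> > 0" using e by (simp add: \<delta>_def)
  define bad where "bad n k S = real (card {i \<in> {0..<fact n :: int}.
    rval (fact n) (shift i (point S)) \<noteq> rval (fact n) (shift i (moved k S))})" for n k S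
  have bad_meas [measurable]: "bad n k \<in> borel_measurable \<mu>" for n k
  proof -
    have "bad n k = (\<lambda>S. \<Sum>i\<in>{0..<fact n :: int}.
      if rval (fact n) (shift i (point S)) \<noteq> rval (fact n) (shift i (moved k S)) then 1 else 0)"
      by (auto simp: bad_def fun_eq_iff sum.If_cases Int_def)
    also have "\<dots> \<in> borel_measurable \<mu>" by measurable
    finally show ?thesis .
  qed
  define A where "A n k = {S \<in> space \<mu>. bad n k S / fact n \<ge> \<delta>}" for n k
  have A_meas [measurable]: "A n k \<in> sets \<mu>" for n k unfolding A_def by measurable
  have "\<forall>\<^sub>F n in sequentially. \<forall>k\<in>{..<K}. measure \<mu> (A n k) < e / 3"
  proof (intro eventually_ball_finite ballI finite_lessThan)
    fix k
    have "(\<lambda>n. measure \<mu> (A n k)) \<longlonglongrightarrow> 0"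
    proof (rule measure_tendsto_0)
      fix S assume "S \<in> space \<mu>"
      then have "(\<lambda>n. bad n k S / fact n) \<longlonglongrightarrow> 0" using moved_density[of S k] sp by (simp add: bad_def)
      from order_tendstoD(2)[OF this \<delta>] show "\<forall>\<^sub>F n in sequentially. S \<notin> A n k"
        by eventually_elim (auto simp: A_def)
    qed simp
    then show "\<forall>\<^sub>F n in sequentially. measure \<mu> (A n k) < e / 3" using e by (intro order_tendstoD(2)) auto
  qed
  then obtain n where n: "\<And>k. k < K \<Longrightarrow> measure \<mu> (A n k) < e / 3"
    by (auto simp: eventually_sequentially)
  define B where "B L k = {S \<in> space \<mu>. \<not> separates n L (point S) (moved k S)}" for L k
  have B_meas [measurable]: "B L k \<in> sets \<mu>" for L k
  proof -
    have c: "(\<lambda>S. color L (rval p (shift i (point S)))) \<in> measurable \<mu> (count_space UNIV)"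
      "(\<lambda>S. color L (rval p (shift i (moved k S)))) \<in> measurable \<mu> (count_space UNIV)" for p i
      by (rule measurable_compose[OF _ color_rval_measurable],
          rule measurable_compose[OF id], measurable)+
    have r: "Measurable.pred \<mu> (\<lambda>S. rval p (shift i (point S)) = rval p (shift j (moved k S)))" for p i j
      by measurable
    have "Measurable.pred \<mu> (\<lambda>S. \<not> separates n L (point S) (moved k S))"
      unfolding separates_def
      by (intro pred_intros_finite pred_intros_logic measurable_eq_countable c r) simp_all
    then show ?thesis unfolding B_def by (rule predE)
  qed
  have "\<forall>\<^sub>F L in sequentially. \<forall>k\<in>{..<K}. measure \<mu> (B L k) < e / 3"
  proof (intro eventually_ball_finite ballI finite_lessThan)
    fix k
    have "(\<lambda>L. measure \<mu> (B L k)) \<longlonglongrightarrow> 0"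
    proof (rule measure_tendsto_0)
      fix S assume "S \<in> space \<mu>"
      from separates_eventually[of n "point S" "moved k S"] show "\<forall>\<^sub>F L in sequentially. S \<notin> B L k"
        by eventually_elim (auto simp: B_def)
    qed simp
    then show "\<forall>\<^sub>F L in sequentially. measure \<mu> (B L k) < e / 3" using e by (intro order_tendstoD(2)) auto
  qed
  then obtain L where L: "\<And>k. k < K \<Longrightarrow> measure \<mu> (B L k) < e / 3"
    by (auto simp: eventually_sequentially)
  \<comment> \<open>The ground set of \<open>card_pick_neq\<close>, with 2 L + 1 colours and n!
    indices.\<close>
  define U :: "nat set" where "U = {..<(2 * L + 1) * fact n}"
  let ?P = "{\<sigma>. \<sigma> permutes U}"
  have finP: "finite ?P" by (intro finite_permutations) (simp add: U_def)
  have "id \<in> ?P" using permutes_id[of U] by simp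
  then have P0: "card ?P > 0" using finP card_gt_0_iff[of ?P] by blast
  define C where "C \<sigma> k = {S \<in> space \<mu>. S \<notin> A n k \<and> amin \<sigma> (coding n L (point S)) \<noteq> amin \<sigma> (coding n L (moved k S))}" for \<sigma> k
  have C_meas: "C \<sigma> k \<in> sets \<mu>" if "\<sigma> permutes U" for \<sigma> k
  proof -
    have "(\<lambda>S. amin \<sigma> (coding n L (point S))) \<in> measurable \<mu> (count_space UNIV)"
      "(\<lambda>S. amin \<sigma> (coding n L (moved k S))) \<in> measurable \<mu> (count_space UNIV)"
      by (rule measurable_compose[OF _ amin_coding_measurable[OF that]], measurable)+
    then have "Measurable.pred \<mu> (\<lambda>S. \<not> amin \<sigma> (coding n L (point S)) = amin \<sigma> (coding n L (moved k S)))"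
      by (intro pred_intros_logic measurable_eq_countable)
    from sets.Diff[OF predE[OF this] A_meas[of n k]] show ?thesis
      unfolding C_def by (simp add: set_diff_eq conj_ac)
  qed
  have sumC: "(\<Sum>\<sigma>\<in>?P. measure \<mu> (C \<sigma> k)) \<le> 2 * \<delta> * card ?P" for k
  proof (rule sum_measure_le[OF finP])
    fix S assume "S \<in> space \<mu>"
    show "real (card {\<sigma> \<in> ?P. S \<in> C \<sigma> k}) \<le> 2 * \<delta> * card ?P"
    proof (cases "S \<in> A n k")
      case True
      then have "{\<sigma> \<in> ?P. S \<in> C \<sigma> k} = {}" by (auto simp: C_def)
      then show ?thesis using \<delta> by (simp only: card.empty) simp
    next
      case False
      let ?I = "{0..<fact n :: int}"
      let ?a = "\<lambda>i. rval (fact n) (shift i (point S))" and ?b = "\<lambda>i. rval (fact n) (shift i (moved k S))"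
      have "{\<sigma> \<in> ?P. S \<in> C \<sigma> k} \<subseteq> {\<sigma>. \<sigma> permutes U \<and> amin \<sigma> (coding n L (point S)) \<noteq> amin \<sigma> (coding n L (moved k S))}"
        by (auto simp: C_def)
      then have "card {\<sigma> \<in> ?P. S \<in> C \<sigma> k} \<le> card {\<sigma>. \<sigma> permutes U \<and> amin \<sigma> (coding n L (point S)) \<noteq> amin \<sigma> (coding n L (moved k S))}"
        by (rule card_mono[rotated]) (rule finite_subset[OF _ finP], auto)
      then have "card {\<sigma> \<in> ?P. S \<in> C \<sigma> k} * fact n \<le> card {\<sigma>. \<sigma> permutes U \<and> amin \<sigma> (coding n L (point S)) \<noteq> amin \<sigma> (coding n L (moved k S))} * fact n"
        by simp
      also have "\<dots> \<le> 2 * card {i \<in> ?I. color L (?a i) \<noteq> color L (?b i)} * card ?P"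
        using card_pick_neq[of ?I "\<lambda>i. color L (?a i)" "2 * L + 1" "\<lambda>i. color L (?b i)"] color_rval_less
        unfolding card_index coding_def U_def by auto
      also have "\<dots> \<le> 2 * card {i \<in> ?I. ?a i \<noteq> ?b i} * card ?P"
        by (intro mult_right_mono mult_left_mono card_mono) (auto intro: finite_subset[of _ ?I])
      finally have "real (card {\<sigma> \<in> ?P. S \<in> C \<sigma> k} * fact n) \<le> real (2 * card {i \<in> ?I. ?a i \<noteq> ?b i} * card ?P)"
        by (simp only: of_nat_le_iff)
      then have "real (card {\<sigma> \<in> ?P. S \<in> C \<sigma> k}) * fact n \<le> 2 * bad n k S * card ?P"
        by (simp add: bad_def)
      also have "\<dots> \<le> 2 * (\<delta> * fact n) * card ?P"
      proof (intro mult_right_mono mult_left_mono)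
        have "bad n k S / fact n < \<delta>" using False \<open>S \<in> space \<mu>\<close> by (simp add: A_def)
        then show "bad n k S \<le> \<delta> * fact n" by (simp add: field_simps)
      qed auto
      finally have "real (card {\<sigma> \<in> ?P. S \<in> C \<sigma> k}) * fact n \<le> (2 * \<delta> * card ?P) * fact n"
        by (simp add: mult_ac)
      then show ?thesis by (rule mult_right_le_imp_le) simp
    qed
  qed (use C_meas in auto)
  \<comment> \<open>Some order does not exceed the average. Summing over k first makes this one
    order good for all k < K.\<close>
  have "\<exists>\<sigma>\<in>?P. (\<Sum>k<K. measure \<mu> (C \<sigma> k)) \<le> real K * (2 * \<delta>)"
  proof (rule ccontr)
    assume "\<not> ?thesis"
    then have "(\<Sum>\<sigma>\<in>?P. real K * (2 * \<delta>)) < (\<Sum>\<sigma>\<in>?P. \<Sum>k<K. measure \<mu> (C \<sigma> k))"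
      using P0 finP by (intro sum_strict_mono) (auto simp: not_le card_gt_0_iff)
    also have "\<dots> = (\<Sum>k<K. \<Sum>\<sigma>\<in>?P. measure \<mu> (C \<sigma> k))" by (rule sum.swap)
    also have "\<dots> \<le> (\<Sum>k<K. 2 * \<delta> * card ?P)" by (rule sum_mono) (rule sumC)
    finally show False by (simp add: mult_ac)
  qed
  then obtain \<sigma> where \<sigma>: "\<sigma> permutes U" "(\<Sum>k<K. measure \<mu> (C \<sigma> k)) \<le> real K * (2 * \<delta>)" by blast
  have "measure \<mu> {S \<in> space \<mu>. (S, move k S) \<notin> hash_rel \<sigma> n L} \<le> e" if k: "k < K" for k
  proof -
    have "measure \<mu> (C \<sigma> k) \<le> (\<Sum>k<K. measure \<mu> (C \<sigma> k))"
      using k by (intro member_le_sum) auto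
    also have "\<dots> \<le> e / 3"
    proof -
      have "real K + 1 \<noteq> 0" by linarith
      then have "real K * (2 * \<delta>) = (e / 3) * (real K / (real K + 1))"
        unfolding \<delta>_def by (simp add: divide_simps del: of_nat_Suc)
      also have "\<dots> \<le> (e / 3) * 1" using e by (intro mult_left_mono) auto
      finally show ?thesis using \<sigma>(2) by simp
    qed
    finally have Ck: "measure \<mu> (C \<sigma> k) \<le> e / 3" .
    have "{S \<in> space \<mu>. (S, move k S) \<notin> hash_rel \<sigma> n L} \<subseteq> A n k \<union> B L k \<union> C \<sigma> k"
    proof (rule subsetI, rule ccontr)
      fix S assume S: "S \<in> {S \<in> space \<mu>. (S, move k S) \<notin> hash_rel \<sigma> n L}" and "S \<notin> A n k \<union> B L k \<union> C \<sigma> k"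
      then have "separates n L (point S) (moved k S)" "amin \<sigma> (coding n L (point S)) = amin \<sigma> (coding n L (moved k S))"
        by (auto simp: B_def C_def)
      from chosen_eq_if_separates[OF \<sigma>(1) this] have c: "chosen \<sigma> n L (point S) = chosen \<sigma> n L (moved k S)" .
      have T: "S \<in> toeplitz_sep" using S sp by auto
      have "chosen \<sigma> n L (moved k S) = chosen \<sigma> n L (point (move k S))"
        by (rule chosen_eq[OF move_sep[OF T]]) (auto intro: point_in toeplitz_sepD(1) move_sep[OF T])
      then show False using S c move_conj[OF T] by (auto simp: hash_rel_def)
    qed
    then have "measure \<mu> {S \<in> space \<mu>. (S, move k S) \<notin> hash_rel \<sigma> n L} \<le> measure \<mu> (A n k \<union> B L k \<union> C \<sigma> k)"
      using C_meas[OF \<sigma>(1), of k] by (intro finite_measure_mono) auto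
    also have "\<dots> \<le> measure \<mu> (A n k \<union> B L k) + measure \<mu> (C \<sigma> k)"
      using C_meas[OF \<sigma>(1), of k] by (intro measure_Un_le) auto
    also have "measure \<mu> (A n k \<union> B L k) \<le> measure \<mu> (A n k) + measure \<mu> (B L k)"
      by (intro measure_Un_le) auto
    finally show ?thesis using n[OF k] L[OF k] Ck by simp
  qed
  then show ?thesis using \<sigma>(1) by blast
qed

text \<open>The relations for different m need not be nested. Intersecting over the tail from l on
  gives relations that increase with l and stay finite, being contained in the l-th one.\<close>

lemma finite_borel_equiv_hash_INT:
  fixes l :: nat
  assumes \<sigma>: "\<And>m. \<sigma> m permutes U m" and N: "(\<lambda>S. S) \<in> measurable N subshift_space" "space N \<subseteq> toeplitz_sep"
  shows "finite_borel_equiv N ((\<Inter>m\<in>{l..}. hash_rel (\<sigma> m) (n m) (L m)) \<inter> space N \<times> space N)"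
  unfolding finite_borel_equiv_def borel_equiv_def
proof (intro conjI ballI)
  let ?F = "\<lambda>m. hash_rel (\<sigma> m) (n m) (L m)"
  have F: "refl_on toeplitz_sep (?F m)" "sym (?F m)" "trans (?F m)" for m
    using equiv_hash_rel unfolding equiv_def by blast+
  show "equiv (space N) ((\<Inter>m\<in>{l..}. ?F m) \<inter> space N \<times> space N)"
  proof (rule equivI)
    show "refl_on (space N) ((\<Inter>m\<in>{l..}. ?F m) \<inter> space N \<times> space N)"
      using F(1) N(2) unfolding refl_on_def by blast
    show "sym ((\<Inter>m\<in>{l..}. ?F m) \<inter> space N \<times> space N)"
      by (rule symI) (auto dest: symD[OF F(2)])
    show "trans ((\<Inter>m\<in>{l..}. ?F m) \<inter> space N \<times> space N)"
      by (rule transI) (auto intro: transD[OF F(3)])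
  qed auto
  have "(\<Inter>m\<in>{l..}. ?F m) \<in> sets (subshift_space \<Otimes>\<^sub>M subshift_space)"
    by (rule sets.countable_INT') (use hash_rel_measurable[OF \<sigma>] in auto)
  from measurable_sets[OF id_pair_measurable[OF N(1)] this]
  show "(\<Inter>m\<in>{l..}. ?F m) \<inter> space N \<times> space N \<in> sets (N \<Otimes>\<^sub>M N)"
    by (simp add: space_pair_measure)
  show "finite (((\<Inter>m\<in>{l..}. ?F m) \<inter> space N \<times> space N) `` {S})" for S
    by (rule finite_subset[OF _ finite_hash_rel[OF \<sigma>[of l]]]) auto
qed

lemma hyperfinite_ae_conjugacy_sep:
  assumes prob: "prob_space \<mu>" and sets: "sets \<mu> = sets (restrict_space subshift_space toeplitz_sep)"
  shows "hyperfinite_ae \<mu> conjugacy_sep"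
proof -
  interpret prob_space \<mu> by fact
  note sp = toeplitz_measure(1)[OF sets] and id = toeplitz_measure(2)[OF sets]
  \<comment> \<open>The m-th relation treats the first m maps with error 2^(-m), which is summable
    for Borel-Cantelli.\<close>
  have "\<forall>m. \<exists>\<sigma> U n L. \<sigma> permutes U \<and> (\<forall>k<m. measure \<mu> {S \<in> space \<mu>. (S, move k S) \<notin> hash_rel \<sigma> n L} \<le> (1/2) ^ m)"
    using finite_approximation[OF prob sets] by simp
  then obtain \<sigma> U n L where a: "\<forall>m. \<sigma> m permutes U m \<and>
    (\<forall>k<m. measure \<mu> {S \<in> space \<mu>. (S, move k S) \<notin> hash_rel (\<sigma> m) (n m) (L m)} \<le> (1/2) ^ m)"
    unfolding choice_iff by blast
  then have \<sigma>: "\<And>m. \<sigma> m permutes U m"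
    and small: "\<And>m k. k < m \<Longrightarrow> measure \<mu> {S \<in> space \<mu>. (S, move k S) \<notin> hash_rel (\<sigma> m) (n m) (L m)} \<le> (1/2) ^ m"
    by blast+
  define F where "F m = hash_rel (\<sigma> m) (n m) (L m)" for m
  have F_meas [measurable]: "F m \<in> sets (subshift_space \<Otimes>\<^sub>M subshift_space)" for m
    unfolding F_def by (rule hash_rel_measurable[OF \<sigma>])
  have [measurable]: "Measurable.pred \<mu> (\<lambda>S. (S, move k S) \<in> F m)" for k m
  proof -
    have "(\<lambda>S. (S, move k S)) \<in> measurable \<mu> (subshift_space \<Otimes>\<^sub>M subshift_space)"
      by (intro measurable_Pair id measurable_compose[OF id move_measurable])
    then show ?thesis by measurable
  qed
  \<comment> \<open>The points whose every pair (S, move k S) lies in all but finitely many of the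
    relations, hence in some tail intersection.\<close>
  define A where "A = {S \<in> space \<mu>. \<forall>k. \<exists>l. \<forall>m. l \<le> m \<longrightarrow> (S, move k S) \<in> F m}"
  have A_meas: "A \<in> sets \<mu>" unfolding A_def by measurable
  have "AE S in \<mu>. \<forall>k. \<exists>l. \<forall>m. l \<le> m \<longrightarrow> (S, move k S) \<in> F m"
    unfolding AE_all_countable
  proof
    fix k
    \<comment> \<open>The estimate covers only m > k; the finitely many earlier sets are replaced by
      {}.\<close>
    let ?B = "\<lambda>m. if k < m then {S \<in> space \<mu>. (S, move k S) \<notin> F m} else {}"
    have "AE S in \<mu>. \<forall>\<^sub>F m in sequentially. S \<in> space \<mu> - ?B m"
    proof (rule borel_cantelli_AE1)
      show "summable (\<lambda>m. measure \<mu> (?B m))"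
        by (rule summable_comparison_test'[of "\<lambda>m. (1/2) ^ m" 0]) (use small in \<open>auto simp: F_def\<close>)
    qed (auto simp: emeasure_eq_measure)
    then show "AE S in \<mu>. \<exists>l. \<forall>m. l \<le> m \<longrightarrow> (S, move k S) \<in> F m"
    proof (rule AE_mp, intro AE_I2 impI)
      fix S assume "S \<in> space \<mu>" "\<forall>\<^sub>F m in sequentially. S \<in> space \<mu> - ?B m"
      then obtain l where l: "\<And>m. l \<le> m \<Longrightarrow> S \<notin> ?B m" by (auto simp: eventually_sequentially)
      have "(S, move k S) \<in> F m" if "max l (Suc k) \<le> m" for m
        using l[of m] that \<open>S \<in> space \<mu>\<close> by auto
      then show "\<exists>l. \<forall>m. l \<le> m \<longrightarrow> (S, move k S) \<in> F m" by blast
    qed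
  qed
  then have null: "space \<mu> - A \<in> null_sets \<mu>"
    using A_meas by (subst AE_iff_null_sets) (auto simp: A_def)
  let ?N = "restrict_space \<mu> A"
  have spN: "space ?N = A" using A_meas sets.sets_into_space by (auto simp: space_restrict_space)
  have idN: "(\<lambda>S. S) \<in> measurable ?N subshift_space" using id by (rule measurable_restrict_space1)
  have subN: "space ?N \<subseteq> toeplitz_sep"
    unfolding spN using sets.sets_into_space[OF A_meas] sp by simp
  define G where "G l = (\<Inter>m\<in>{l..}. F m) \<inter> A \<times> A" for l
  have "hyperfinite ?N (conjugacy_sep \<inter> A \<times> A)"
    unfolding hyperfinite_def
  proof (intro conjI exI[of _ G] allI)
    show "countable_borel_equiv ?N (conjugacy_sep \<inter> A \<times> A)"
      using countable_borel_equiv_conjugacy[OF idN subN] unfolding spN .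
    show "finite_borel_equiv ?N (G l)" for l
      using finite_borel_equiv_hash_INT[OF \<sigma> idN subN] unfolding spN G_def F_def .
    show "incseq G" unfolding incseq_def G_def by force
    show "conjugacy_sep \<inter> A \<times> A = (\<Union>l. G l)"
    proof (intro subset_antisym subsetI)
      fix z assume "z \<in> conjugacy_sep \<inter> A \<times> A"
      then obtain S T where z: "z = (S, T)" "(S, T) \<in> conjugacy_sep" "S \<in> A" "T \<in> A" by (cases z) auto
      obtain k where k: "T = move k S" using move_surj[OF z(2)] by blast
      obtain l where "\<And>m. l \<le> m \<Longrightarrow> (S, T) \<in> F m" using z(3) k by (auto simp: A_def)
      then have "z \<in> G l" using z by (auto simp: G_def)
      then show "z \<in> (\<Union>l. G l)" by blast
    next
      fix z assume "z \<in> (\<Union>l. G l)"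
      then show "z \<in> conjugacy_sep \<inter> A \<times> A" by (auto simp: G_def F_def hash_rel_def)
    qed
  qed
  then show ?thesis unfolding hyperfinite_ae_def using A_meas null by blast
qed

theorem theorem1p1:
  shows "standard_borel subshift_space
    \<and> toeplitz_sep \<in> sets subshift_space
    \<and> amenable (restrict_space subshift_space toeplitz_sep) conjugacy_sep
    \<and> (\<forall>\<mu> :: (int \<Rightarrow> bool) set measure.
         prob_space \<mu> \<and> sets \<mu> = sets (restrict_space subshift_space toeplitz_sep)
           \<longrightarrow> hyperfinite_ae \<mu> conjugacy_sep)"
  using standard_borel_subshift_space toeplitz_sep_measurable amenable_conjugacy_sep
    hyperfinite_ae_conjugacy_sep by blast

end
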